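(* Let $M,m,A,A_1,B,B_1>0$, $\mu:=\frac{2M+m}{m}$, $\gamma:=\frac{16B_1}{B}$, and assume $\mu>1+\frac{A}{4A_1}$, $\mu>1+\frac{B}{16B_1}$ and $(\mu-1)^{4/15}\left(\frac{4A_1}{A}\right)^{2/3}\neq\left(\frac{16B_1}{B}\right)^{2/5}$. If $$\cos^2\left(\left(\frac{4}{1+\gamma}\right)^{1/2}\left(1-\frac1\mu\right)^{3/4}\left(1+\frac{\gamma^{2/5}}{(\mu-1)^{3/5}}\right)^{5/4}\right)\le\frac{1}{\left(1-\frac1\mu\right)\left(1+\frac{\gamma^{2/5}}{(\mu-1)^{3/5}}\right)},$$ then on the triple collision manifold $\Delta$ all orbits emerging from $Q$ end in $\mathcal B_+(0)$ or $\mathcal B_-(0)$, except for two orbits, which end in $E_+$ and $E_-$.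
   Context: Let $W(\theta)=\left(\tfrac M2\right)^{3/2}\left(\tfrac{B}{\cos^3\theta}+\tfrac{16B_1}{(\cos^2\theta+\mu\sin^2\theta)^{3/2}}\right)$ and $U(\theta)=W(\theta)\cos^3\theta$ (positive on $[-\pi/2,\pi/2]$). The triple collision manifold of the isosceles Schwarzschild problem is $$\Delta=\left\{(v,\theta,w)\in\mathbb R\times[-\tfrac\pi2,\tfrac\pi2]\times\mathbb R:\ w^2+\tfrac{\cos^6\theta}{U(\theta)}v^2=2\cos^3\theta\right\}$$ (the set $r=0$), with the flow of $$v'=\tfrac{\cos^3\theta}{2\sqrt U}v^2-\sqrt U,\quad \theta'=w,\quad w'=\tfrac{\cos^3\theta}{2\sqrt U}vw+\tfrac{U'(\theta)}{U}\left(\cos^3\theta-\tfrac{w^2}{2}\right)-3\sin\theta\cos^2\theta+\tfrac{3\sin\theta\cos^5\theta}{U}v^2 .$$ The angle $\theta_w\in(0,\pi/2)$ is defined by $\cos\theta_w=\sqrt{\frac{\mu}{(\mu-1)+(\mu-1)^{2/5}\gamma^{2/5}}}$. In coordinates $(v,\theta,w)$, the equilibria are $Q=(\sqrt{2W(0)},0,0)$ and $E_\pm=(\sqrt{2W(\theta_w)},\pm\theta_w,0)$. $\mathcal B_\pm(0)=\{\theta=\pm\pi/2,\ w=0\}\subset\Delta$. An orbit emerges from $Q$ if it is non-constant and tends to $Q$ as time tends to $-\infty$; it ends in $E_\pm$ if it tends to $E_\pm$ as time tends to $+\infty$; it ends in $\mathcal B_\pm(0)$ if $\theta\to\pm\pi/2$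 and $w\to0$ as time tends to $+\infty$. *)

theory Defs
  imports "HOL-Analysis.Analysis"
begin

text \<open>Points of phase space are triples \<open>(v, \<theta>, w)\<close>.\<close>

definition W :: "real \<Rightarrow> real \<Rightarrow> real \<Rightarrow> real \<Rightarrow> real \<Rightarrow> real" where
  "W M B B1 \<mu> \<theta> =
     (M / 2) powr (3/2) *
       (B / cos \<theta> ^ 3 + 16 * B1 / ((cos \<theta>)\<^sup>2 + \<mu> * (sin \<theta>)\<^sup>2) powr (3/2))"

text \<open>
  \<open>U = W cos\<^sup>3\<close> must be read as the smooth extension to \<open>\<theta> = \<plusminus>\<pi>/2\<close>, where \<open>U > 0\<close>. Since
  \<open>x / 0 = 0\<close> in HOL, the literal product would vanish there, so the factor \<open>cos\<^sup>3\<close> is multiplied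
  out; lemma \<open>U_eq_W_cos\<close> below relates the two.
\<close>

definition U :: "real \<Rightarrow> real \<Rightarrow> real \<Rightarrow> real \<Rightarrow> real \<Rightarrow> real" where
  "U M B B1 \<mu> \<theta> =
     (M / 2) powr (3/2) *
       (B + 16 * B1 * cos \<theta> ^ 3 / ((cos \<theta>)\<^sup>2 + \<mu> * (sin \<theta>)\<^sup>2) powr (3/2))"

lemma U_eq_W_cos: "cos \<theta> \<noteq> 0 \<Longrightarrow> U M B B1 \<mu> \<theta> = W M B B1 \<mu> \<theta> * cos \<theta> ^ 3"
  by (simp add: U_def W_def field_simps)

lemma U_pos:
  assumes "M > 0" "B > 0" "B1 > 0" "\<theta> \<in> {- (pi / 2)..pi / 2}"
  shows "U M B B1 \<mu> \<theta> > 0"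
proof -
  have "cos \<theta> \<ge> 0" using assms(4) by (intro cos_ge_zero) auto
  then have "16 * B1 * cos \<theta> ^ 3 / ((cos \<theta>)\<^sup>2 + \<mu> * (sin \<theta>)\<^sup>2) powr (3/2) \<ge> 0"
    using assms(3) by simp
  then show ?thesis unfolding U_def using assms(1,2) by (intro mult_pos_pos) auto
qed

definition collision_manifold ::
    "real \<Rightarrow> real \<Rightarrow> real \<Rightarrow> real \<Rightarrow> (real \<times> real \<times> real) set" where
  "collision_manifold M B B1 \<mu> =
     {(v, \<theta>, w). \<theta> \<in> {- (pi / 2)..pi / 2} \<and>
        w\<^sup>2 + cos \<theta> ^ 6 / U M B B1 \<mu> \<theta> * v\<^sup>2 = 2 * cos \<theta> ^ 3}"

definition collision_field ::
    "real \<Rightarrow> real \<Rightarrow> real \<Rightarrow> real \<Rightarrow> real \<times> real \<times> real \<Rightarrow> real \<times> real \<times> real" where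
  "collision_field M B B1 \<mu> = (\<lambda>(v, \<theta>, w).
     let u = U M B B1 \<mu> \<theta>; u' = deriv (U M B B1 \<mu>) \<theta> in
     (cos \<theta> ^ 3 / (2 * sqrt u) * v\<^sup>2 - sqrt u,
      w,
      cos \<theta> ^ 3 / (2 * sqrt u) * v * w + u' / u * (cos \<theta> ^ 3 - w\<^sup>2 / 2)
        - 3 * sin \<theta> * (cos \<theta>)\<^sup>2 + 3 * sin \<theta> * cos \<theta> ^ 5 / u * v\<^sup>2))"

text \<open>
  Trajectories are defined for all times. This excludes nothing: on the manifold
  \<open>cos\<^sup>6 / U * v\<^sup>2 \<le> 2 cos\<^sup>3\<close>, so \<open>v'\<close> lies between \<open>- sqrt U\<close> and \<open>0\<close> while \<open>\<theta>\<close> and \<open>w\<close> are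
  bounded, and the flow is complete. The orbit of a trajectory \<open>x\<close> is \<open>range x\<close>.
\<close>

definition trajectory ::
    "real \<Rightarrow> real \<Rightarrow> real \<Rightarrow> real \<Rightarrow> (real \<Rightarrow> real \<times> real \<times> real) \<Rightarrow> bool" where
  "trajectory M B B1 \<mu> x \<longleftrightarrow>
     (\<forall>t. x t \<in> collision_manifold M B B1 \<mu> \<and>
          (x has_vector_derivative collision_field M B B1 \<mu> (x t)) (at t))"

definition emerges_from ::
    "(real \<Rightarrow> real \<times> real \<times> real) \<Rightarrow> real \<times> real \<times> real \<Rightarrow> bool" where
  "emerges_from x P \<longleftrightarrow> \<not> x constant_on UNIV \<and> (x \<longlongrightarrow> P) at_bot"

definition ends_in ::
    "(real \<Rightarrow> real \<times> real \<times> real) \<Rightarrow> real \<times> real \<times> real \<Rightarrow> bool" where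
  "ends_in x P \<longleftrightarrow> (x \<longlongrightarrow> P) at_top"

definition ends_in_B_plus :: "(real \<Rightarrow> real \<times> real \<times> real) \<Rightarrow> bool" where
  "ends_in_B_plus x \<longleftrightarrow>
     ((\<lambda>t. fst (snd (x t))) \<longlongrightarrow> pi / 2) at_top \<and> ((\<lambda>t. snd (snd (x t))) \<longlongrightarrow> 0) at_top"

definition ends_in_B_minus :: "(real \<Rightarrow> real \<times> real \<times> real) \<Rightarrow> bool" where
  "ends_in_B_minus x \<longleftrightarrow>
     ((\<lambda>t. fst (snd (x t))) \<longlongrightarrow> - (pi / 2)) at_top \<and> ((\<lambda>t. snd (snd (x t))) \<longlongrightarrow> 0) at_top"

definition theta_w :: "real \<Rightarrow> real \<Rightarrow> real" where
  "theta_w \<mu> \<gamma> =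
     arccos (sqrt (\<mu> / ((\<mu> - 1) + (\<mu> - 1) powr (2/5) * \<gamma> powr (2/5))))"

lemma theta_w:
  assumes "\<mu> > 1" "\<gamma> > 0" "\<mu> > 1 + 1 / \<gamma>"
  shows "theta_w \<mu> \<gamma> \<in> {0<..<pi / 2}"
    and "cos (theta_w \<mu> \<gamma>) = sqrt (\<mu> / ((\<mu> - 1) + (\<mu> - 1) powr (2/5) * \<gamma> powr (2/5)))"
proof -
  let ?c = "sqrt (\<mu> / ((\<mu> - 1) + (\<mu> - 1) powr (2/5) * \<gamma> powr (2/5)))"
  have "(\<mu> - 1) * \<gamma> > 1" using assms by (simp add: field_simps)
  then have "((\<mu> - 1) * \<gamma>) powr (2/5) > 1" by simp
  then have "(\<mu> - 1) powr (2/5) * \<gamma> powr (2/5) > 1" using assms by (simp add: powr_mult)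
  then have c: "0 < ?c" "?c < 1" using assms(1) by simp_all
  have c': "- 1 \<le> ?c" "?c \<le> 1" using c by linarith+
  show "cos (theta_w \<mu> \<gamma>) = ?c" unfolding theta_w_def by (rule cos_arccos[OF c'])
  have "arccos ?c < arccos 0" "arccos 1 < arccos ?c"
    by (rule arccos_less_arccos; use c c' in linarith)+
  then show "theta_w \<mu> \<gamma> \<in> {0<..<pi / 2}" unfolding theta_w_def by simp
qed

definition Q :: "real \<Rightarrow> real \<Rightarrow> real \<Rightarrow> real \<Rightarrow> real \<times> real \<times> real" where
  "Q M B B1 \<mu> = (sqrt (2 * W M B B1 \<mu> 0), 0, 0)"

definition E_plus :: "real \<Rightarrow> real \<Rightarrow> real \<Rightarrow> real \<Rightarrow> real \<Rightarrow> real \<times> real \<times> real" where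
  "E_plus M B B1 \<mu> \<gamma> = (sqrt (2 * W M B B1 \<mu> (theta_w \<mu> \<gamma>)), theta_w \<mu> \<gamma>, 0)"

definition E_minus :: "real \<Rightarrow> real \<Rightarrow> real \<Rightarrow> real \<Rightarrow> real \<Rightarrow> real \<times> real \<times> real" where
  "E_minus M B B1 \<mu> \<gamma> = (sqrt (2 * W M B B1 \<mu> (theta_w \<mu> \<gamma>)), - theta_w \<mu> \<gamma>, 0)"

end

theory Submission
  imports Defs
begin

text \<open>
  Write \<open>s = sqrt (2 * W \<theta>\<^sub>w)\<close> for the value of \<open>v\<close> at the saddles \<open>E\<^sub>\<plusminus>\<close>. On \<open>\<Delta>\<close> the energy
  relation turns the first equation into \<open>v' = - sqrt U * w\<^sup>2 / (2 * cos\<^sup>3 \<theta>)\<close>, so \<open>v\<close> never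
  increases, and a motion with \<open>w > 0\<close> obeys \<open>dv/d\<theta> = - sqrt (2 * W \<theta> - v\<^sup>2) / 2\<close>. The function
  \<open>W\<close> is even, decreases on \<open>(0, \<theta>\<^sub>w)\<close> and increases on \<open>(\<theta>\<^sub>w, \<pi>/2)\<close>. Hence the part of \<open>\<Delta>\<close> with
  \<open>v > s\<close> and \<open>\<bar>\<theta>\<bar> < \<theta>\<^sub>w\<close> is a disc, the cap, with \<open>Q\<close> at its top and with \<open>E\<^sub>\<plusminus>\<close> on its rim. The
  orbits through the cap other than \<open>Q\<close> emerge from \<open>Q\<close>, and every orbit that emerges from \<open>Q\<close> starts
  in it.

  \<^item> An orbit that leaves the cap crosses the level \<open>v = s\<close> with \<open>\<bar>\<theta>\<bar> < \<theta>\<^sub>w\<close> and \<open>w \<noteq> 0\<close>, say \<open>w > 0\<close>.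
  While \<open>\<theta> \<le> \<theta>\<^sub>w\<close>, the value \<open>v\<close> drops by less than \<open>2 * \<theta>\<^sub>w * sqrt (2 * W 0) / 2\<close>. The argument of
  the cosine in the hypothesis is \<open>2 * sqrt (W \<theta>\<^sub>w / W 0)\<close> and the right hand side is \<open>cos\<^sup>2 \<theta>\<^sub>w\<close>, so
  the hypothesis gives \<open>\<theta>\<^sub>w \<le> 2 * sqrt (W \<theta>\<^sub>w / W 0)\<close>: the drop is less than \<open>2 * s\<close>, and \<open>v > - s\<close>
  when \<open>\<theta>\<close> reaches \<open>\<theta>\<^sub>w\<close>. Up to there \<open>\<bar>v\<bar> < s\<close> keeps \<open>w\<close> away from \<open>0\<close>; beyond \<open>\<theta>\<^sub>w\<close>, \<open>W' > 0\<close> makes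
  \<open>w' > 0\<close> wherever \<open>w = 0\<close>. So \<open>w\<close> stays positive, and \<open>\<theta>\<close> increases to \<open>\<pi>/2\<close> (\<open>right_exit\<close>).

  \<^item> An orbit that stays in the cap converges to a rest point, by a LaSalle argument with the
  monotone quantity \<open>v\<close>, and only \<open>E\<^sub>+\<close> and \<open>E\<^sub>-\<close> are left (\<open>ends_at_saddle\<close>).

  \<^item> At most one orbit in the cap ends in \<open>E\<^sub>+\<close>: near \<open>E\<^sub>+\<close> two such orbits are graphs over \<open>\<theta>\<close>, and the
  square of their difference does not decrease while it tends to \<open>0\<close> (\<open>connection_unique\<close>).

  \<^item> There is one: on a half circle around \<open>Q\<close> from a point to its mirror image, the starting points
  whose orbits leave to the right and those whose orbits leave to the left form disjoint open sets,
  exchanged by the reflection. By connectedness some orbit does not leave (\<open>connection_exists\<close>).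

  The motion in the cap is studied in the angle \<open>\<psi>\<close> with \<open>v = sqrt (2 * W \<theta>) * cos \<psi>\<close> and
  \<open>w = sqrt (2 * cos\<^sup>3 \<theta>) * sin \<psi>\<close>. This gives a planar system that becomes globally Lipschitz once
  \<open>\<theta>\<close> is clamped to \<open>[- \<theta>\<^sub>w, \<theta>\<^sub>w]\<close> in its coefficients; then all solutions exist for all times.
\<close>

section \<open>Global solutions of Lipschitz equations\<close>

text \<open>
  For \<open>t < 0\<close> this is minus the integral over \<open>[t, 0]\<close>, so that \<open>signed_integral f\<close> is an
  antiderivative of a continuous \<open>f\<close> on the whole line.
\<close>

definition signed_integral :: "(real \<Rightarrow> 'a::banach) \<Rightarrow> real \<Rightarrow> 'a" where
  "signed_integral f t = integral {0..t} f - integral {t..0} f"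

lemma signed_integral_from:
  fixes f :: "real \<Rightarrow> 'a::banach"
  assumes f: "continuous_on UNIV f" and t: "a \<le> t" and "a \<le> 0"
  shows "signed_integral f t = integral {a..t} f - integral {a..0} f"
proof -
  have int: "f integrable_on {u..v}" for u v
    by (rule integrable_continuous_real) (rule continuous_on_subset[OF f], simp)
  show ?thesis
  proof (cases "0 \<le> t")
    case True
    have "integral {a..0} f + integral {0..t} f = integral {a..t} f"
      using True assms int by (intro Henstock_Kurzweil_Integration.integral_combine) auto
    moreover have "integral {t..0} f = 0" using True by (cases "t = 0") auto
    ultimately show ?thesis by (simp add: signed_integral_def algebra_simps)
  next
    case False
    have "integral {a..t} f + integral {t..0} f = integral {a..0} f"
      using False assms int by (intro Henstock_Kurzweil_Integration.integral_combine) auto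
    then show ?thesis using False by (simp add: signed_integral_def algebra_simps)
  qed
qed

lemma signed_integral_derivative:
  fixes f :: "real \<Rightarrow> 'a::banach"
  assumes f: "continuous_on UNIV f"
  shows "(signed_integral f has_vector_derivative f t) (at t)"
proof -
  define n where "n = \<bar>t\<bar> + 1"
  have "((\<lambda>u. integral {-n..u} f) has_vector_derivative f t) (at t within {-n..n})"
    by (rule integral_has_vector_derivative)
       (use f in \<open>auto intro: continuous_on_subset simp: n_def\<close>)
  then have "((\<lambda>u. integral {-n..u} f) has_vector_derivative f t) (at t within {-n<..<n})"
    by (rule has_vector_derivative_within_subset) auto
  then have "((\<lambda>u. integral {-n..u} f) has_vector_derivative f t) (at t)"
    by (subst (asm) has_vector_derivative_within_open) (auto simp: n_def)
  then have d: "((\<lambda>u. integral {-n..u} f - integral {-n..0} f) has_vector_derivative f t) (at t)"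
    by (auto intro!: derivative_eq_intros)
  show ?thesis
    by (rule has_vector_derivative_transform_within_open[OF d, of "{-n<..<n}"])
       (auto simp: n_def signed_integral_from[OF f, of "- n"])
qed

text \<open>
  Integrating a bound \<open>exp (l * \<bar>s\<bar>)\<close> reproduces it with the factor \<open>1 / l\<close>. For large \<open>l\<close> this makes
  the Picard operator a contraction in the norm weighted with \<open>exp (- l * \<bar>s\<bar>)\<close>.
\<close>

lemma norm_signed_integral_le:
  fixes f :: "real \<Rightarrow> 'a::banach"
  assumes f: "continuous_on UNIV f" and "l > 0"
    and bound: "\<And>s. norm (f s) \<le> D * exp (l * \<bar>s\<bar>)"
  shows "norm (signed_integral f t) \<le> D / l * exp (l * \<bar>t\<bar>)"
proof -
  have D: "D \<ge> 0" using bound[of 0] order_trans[OF norm_ge_zero[of "f 0"]] by simp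
  have int: "f integrable_on {u..v}" for u v
    by (rule integrable_continuous_real) (rule continuous_on_subset[OF f], simp)
  show ?thesis
  proof (cases "0 \<le> t")
    case True
    have I: "((\<lambda>s. D * exp (l * s)) has_integral (D / l * exp (l * t) - D / l * exp (l * 0))) {0..t}"
      using True \<open>l > 0\<close>
      by (intro fundamental_theorem_of_calculus)
         (auto intro!: derivative_eq_intros simp flip: has_real_derivative_iff_has_vector_derivative)
    have "norm (integral {0..t} f) \<le> integral {0..t} (\<lambda>s. D * exp (l * s))"
      using bound by (intro integral_norm_bound_integral int has_integral_integrable[OF I])
        (metis abs_of_nonneg atLeastAtMost_iff)
    also have "\<dots> \<le> D / l * exp (l * t)"
      using integral_unique[OF I] D \<open>l > 0\<close> by simp
    finally show ?thesis using True
      by (cases "t = 0") (auto simp: signed_integral_def)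
  next
    case False
    have I: "((\<lambda>s. D * exp (- l * s)) has_integral (- D / l * exp (- l * 0) - - D / l * exp (- l * t))) {t..0}"
      using False \<open>l > 0\<close>
      by (intro fundamental_theorem_of_calculus)
         (auto intro!: derivative_eq_intros simp flip: has_real_derivative_iff_has_vector_derivative)
    have "norm (integral {t..0} f) \<le> integral {t..0} (\<lambda>s. D * exp (- l * s))"
    proof (intro integral_norm_bound_integral int has_integral_integrable[OF I])
      fix s assume "s \<in> {t..0}"
      then have "l * \<bar>s\<bar> = - l * s" by simp
      then show "norm (f s) \<le> D * exp (- l * s)" using bound[of s] by simp
    qed
    also have "\<dots> \<le> D / l * exp (- l * t)"
      using integral_unique[OF I] D \<open>l > 0\<close> by simp
    finally show ?thesis using False by (auto simp: signed_integral_def)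
  qed
qed

lemma signed_integral_diff:
  fixes f g :: "real \<Rightarrow> 'a::banach"
  assumes f: "continuous_on UNIV f" and g: "continuous_on UNIV g"
  shows "signed_integral (\<lambda>s. f s - g s) t = signed_integral f t - signed_integral g t"
proof -
  have int: "f integrable_on {u..v}" "g integrable_on {u..v}" for u v
    by (rule integrable_continuous_real, rule continuous_on_subset, (rule f g), simp)+
  show ?thesis unfolding signed_integral_def using int
    by (simp add: integral_diff)
qed

text \<open>
  Banach's fixed point theorem for the Picard operator, acting on bounded continuous \<open>y\<close> with
  \<open>x t = x0 + exp (l * \<bar>t\<bar>) * y t\<close>. The weight makes the operator contract on the whole line at once.
\<close>

theorem lipschitz_global_solution:
  fixes F :: "'a::banach \<Rightarrow> 'a"
  assumes L: "L-lipschitz_on UNIV F"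
  obtains x where "x 0 = x0" "\<And>t::real. (x has_vector_derivative F (x t)) (at t)"
proof -
  have L0: "L \<ge> 0" using L by (rule lipschitz_on_nonneg)
  define l where "l = 2 * L + 1"
  have l: "l > 0" "0 \<le> L / l" "L / l < 1" using L0 by (auto simp: l_def field_simps)
  define path where "path y s = x0 + exp (l * \<bar>s\<bar>) *\<^sub>R apply_bcontfun y s" for y :: "real \<Rightarrow>\<^sub>C 'a" and s
  define G where "G y t = exp (- l * \<bar>t\<bar>) *\<^sub>R signed_integral (\<lambda>s. F (path y s)) t" for y t
  have path_cont: "continuous_on UNIV (path y)" for y
    unfolding path_def by (intro continuous_intros continuous_on_apply_bcontfun)
  have F_cont: "continuous_on UNIV F" using L by (rule lipschitz_on_continuous_on)
  have FC: "continuous_on UNIV (\<lambda>s. F (path y s))" for y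
    by (rule continuous_on_compose2[OF F_cont path_cont]) auto
  have G_mem: "G y \<in> bcontfun" for y
  proof -
    have "continuous_on UNIV (signed_integral (\<lambda>s. F (path y s)))"
      using signed_integral_derivative[OF FC]
      by (meson continuous_at_imp_continuous_on has_vector_derivative_continuous)
    then have c: "continuous_on UNIV (G y)" unfolding G_def by (intro continuous_intros)
    obtain b where b: "\<And>s. norm (apply_bcontfun y s) \<le> b"
      using bounded_apply_bcontfun[of y] by (auto simp: bounded_iff)
    define D where "D = norm (F x0) + L * b"
    have "norm (F (path y s)) \<le> D * exp (l * \<bar>s\<bar>)" for s
    proof -
      have "norm (F (path y s) - F x0) \<le> L * norm (path y s - x0)"
        using lipschitz_on_normD[OF L] by auto
      also have "norm (path y s - x0) \<le> exp (l * \<bar>s\<bar>) * b"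
        using b[of s] by (simp add: path_def)
      finally have "norm (F (path y s) - F x0) \<le> L * (exp (l * \<bar>s\<bar>) * b)"
        using L0 by (simp add: mult_left_mono)
      moreover have "norm (F x0) * 1 \<le> norm (F x0) * exp (l * \<bar>s\<bar>)"
        using l by (intro mult_left_mono) auto
      moreover have "norm (F (path y s)) \<le> norm (F x0) + norm (F (path y s) - F x0)"
        by (rule norm_triangle_sub)
      ultimately show ?thesis by (simp add: D_def algebra_simps)
    qed
    then have "norm (signed_integral (\<lambda>s. F (path y s)) t) \<le> D / l * exp (l * \<bar>t\<bar>)" for t
      by (intro norm_signed_integral_le FC l)
    then have "norm (G y t) \<le> D / l" for t
    proof -
      have "norm (G y t) = exp (- l * \<bar>t\<bar>) * norm (signed_integral (\<lambda>s. F (path y s)) t)"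
        by (simp add: G_def)
      also have "\<dots> \<le> exp (- l * \<bar>t\<bar>) * (D / l * exp (l * \<bar>t\<bar>))"
        using \<open>norm (signed_integral (\<lambda>s. F (path y s)) t) \<le> D / l * exp (l * \<bar>t\<bar>)\<close>
        by (intro mult_left_mono) auto
      also have "\<dots> = D / l" by (simp add: exp_minus field_simps)
      finally show ?thesis .
    qed
    with c show ?thesis by (auto simp: bcontfun_def bounded_iff)
  qed
  define T where "T y = Bcontfun (G y)" for y
  have T: "apply_bcontfun (T y) = G y" for y
    unfolding T_def by (rule Bcontfun_inverse[OF G_mem])
  have "\<forall>y z. dist (T y) (T z) \<le> L / l * dist y z"
  proof (intro allI dist_bound)
    fix y z :: "real \<Rightarrow>\<^sub>C 'a" and t :: real
    have "norm (F (path y s) - F (path z s)) \<le> (L * dist y z) * exp (l * \<bar>s\<bar>)" for s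
    proof -
      have "norm (F (path y s) - F (path z s)) \<le> L * norm (path y s - path z s)"
        using lipschitz_on_normD[OF L] by auto
      also have "norm (path y s - path z s) = exp (l * \<bar>s\<bar>) * dist (apply_bcontfun y s) (apply_bcontfun z s)"
        by (simp add: path_def dist_norm flip: scaleR_diff_right)
      also have "\<dots> \<le> exp (l * \<bar>s\<bar>) * dist y z"
        by (intro mult_left_mono dist_bounded) auto
      finally have "norm (F (path y s) - F (path z s)) \<le> L * (exp (l * \<bar>s\<bar>) * dist y z)"
        using L0 by (simp add: mult_left_mono)
      then show ?thesis by (simp only: ac_simps)
    qed
    then have "norm (signed_integral (\<lambda>s. F (path y s) - F (path z s)) t) \<le> L * dist y z / l * exp (l * \<bar>t\<bar>)"
      by (intro norm_signed_integral_le l continuous_on_diff FC)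
    then have le: "norm (signed_integral (\<lambda>s. F (path y s)) t - signed_integral (\<lambda>s. F (path z s)) t)
        \<le> L * dist y z / l * exp (l * \<bar>t\<bar>)"
      by (simp add: signed_integral_diff FC)
    have "dist (T y t) (T z t) = exp (- l * \<bar>t\<bar>) *
        norm (signed_integral (\<lambda>s. F (path y s)) t - signed_integral (\<lambda>s. F (path z s)) t)"
      by (simp add: T G_def dist_norm flip: scaleR_diff_right)
    also have "\<dots> \<le> exp (- l * \<bar>t\<bar>) * (L * dist y z / l * exp (l * \<bar>t\<bar>))"
      using le by (intro mult_left_mono) auto
    also have "\<dots> = L / l * dist y z" by (simp add: exp_minus field_simps)
    finally show "dist (T y t) (T z t) \<le> L / l * dist y z" .
  qed
  then obtain y where y: "T y = y" using banach_fix_type[OF l(2,3)] by blast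
  have path_eq: "path y = (\<lambda>t. x0 + signed_integral (\<lambda>s. F (path y s)) t)"
  proof
    fix t
    have "apply_bcontfun y t = G y t" using T[of y] y by simp
    then show "path y t = x0 + signed_integral (\<lambda>s. F (path y s)) t"
      by (simp add: path_def[of y t] G_def flip: exp_add)
  qed
  show thesis
  proof (rule that[of "path y"])
    show "path y 0 = x0" by (subst path_eq) (simp add: signed_integral_def)
    have d: "((\<lambda>u. x0 + signed_integral (\<lambda>s. F (path y s)) u) has_vector_derivative F (path y t)) (at t)" for t
      using signed_integral_derivative[OF FC[of y], of t]
      by (auto intro!: derivative_eq_intros)
    show "(path y has_vector_derivative F (path y t)) (at t)" for t
      using d[of t] by (simp flip: path_eq)
  qed
qed

text \<open>
  Since \<open>(x - y) \<bullet> (F x - F y) \<le> L * (norm (x - y))\<^sup>2\<close>, the function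
  \<open>exp (- 2 * L * u) * (norm (x u - y u))\<^sup>2\<close> does not increase.
\<close>

lemma gronwall_forward:
  fixes F :: "'a::real_inner \<Rightarrow> 'a"
  assumes L: "L-lipschitz_on UNIV F" and "s \<le> t"
    and x: "\<And>u. s \<le> u \<Longrightarrow> u \<le> t \<Longrightarrow> (x has_vector_derivative F (x u)) (at u)"
    and y: "\<And>u. s \<le> u \<Longrightarrow> u \<le> t \<Longrightarrow> (y has_vector_derivative F (y u)) (at u)"
  shows "norm (x t - y t) \<le> exp (L * (t - s)) * norm (x s - y s)"
proof -
  define f where "f u = exp (- 2 * L * u) * (norm (x u - y u))\<^sup>2" for u
  have "f t \<le> f s"
  proof (rule DERIV_nonpos_imp_nonincreasing[OF \<open>s \<le> t\<close>])
    fix u assume u: "s \<le> u" "u \<le> t"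
    define d where "d = x u - y u"
    define e where "e = F (x u) - F (y u)"
    have "((\<lambda>u. x u - y u) has_vector_derivative e) (at u)"
      unfolding e_def by (intro has_vector_derivative_diff x y u)
    then have dd: "((\<lambda>u. x u - y u) has_derivative (\<lambda>h. h *\<^sub>R e)) (at u)"
      by (simp add: has_vector_derivative_def)
    have "((\<lambda>u. (x u - y u) \<bullet> (x u - y u)) has_real_derivative 2 * (d \<bullet> e)) (at u)"
      unfolding has_field_derivative_def
      by (rule has_derivative_eq_rhs[OF has_derivative_inner[OF dd dd]])
         (auto simp: d_def inner_commute fun_eq_iff)
    then have "((\<lambda>u. (norm (x u - y u))\<^sup>2) has_real_derivative 2 * (d \<bullet> e)) (at u)"
      by (simp add: power2_norm_eq_inner)
    note sq = this
    have "((\<lambda>u. exp (- 2 * L * u)) has_real_derivative - 2 * L * exp (- 2 * L * u)) (at u)"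
      by (auto intro!: derivative_eq_intros)
    from DERIV_mult[OF this sq]
    have "(f has_real_derivative exp (- 2 * L * u) * (2 * (d \<bullet> e) - 2 * L * (norm d)\<^sup>2)) (at u)"
      unfolding f_def d_def by (simp add: algebra_simps)
    moreover have "d \<bullet> e \<le> L * (norm d)\<^sup>2"
    proof -
      have "d \<bullet> e \<le> norm d * norm e" by (rule norm_cauchy_schwarz)
      also have "\<dots> \<le> norm d * (L * norm d)"
        using lipschitz_on_normD[OF L, of "x u" "y u"] by (intro mult_left_mono) (auto simp: d_def e_def)
      finally show ?thesis by (simp add: power2_eq_square algebra_simps)
    qed
    ultimately show "\<exists>D. (f has_real_derivative D) (at u) \<and> D \<le> 0"
      by (intro exI[of _ "exp (- 2 * L * u) * (2 * (d \<bullet> e) - 2 * L * (norm d)\<^sup>2)"])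
        (simp add: mult_nonneg_nonpos)
  qed
  then have "(norm (x t - y t))\<^sup>2 \<le> exp (2 * L * t) * (exp (- 2 * L * s) * (norm (x s - y s))\<^sup>2)"
    by (simp add: f_def exp_minus field_simps)
  also have "\<dots> = (exp (L * (t - s)) * norm (x s - y s))\<^sup>2"
    by (simp add: power_mult_distrib flip: exp_double exp_add) (simp add: algebra_simps flip: exp_add)
  finally show ?thesis by (rule power2_le_imp_le) simp
qed

lemma gronwall_backward:
  fixes F :: "'a::real_inner \<Rightarrow> 'a"
  assumes L: "L-lipschitz_on UNIV F" and "s \<le> t"
    and x: "\<And>u. s \<le> u \<Longrightarrow> u \<le> t \<Longrightarrow> (x has_vector_derivative F (x u)) (at u)"
    and y: "\<And>u. s \<le> u \<Longrightarrow> u \<le> t \<Longrightarrow> (y has_vector_derivative F (y u)) (at u)"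
  shows "norm (x s - y s) \<le> exp (L * (t - s)) * norm (x t - y t)"
proof -
  have r: "((\<lambda>u. z (- u)) has_vector_derivative - F (z (- u))) (at u)"
    if "(z has_vector_derivative F (z (-u))) (at (-u))" for z and u
  proof -
    have "(uminus has_vector_derivative (-1::real)) (at u)"
      by (auto intro!: derivative_eq_intros simp flip: has_real_derivative_iff_has_vector_derivative)
    from vector_diff_chain_at[OF this that] show ?thesis by (simp add: o_def)
  qed
  have "norm (x (- (- s)) - y (- (- s))) \<le> exp (L * (- s - - t)) * norm (x (- (- t)) - y (- (- t)))"
    by (rule gronwall_forward[where F = "\<lambda>z. - F z" and L = L])
       (use assms in \<open>auto intro!: r\<close>)
  then show ?thesis by (simp add: algebra_simps)
qed

section \<open>Convergence along a path\<close>

text \<open>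
  By the mean value theorem \<open>f (t + d) - f t = d * g z\<close> for some \<open>z\<close> near \<open>t\<close>. The left hand side
  tends to \<open>0\<close> for fixed \<open>d\<close>, and \<open>g z\<close> is close to \<open>g t\<close> if \<open>d\<close> is small.
\<close>

lemma barbalat:
  fixes f g :: "real \<Rightarrow> real"
  assumes lim: "(f \<longlongrightarrow> l) at_top"
    and der: "\<forall>\<^sub>F t in at_top. (f has_real_derivative g t) (at t)"
    and osc: "\<And>e. e > 0 \<Longrightarrow> \<exists>d>0. \<forall>\<^sub>F t in at_top. \<forall>s\<in>{t..t+d}. \<bar>g s - g t\<bar> \<le> e"
  shows "(g \<longlongrightarrow> 0) at_top"
proof (rule tendstoI)
  fix e :: real assume "e > 0"
  then obtain d where d: "d > 0" and o: "\<forall>\<^sub>F t in at_top. \<forall>s\<in>{t..t+d}. \<bar>g s - g t\<bar> \<le> e/3"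
    using osc[of "e/3"] by auto
  have "\<forall>\<^sub>F t in at_top. dist (f t) l < d * e / 6"
    using lim \<open>e > 0\<close> d by (intro tendstoD) auto
  then obtain T where T: "\<And>t. t \<ge> T \<Longrightarrow> \<bar>f t - l\<bar> < d * e / 6"
    by (auto simp: eventually_at_top_linorder dist_real_def)
  obtain T' where T': "\<And>t. t \<ge> T' \<Longrightarrow> (f has_real_derivative g t) (at t)"
    using der by (auto simp: eventually_at_top_linorder)
  have "\<forall>\<^sub>F t in at_top. t \<ge> max T T'" by (rule eventually_ge_at_top)
  with o show "\<forall>\<^sub>F t in at_top. dist (g t) 0 < e"
  proof eventually_elim
    case (elim t)
    have "\<exists>z. t < z \<and> z < t + d \<and> f (t + d) - f t = (t + d - t) * g z"
      by (rule MVT2) (use d elim in \<open>auto intro!: T'\<close>)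
    then obtain z where z: "t < z" "z < t + d" "f (t + d) - f t = d * g z" by auto
    have "\<bar>f (t + d) - f t\<bar> < d * e / 3"
      using T[of t] T[of "t + d"] elim d by (auto simp: abs_if split: if_splits)
    then have "d * \<bar>g z\<bar> < d * (e / 3)" using z(3) d by (simp add: abs_mult)
    then have "\<bar>g z\<bar> < e / 3" using d by simp
    moreover have "\<bar>g z - g t\<bar> \<le> e / 3" using elim z by auto
    ultimately have "\<bar>g t\<bar> < e" using \<open>e > 0\<close> by linarith
    then show ?case by (simp add: dist_real_def)
  qed
qed

lemma derivative_limit_zero:
  fixes f g :: "real \<Rightarrow> real"
  assumes lim: "(f \<longlongrightarrow> l) at_top"
    and der: "\<forall>\<^sub>F t in at_top. (f has_real_derivative g t) (at t)"
    and g: "(g \<longlongrightarrow> m) at_top"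
  shows "m = 0"
proof -
  have "(g \<longlongrightarrow> 0) at_top"
  proof (rule barbalat[OF lim der])
    fix e :: real assume "e > 0"
    have "\<forall>\<^sub>F t in at_top. dist (g t) m < e / 2" using g \<open>e > 0\<close> by (intro tendstoD) auto
    then obtain T where T: "\<And>t. t \<ge> T \<Longrightarrow> \<bar>g t - m\<bar> < e / 2"
      by (auto simp: eventually_at_top_linorder dist_real_def)
    have "\<forall>s\<in>{t..t+1}. \<bar>g s - g t\<bar> \<le> e" if "t \<ge> T" for t
      using T[of t] T that by (auto simp: abs_if split: if_splits) (smt (verit) T field_sum_of_halves)+
    then show "\<exists>d>0. \<forall>\<^sub>F t in at_top. \<forall>s\<in>{t..t+d}. \<bar>g s - g t\<bar> \<le> e"
      by (intro exI[of _ 1]) (auto simp: eventually_at_top_linorder)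
  qed
  then show ?thesis using g by (auto dest: tendsto_unique[rotated])
qed

lemma norm_diff_le_of_vector_derivative:
  fixes f :: "real \<Rightarrow> 'a::real_normed_vector"
  assumes "convex S" and der: "\<And>x. x \<in> S \<Longrightarrow> (f has_vector_derivative f' x) (at x within S)"
    and B: "\<And>x. x \<in> S \<Longrightarrow> norm (f' x) \<le> B" and "x \<in> S" "y \<in> S"
  shows "norm (f x - f y) \<le> B * norm (x - y)"
proof (rule differentiable_bound[OF \<open>convex S\<close> _ _ \<open>x \<in> S\<close> \<open>y \<in> S\<close>])
  show "(f has_derivative (\<lambda>h. h *\<^sub>R f' u)) (at u within S)" if "u \<in> S" for u
    using der[OF that] by (simp add: has_vector_derivative_def)
  show "onorm (\<lambda>h. h *\<^sub>R f' u) \<le> B" if "u \<in> S" for u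
    using mult_right_mono[OF B[OF that] abs_ge_zero] by (intro onorm_le) (simp add: mult.commute)
qed

text \<open>
  This provides the hypothesis on the oscillation in \<open>barbalat\<close>: a path of bounded speed in a compact
  set is Lipschitz, and \<open>G\<close> is uniformly continuous on that set.
\<close>

lemma oscillation_along_path:
  fixes y :: "real \<Rightarrow> 'a::real_normed_vector" and G :: "'a \<Rightarrow> real"
  assumes K: "compact K" and G: "continuous_on K G"
    and y: "\<And>t. t \<ge> 0 \<Longrightarrow> y t \<in> K"
    and der: "\<And>t. t \<ge> 0 \<Longrightarrow> (y has_vector_derivative y' t) (at t)"
    and C: "\<And>t. t \<ge> 0 \<Longrightarrow> norm (y' t) \<le> C"
    and e: "e > 0"
  shows "\<exists>d>0. \<forall>\<^sub>F t in at_top. \<forall>s\<in>{t..t+d}. \<bar>G (y s) - G (y t)\<bar> \<le> e"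
proof -
  have C0: "C \<ge> 0" using C[of 0] norm_ge_zero[of "y' 0"] by linarith
  have "uniformly_continuous_on K G" by (rule compact_uniformly_continuous[OF G K])
  then obtain d where d: "d > 0" "\<And>p q. p \<in> K \<Longrightarrow> q \<in> K \<Longrightarrow> dist q p < d \<Longrightarrow> dist (G q) (G p) < e"
    using e by (auto simp: uniformly_continuous_on_def)
  define r where "r = d / (C + 1)"
  have "(C + 1) * r = d" using C0 by (simp add: r_def)
  moreover have "r > 0" using C0 d(1) by (simp add: r_def)
  ultimately have r: "r > 0" "C * r < d" by (simp_all add: algebra_simps)
  have "\<bar>G (y s) - G (y t)\<bar> \<le> e" if t: "t \<ge> 0" and s: "s \<in> {t..t+r}" for s t
  proof -
    have "norm (y s - y t) \<le> C * norm (s - t)"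
    proof (rule norm_diff_le_of_vector_derivative[where S = "{t..s}" and f' = y' and f = y])
      show "(y has_vector_derivative y' x) (at x within {t..s})" if "x \<in> {t..s}" for x
        by (rule has_vector_derivative_at_within, rule der) (use that t in simp)
      show "norm (y' x) \<le> C" if "x \<in> {t..s}" for x
        by (rule C) (use that t in simp)
    qed (use s in simp_all)
    also have "\<dots> \<le> C * r" using s C0 by (intro mult_left_mono) auto
    finally have "dist (y s) (y t) < d" using r by (simp add: dist_norm)
    then have "dist (G (y s)) (G (y t)) < e" using y t s by (intro d) auto
    then show ?thesis by (simp add: dist_real_def)
  qed
  then have "\<forall>\<^sub>F t in at_top. \<forall>s\<in>{t..t+r}. \<bar>G (y s) - G (y t)\<bar> \<le> e"
    unfolding eventually_at_top_linorder by (intro exI[of _ 0]) blast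
  then show ?thesis using r(1) by blast
qed

lemma tendsto_zero_if_mult_le:
  fixes f g :: "'a \<Rightarrow> real"
  assumes g: "(g \<longlongrightarrow> 0) F" and m: "m > 0" and le: "\<forall>\<^sub>F t in F. m * \<bar>f t\<bar> \<le> \<bar>g t\<bar>"
  shows "(f \<longlongrightarrow> 0) F"
proof (rule Lim_null_comparison)
  show "((\<lambda>t. \<bar>g t / m\<bar>) \<longlongrightarrow> 0) F" by (rule tendsto_rabs_zero[OF tendsto_divide_zero[OF g]])
  show "\<forall>\<^sub>F t in F. norm (f t) \<le> \<bar>g t / m\<bar>"
    using le by (rule eventually_mono) (use m in \<open>simp add: field_simps\<close>)
qed

text \<open>
  Outside a ball around \<open>p\<close>, \<open>\<bar>f\<bar>\<close> has a positive minimum on \<open>K\<close>.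
\<close>

lemma tendsto_unique_zero:
  fixes f :: "'a::metric_space \<Rightarrow> real"
  assumes K: "compact K" and f: "continuous_on K f"
    and zero: "\<And>x. x \<in> K \<Longrightarrow> f x = 0 \<Longrightarrow> x = p"
    and ev: "\<forall>\<^sub>F t in F. y t \<in> K" and lim: "((\<lambda>t. f (y t)) \<longlongrightarrow> 0) F"
  shows "(y \<longlongrightarrow> p) F"
proof (rule tendstoI)
  fix e :: real assume e: "e > 0"
  define S where "S = K - ball p e"
  have S: "compact S" unfolding S_def by (intro compact_diff K open_ball)
  have fS: "continuous_on S (\<lambda>x. \<bar>f x\<bar>)"
    using f unfolding S_def by (intro continuous_intros) (auto intro: continuous_on_subset)
  show "\<forall>\<^sub>F t in F. dist (y t) p < e"
  proof (cases "S = {}")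
    case True
    then show ?thesis by (intro eventually_mono[OF ev]) (auto simp: S_def dist_commute)
  next
    case False
    then obtain x where x: "x \<in> S" "\<And>u. u \<in> S \<Longrightarrow> \<bar>f x\<bar> \<le> \<bar>f u\<bar>"
      using continuous_attains_inf[OF S False fS] by blast
    have "x \<noteq> p" using x(1) e by (auto simp: S_def)
    then have "\<bar>f x\<bar> > 0" using zero x(1) by (auto simp: S_def)
    then have "\<forall>\<^sub>F t in F. dist (f (y t)) 0 < \<bar>f x\<bar>" using lim by (intro tendstoD)
    with ev show ?thesis
    proof eventually_elim
      case (elim t)
      then have "y t \<notin> S" using x(2)[of "y t"] by (auto simp: dist_real_def)
      then show ?case using elim by (auto simp: S_def dist_commute)
    qed
  qed
qed

lemma lipschitz_on_mult_bounded:
  fixes f g :: "'a::metric_space \<Rightarrow> real"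
  assumes f: "L-lipschitz_on S f" and g: "M-lipschitz_on S g"
    and A: "\<And>x. x \<in> S \<Longrightarrow> \<bar>f x\<bar> \<le> A" and B: "\<And>x. x \<in> S \<Longrightarrow> \<bar>g x\<bar> \<le> B"
    and "A \<ge> 0" "B \<ge> 0"
  shows "(A * M + B * L)-lipschitz_on S (\<lambda>x. f x * g x)"
proof (rule lipschitz_onI)
  show "0 \<le> A * M + B * L"
    using assms lipschitz_on_nonneg[OF f] lipschitz_on_nonneg[OF g] by auto
  fix x y assume xy: "x \<in> S" "y \<in> S"
  have "f x * g x - f y * g y = f x * (g x - g y) + g y * (f x - f y)" by (simp add: algebra_simps)
  then have "\<bar>f x * g x - f y * g y\<bar> \<le> \<bar>f x\<bar> * \<bar>g x - g y\<bar> + \<bar>g y\<bar> * \<bar>f x - f y\<bar>"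
    by (metis abs_mult abs_triangle_ineq)
  also have "\<dots> \<le> A * (M * dist x y) + B * (L * dist x y)"
    using lipschitz_onD[OF f] lipschitz_onD[OF g] xy A B \<open>A \<ge> 0\<close> \<open>B \<ge> 0\<close>
    by (intro add_mono mult_mono) (auto simp: dist_real_def)
  finally show "dist (f x * g x) (f y * g y) \<le> (A * M + B * L) * dist x y"
    by (simp add: dist_real_def algebra_simps)
qed

text \<open>
  A product of Lipschitz functions need not be Lipschitz unless the factors are bounded; the two
  properties together are inherited by products.
\<close>

definition bounded_lipschitz :: "('a::metric_space \<Rightarrow> real) \<Rightarrow> bool" where
  "bounded_lipschitz f \<longleftrightarrow> (\<exists>L. L-lipschitz_on UNIV f) \<and> (\<exists>A. \<forall>x. \<bar>f x\<bar> \<le> A)"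

lemma bounded_lipschitz_mult:
  assumes "bounded_lipschitz f" "bounded_lipschitz g"
  shows "bounded_lipschitz (\<lambda>x. f x * g x)"
proof -
  obtain L A M B where *: "L-lipschitz_on UNIV f" "\<And>x. \<bar>f x\<bar> \<le> A"
    "M-lipschitz_on UNIV g" "\<And>x. \<bar>g x\<bar> \<le> B"
    using assms by (auto simp: bounded_lipschitz_def)
  have AB: "A \<ge> 0" "B \<ge> 0"
    using *(2,4)[of undefined] by linarith+
  have "(A * M + B * L)-lipschitz_on UNIV (\<lambda>x. f x * g x)"
    using * AB by (intro lipschitz_on_mult_bounded) auto
  moreover have "\<bar>f x * g x\<bar> \<le> A * B" for x
    unfolding abs_mult using * AB by (intro mult_mono) auto
  ultimately show ?thesis unfolding bounded_lipschitz_def by blast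
qed

lemma bounded_lipschitz_add:
  assumes "bounded_lipschitz f" "bounded_lipschitz g"
  shows "bounded_lipschitz (\<lambda>x. f x + g x)"
proof -
  obtain L A M B where *: "L-lipschitz_on UNIV f" "\<And>x. \<bar>f x\<bar> \<le> A"
    "M-lipschitz_on UNIV g" "\<And>x. \<bar>g x\<bar> \<le> B"
    using assms by (auto simp: bounded_lipschitz_def)
  have "\<bar>f x + g x\<bar> \<le> A + B" for x using *(2,4)[of x] by linarith
  then show ?thesis using lipschitz_on_add[OF *(1,3)] unfolding bounded_lipschitz_def by blast
qed

lemma bounded_lipschitz_sin_cos:
  "bounded_lipschitz sin" "bounded_lipschitz (cos :: real \<Rightarrow> real)"
proof -
  have "norm (sin x - sin y) \<le> 1 * norm (x - y)" for x y :: real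
    by (rule field_differentiable_bound[where S = UNIV and f' = cos])
       (auto intro!: derivative_eq_intros)
  then have "1-lipschitz_on UNIV (sin :: real \<Rightarrow> real)"
    by (intro lipschitz_onI) (auto simp: dist_norm)
  moreover have "norm (cos x - cos y) \<le> 1 * norm (x - y)" for x y :: real
    by (rule field_differentiable_bound[where S = UNIV and f' = "\<lambda>x. - sin x"])
       (auto intro!: derivative_eq_intros)
  then have "1-lipschitz_on UNIV (cos :: real \<Rightarrow> real)"
    by (intro lipschitz_onI) (auto simp: dist_norm)
  ultimately show "bounded_lipschitz sin" "bounded_lipschitz (cos :: real \<Rightarrow> real)"
    unfolding bounded_lipschitz_def by (auto intro!: exI[of _ 1])
qed

lemma bounded_lipschitz_compose:
  assumes f: "bounded_lipschitz f" and g: "L-lipschitz_on UNIV g"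
  shows "bounded_lipschitz (\<lambda>x. f (g x))"
proof -
  obtain M A where *: "M-lipschitz_on UNIV f" "\<And>x. \<bar>f x\<bar> \<le> A"
    using f by (auto simp: bounded_lipschitz_def)
  have "(M * L)-lipschitz_on UNIV (\<lambda>x. f (g x))"
    by (rule lipschitz_on_compose2[OF g lipschitz_on_subset[OF *(1)]]) simp
  then show ?thesis using *(2) unfolding bounded_lipschitz_def by blast
qed

lemma mono_bounded_converges:
  fixes f :: "real \<Rightarrow> real"
  assumes mono: "\<And>s t. T \<le> s \<Longrightarrow> s \<le> t \<Longrightarrow> f s \<le> f t" and bdd: "\<And>t. T \<le> t \<Longrightarrow> f t \<le> B"
  obtains l where "(f \<longlongrightarrow> l) at_top" "\<And>t. T \<le> t \<Longrightarrow> f t \<le> l" "l \<le> B"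
proof
  have b: "bdd_above (f ` {T..})" using bdd by (auto simp: bdd_above_def)
  show up: "f t \<le> (SUP t\<in>{T..}. f t)" if "T \<le> t" for t
    using that by (intro cSUP_upper b) auto
  show "(SUP t\<in>{T..}. f t) \<le> B" using bdd by (intro cSUP_least) auto
  show "(f \<longlongrightarrow> (SUP t\<in>{T..}. f t)) at_top"
  proof (rule increasing_tendsto)
    show "\<forall>\<^sub>F t in at_top. f t \<le> (SUP t\<in>{T..}. f t)"
      using eventually_ge_at_top[of T] by eventually_elim (rule up)
    fix x assume "x < (SUP t\<in>{T..}. f t)"
    then obtain s where "s \<ge> T" "x < f s" using b by (auto simp: less_cSUP_iff)
    then show "\<forall>\<^sub>F t in at_top. x < f t"
      by (intro eventually_mono[OF eventually_ge_at_top[of s]]) (use mono in \<open>force intro: less_le_trans\<close>)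
  qed
qed

lemma first_hit:
  fixes f :: "real \<Rightarrow> real"
  assumes cont: "continuous_on {p..q} f" and "p \<le> q" "f q \<le> c" "c < f p"
  obtains t where "p < t" "t \<le> q" "f t = c" "\<And>s. p \<le> s \<Longrightarrow> s < t \<Longrightarrow> c < f s"
proof -
  have K: "compact {t \<in> {p..q}. f t \<le> c}"
    using continuous_closed_preimage[OF cont, of "{..c}"]
    by (auto simp: compact_eq_bounded_closed vimage_def Int_def conj_commute intro: bounded_subset[of "{p..q}"])
  have "{t \<in> {p..q}. f t \<le> c} \<noteq> {}" using assms by auto
  from compact_attains_inf[OF K this]
  obtain t where t: "p \<le> t" "t \<le> q" "f t \<le> c" and min: "\<And>s. p \<le> s \<Longrightarrow> s \<le> q \<Longrightarrow> f s \<le> c \<Longrightarrow> t \<le> s"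
    by auto
  have less: "c < f s" if "p \<le> s" "s < t" for s using min[of s] that t by fastforce
  have "p \<noteq> t" using t assms by auto
  obtain s where s: "p \<le> s" "s \<le> t" "f s = c"
    using IVT2'[of f t c p] t assms continuous_on_subset[OF cont, of "{p..t}"] by auto
  then have "s = t" using less[of s] by fastforce
  show thesis by (rule that[of t]) (use t less s \<open>s = t\<close> \<open>p \<noteq> t\<close> in auto)
qed

lemma last_hit:
  fixes f :: "real \<Rightarrow> real"
  assumes cont: "continuous_on {p..q} f" and "p \<le> q" "f p \<le> c" "c < f q"
  obtains t where "p \<le> t" "t < q" "f t = c" "\<And>s. t < s \<Longrightarrow> s \<le> q \<Longrightarrow> c < f s"
proof -
  have "continuous_on {-q..-p} (\<lambda>t. f (- t))"
    by (rule continuous_on_compose2[OF cont]) (auto intro!: continuous_intros)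
  then obtain t where t: "- q < t" "t \<le> - p" "f (- t) = c" "\<And>s. - q \<le> s \<Longrightarrow> s < t \<Longrightarrow> c < f (- s)"
    by (rule first_hit[of "- q" "- p" "\<lambda>t. f (- t)" c]) (use assms in auto)
  show thesis
    by (rule that[of "- t"]) (use t(1-3) t(4)[of "- s" for s] in auto)
qed

lemma nonzero_keeps_sign:
  fixes f :: "'a::topological_space \<Rightarrow> real"
  assumes "connected S" "continuous_on S f" "\<And>x. x \<in> S \<Longrightarrow> f x \<noteq> 0" "x \<in> S" "y \<in> S" "f x > 0"
  shows "f y > 0"
proof (rule ccontr)
  assume "\<not> f y > 0"
  then have "f y \<le> 0" "0 \<le> f x" using assms(6) by auto
  moreover have "connected (f ` S)" using assms(2,1) by (rule connected_continuous_image)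
  moreover have "f y \<in> f ` S" "f x \<in> f ` S" using assms(4,5) by auto
  ultimately have "0 \<in> f ` S" using connectedD_interval by blast
  then obtain x where "x \<in> S" "f x = 0" by force
  then show False using assms(3) by blast
qed

text \<open>
  Used to write an orbit along which \<open>\<theta>\<close> increases as a graph over \<open>\<theta>\<close>.
\<close>

lemma increasing_inverse:
  fixes f f' :: "real \<Rightarrow> real"
  assumes der: "\<And>t. T \<le> t \<Longrightarrow> (f has_real_derivative f' t) (at t)"
    and pos: "\<And>t. T \<le> t \<Longrightarrow> f' t > 0" and lim: "(f \<longlongrightarrow> l) at_top"
  obtains g where "\<And>u. f T < u \<Longrightarrow> u < l \<Longrightarrow> T < g u \<and> f (g u) = u"
    and "\<And>u. f T < u \<Longrightarrow> u < l \<Longrightarrow> (g has_real_derivative inverse (f' (g u))) (at u)"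
proof -
  have mono: "f s < f t" if "T \<le> s" "s < t" for s t
  proof (rule DERIV_pos_imp_increasing[OF \<open>s < t\<close>])
    fix x assume "s \<le> x" "x \<le> t"
    then have "T \<le> x" using that by simp
    then show "\<exists>y. (f has_real_derivative y) (at x) \<and> 0 < y" using der pos by blast
  qed
  have inj: "inj_on f {T..}"
  proof (rule inj_onI)
    fix s t assume "s \<in> {T..}" "t \<in> {T..}" "f s = f t"
    then show "s = t" using mono[of s t] mono[of t s] by (cases s t rule: linorder_cases) auto
  qed
  have cont: "isCont f t" if "T \<le> t" for t using der[OF that] by (rule DERIV_isCont)
  define g where "g = the_inv_into {T..} f"
  have gf: "g (f t) = t" if "T \<le> t" for t
    unfolding g_def using that by (intro the_inv_into_f_f inj) auto
  have g: "T < g u \<and> f (g u) = u" if u: "f T < u" "u < l" for u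
  proof -
    have "\<forall>\<^sub>F t in at_top. u < f t \<and> T \<le> t"
      using order_tendstoD(1)[OF lim u(2)] eventually_ge_at_top[of T] by (rule eventually_conj)
    then obtain q where q: "u < f q" "T \<le> q" by (auto dest: eventually_happens)
    obtain t where t: "T \<le> t" "f t = u"
      using IVT[of f T u q] q u cont by auto
    then have "T \<noteq> t" using u by auto
    then show ?thesis using t gf[of t] by auto
  qed
  show thesis
  proof (rule that[of g])
    show "T < g u \<and> f (g u) = u" if "f T < u" "u < l" for u using that by (rule g)
    show "(g has_real_derivative inverse (f' (g u))) (at u)" if u: "f T < u" "u < l" for u
    proof (rule DERIV_inverse_function[where a = "f T" and b = l])
      show "(f has_real_derivative f' (g u)) (at (g u))" using g[OF u] by (intro der) auto
      show "f' (g u) \<noteq> 0" using pos[of "g u"] g[OF u] by auto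
      show "f (g y) = y" if "f T < y" "y < l" for y using g that by blast
      define x where "x = g u"
      have x: "T < x" "f x = u" using g[OF u] by (auto simp: x_def)
      have "isCont g (f x)"
      proof (rule isCont_inverse_function[where d = "(x - T) / 2" and f = f and x = x])
        show "0 < (x - T) / 2" using x by simp
        show "g (f z) = z" if "\<bar>z - x\<bar> \<le> (x - T) / 2" for z
        proof (rule gf)
          have "x - z \<le> (x - T) / 2" using that by linarith
          then show "T \<le> z" using x by (simp add: field_simps)
        qed
        show "isCont f z" if "\<bar>z - x\<bar> \<le> (x - T) / 2" for z
        proof (rule cont)
          have "x - z \<le> (x - T) / 2" using that by linarith
          then show "T \<le> z" using x by (simp add: field_simps)
        qed
      qed
      then show "isCont g u" using x by simp
    qed (use u in auto)
  qed
qed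

lemma cot_antimono:
  fixes x y :: real
  assumes "0 < x" "x < pi / 2" "0 < y" "y < pi / 2"
  shows "(x - y) * (cos x / sin x - cos y / sin y) \<le> 0"
proof -
  have s: "sin x > 0" "sin y > 0" using assms pi_gt_zero by (auto intro!: sin_gt_zero)
  have eq: "cos x / sin x - cos y / sin y = - sin (x - y) / (sin x * sin y)"
    using s by (simp add: sin_diff field_simps)
  have "(x - y) * sin (x - y) \<ge> 0"
  proof (cases "y \<le> x")
    case True
    then have "sin (x - y) \<ge> 0" using assms by (intro sin_ge_zero) auto
    then show ?thesis using True by simp
  next
    case False
    then have "sin (y - x) \<ge> 0" using assms by (intro sin_ge_zero) auto
    then have "(y - x) * sin (y - x) \<ge> 0" using False by simp
    moreover have "sin (x - y) = - sin (y - x)" using sin_minus[of "y - x"] by simp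
    ultimately show ?thesis by (simp add: algebra_simps)
  qed
  moreover have "sin x * sin y > 0" using s by simp
  ultimately have "(x - y) * sin (x - y) / (sin x * sin y) \<ge> 0" by simp
  then show ?thesis unfolding eq by (simp add: field_simps)
qed

lemma lipschitz_on_interval_C1:
  fixes f f' :: "real \<Rightarrow> real"
  assumes "\<And>x. x \<in> {p..q} \<Longrightarrow> (f has_real_derivative f' x) (at x)" "continuous_on {p..q} f'"
  shows "\<exists>L. L-lipschitz_on {p..q} f"
proof -
  have "compact (f' ` {p..q})" using assms(2) by (intro compact_continuous_image) auto
  then obtain C where C: "\<And>x. x \<in> {p..q} \<Longrightarrow> \<bar>f' x\<bar> \<le> C"
    using compact_imp_bounded bounded_iff by (metis imageI real_norm_def)
  have "norm (f x - f y) \<le> \<bar>C\<bar> * norm (x - y)" if "x \<in> {p..q}" "y \<in> {p..q}" for x y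
    by (rule field_differentiable_bound[where S = "{p..q}" and f' = f'])
       (use that C in \<open>auto intro!: has_field_derivative_at_within assms(1) intro: order_trans[OF _ abs_ge_self]\<close>)
  then have "\<bar>C\<bar>-lipschitz_on {p..q} f" by (intro lipschitz_onI) (auto simp: dist_norm)
  then show ?thesis ..
qed

lemma sgn_powr_diff:
  fixes x y p :: real
  assumes "x > 0" "y > 0" "p > 0"
  shows "sgn (x powr p - y powr p) = sgn (x - y)"
  using assms powr_less_mono2[of p x y] powr_less_mono2[of p y x]
  by (cases x y rule: linorder_cases) auto

section \<open>The planar system on a symmetric hill\<close>

text \<open>
  The situation between the two saddles: \<open>P\<close> stands for \<open>W\<close>, a hill with its top over \<open>0\<close> and its
  feet over \<open>\<plusminus>a = \<plusminus>\<theta>\<^sub>w\<close>, and \<open>k\<close> for the factor \<open>sqrt (2 * cos\<^sup>3 \<theta>)\<close>.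
\<close>

locale symmetric_hill =
  fixes a :: real and P P' k :: "real \<Rightarrow> real"
  assumes a_pos: "a > 0"
    and P_deriv: "\<bar>x\<bar> \<le> a \<Longrightarrow> (P has_real_derivative P' x) (at x)"
    and P_pos: "\<bar>x\<bar> \<le> a \<Longrightarrow> P x > 0"
    and P_even: "P (- x) = P x"
    and P'_odd: "P' (- x) = - P' x"
    and P'_neg: "0 < x \<Longrightarrow> x < a \<Longrightarrow> P' x < 0"
    and P'_a: "P' a = 0"
    and k_pos: "\<bar>x\<bar> \<le> a \<Longrightarrow> k x > 0"
    and k_even: "k (- x) = k x"
    and k_lip: "\<exists>L. L-lipschitz_on {-a..a} k"
    and h_lip: "\<exists>L. L-lipschitz_on {-a..a} (\<lambda>x. P' x / (2 * P x))"
begin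

definition h where "h x = P' x / (2 * P x)"

text \<open>
  Clamping \<open>\<theta>\<close> in the coefficients makes the vector field Lipschitz and bounded on the plane. As
  \<open>P' (\<plusminus>a) = 0\<close>, the energy stays differentiable and monotone along all solutions.
\<close>

definition clamp where "clamp x = max (- a) (min a x)"

text \<open>
  The angular form of the collision flow: substitute \<open>v = sqrt (2 * P \<theta>) * cos \<psi>\<close> and
  \<open>w = k \<theta> * sin \<psi>\<close> in its equations.
\<close>

definition field :: "real \<times> real \<Rightarrow> real \<times> real" where
  "field = (\<lambda>(\<theta>, \<psi>). (k (clamp \<theta>) * sin \<psi>,
     k (clamp \<theta>) * (sin \<psi> / 2 + h (clamp \<theta>) * cos \<psi>)))"

text \<open>
  The coordinate \<open>v\<close>; \<open>loss\<close> is its rate of decrease.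
\<close>

definition energy :: "real \<times> real \<Rightarrow> real" where
  "energy = (\<lambda>(\<theta>, \<psi>). sqrt (2 * P (clamp \<theta>)) * cos \<psi>)"

definition loss :: "real \<times> real \<Rightarrow> real" where
  "loss = (\<lambda>(\<theta>, \<psi>). k (clamp \<theta>) * sqrt (2 * P (clamp \<theta>)) / 2 * (sin \<psi>)\<^sup>2)"

definition saddle_level where "saddle_level = sqrt (2 * P a)"

definition strip :: "(real \<times> real) set" where
  "strip = {-a<..<a} \<times> {-(pi/2)<..<pi/2}"

definition solution :: "(real \<Rightarrow> real \<times> real) \<Rightarrow> bool" where
  "solution z \<longleftrightarrow> (\<forall>t. (z has_vector_derivative field (z t)) (at t))"

lemma clamp_bounds: "\<bar>clamp x\<bar> \<le> a"
  using a_pos by (auto simp: clamp_def)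

lemma clamp_id: "\<bar>x\<bar> \<le> a \<Longrightarrow> clamp x = x"
  by (auto simp: clamp_def)

lemma clamp_minus: "clamp (- x) = - clamp x"
  using a_pos by (auto simp: clamp_def min_def max_def)

lemma h_a: "h a = 0" "h (- a) = 0"
  by (simp_all add: h_def P'_a P'_odd)

lemma P'_0: "P' 0 = 0"
  using P'_odd[of 0] by simp

lemma h_0: "h 0 = 0"
  by (simp add: h_def P'_0)

lemma h_odd: "h (- x) = - h x"
  by (simp add: h_def P'_odd P_even)

lemma h_neg: "0 < x \<Longrightarrow> x < a \<Longrightarrow> h x < 0"
  using P'_neg[of x] P_pos[of x] by (simp add: h_def divide_neg_pos)

lemma h_eq_0: "\<bar>x\<bar> \<le> a \<Longrightarrow> h x = 0 \<Longrightarrow> x = 0 \<or> x = a \<or> x = - a"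
  using h_neg[of x] h_neg[of "- x"] h_odd[of x] by linarith

lemma bounded_lipschitz_clamp:
  fixes f :: "real \<Rightarrow> real"
  assumes f: "L-lipschitz_on {-a..a} f"
  shows "bounded_lipschitz (\<lambda>x. f (clamp x))"
proof -
  have c: "1-lipschitz_on UNIV clamp"
    by (rule lipschitz_onI) (auto simp: clamp_def dist_real_def)
  have "(L * 1)-lipschitz_on UNIV (\<lambda>x. f (clamp x))"
    by (rule lipschitz_on_compose2[OF c lipschitz_on_subset[OF f]])
       (use clamp_bounds in \<open>auto simp: abs_le_iff minus_le_iff\<close>)
  moreover have "compact (f ` {-a..a})"
    by (rule compact_continuous_image[OF lipschitz_on_continuous_on[OF f]]) simp
  then obtain A where "\<And>x. x \<in> {-a..a} \<Longrightarrow> \<bar>f x\<bar> \<le> A"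
    using compact_imp_bounded bounded_iff by (metis imageI real_norm_def)
  then have "\<bar>f (clamp x)\<bar> \<le> A" for x
    using clamp_bounds[of x] by (auto simp: abs_le_iff minus_le_iff)
  ultimately show ?thesis unfolding bounded_lipschitz_def by blast
qed

lemma field_bounded_lipschitz:
  obtains L C where "L-lipschitz_on UNIV field" "\<And>z. norm (field z) \<le> C"
proof -
  have fst_lip: "1-lipschitz_on UNIV (fst :: real \<times> real \<Rightarrow> real)"
    and snd_lip: "1-lipschitz_on UNIV (snd :: real \<times> real \<Rightarrow> real)"
    by (intro lipschitz_onI; simp only: dist_fst_le dist_snd_le mult_1 zero_le_one)+
  have k: "bounded_lipschitz (\<lambda>z :: real \<times> real. k (clamp (fst z)))"
    using k_lip bounded_lipschitz_compose[OF bounded_lipschitz_clamp fst_lip] by blast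
  have hh: "bounded_lipschitz (\<lambda>z :: real \<times> real. h (clamp (fst z)))"
    using h_lip bounded_lipschitz_compose[OF bounded_lipschitz_clamp fst_lip] unfolding h_def by blast
  have s: "bounded_lipschitz (\<lambda>z :: real \<times> real. sin (snd z))"
    and c: "bounded_lipschitz (\<lambda>z :: real \<times> real. cos (snd z))"
    by (rule bounded_lipschitz_compose[OF bounded_lipschitz_sin_cos(1) snd_lip]
             bounded_lipschitz_compose[OF bounded_lipschitz_sin_cos(2) snd_lip])+
  have half: "bounded_lipschitz (\<lambda>z :: real \<times> real. 1/2)"
    unfolding bounded_lipschitz_def using lipschitz_on_constant by blast
  have 1: "bounded_lipschitz (\<lambda>z. fst (field z))"
    using bounded_lipschitz_mult[OF k s] by (simp add: field_def case_prod_beta)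
  have 2: "bounded_lipschitz (\<lambda>z. snd (field z))"
    using bounded_lipschitz_mult[OF k bounded_lipschitz_add[OF
        bounded_lipschitz_mult[OF half s] bounded_lipschitz_mult[OF hh c]]]
    by (simp add: field_def case_prod_beta)
  obtain L A M B where *: "L-lipschitz_on UNIV (\<lambda>z. fst (field z))" "\<And>z. \<bar>fst (field z)\<bar> \<le> A"
    "M-lipschitz_on UNIV (\<lambda>z. snd (field z))" "\<And>z. \<bar>snd (field z)\<bar> \<le> B"
    using 1 2 unfolding bounded_lipschitz_def by blast
  have "norm (field z) \<le> A + B" for z
    using norm_Pair_le[of "fst (field z)" "snd (field z)"] *(2,4)[of z] by auto
  with lipschitz_on_Pair[OF *(1,3)] show thesis by (intro that) auto
qed

lemma field_continuous: "continuous_on S field"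
  by (rule field_bounded_lipschitz)
     (meson continuous_on_subset lipschitz_on_continuous_on subset_UNIV)

lemma solution_exists: obtains z where "solution z" "z 0 = z0"
  using field_bounded_lipschitz lipschitz_global_solution unfolding solution_def by metis

lemma solution_shift: "solution z \<Longrightarrow> solution (\<lambda>t. z (t + s))"
  unfolding solution_def
proof
  fix t assume "\<forall>t. (z has_vector_derivative field (z t)) (at t)"
  then have "(z has_vector_derivative field (z (t + s))) (at (t + s))" by blast
  moreover have "((\<lambda>t. t + s) has_vector_derivative 1) (at t)"
    by (auto intro!: derivative_eq_intros simp flip: has_real_derivative_iff_has_vector_derivative)
  ultimately show "((\<lambda>t. z (t + s)) has_vector_derivative field (z (t + s))) (at t)"
    using vector_diff_chain_at[of "\<lambda>t. t + s" 1 t z] by (simp add: o_def)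
qed

lemma solution_unique:
  assumes z: "solution z" "solution z'" and eq: "z s = z' s"
  shows "z = z'"
proof
  fix t
  obtain L C where L: "L-lipschitz_on UNIV field" using field_bounded_lipschitz by metis
  have "norm (z t - z' t) \<le> 0"
  proof (cases "s \<le> t")
    case True
    then show ?thesis using gronwall_forward[OF L True, of z z'] z eq by (simp add: solution_def)
  next
    case False
    then have "t \<le> s" by simp
    from gronwall_backward[OF L this, of z z'] show ?thesis using z eq by (simp add: solution_def)
  qed
  then show "z t = z' t" by simp
qed

lemma field_rest: "field (a, 0) = 0" "field (- a, 0) = 0" "field (0, 0) = 0"
  using a_pos by (simp_all add: field_def clamp_def h_a h_0 zero_prod_def)

lemma field_minus: "field (- z) = - field z"
  by (cases z) (simp add: field_def clamp_minus k_even h_odd algebra_simps)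

lemma solution_minus: "solution z \<Longrightarrow> solution (\<lambda>t. - z t)"
  unfolding solution_def by (auto simp: field_minus intro!: derivative_intros)

lemma energy_minus: "energy (- z) = energy z"
  by (cases z) (simp add: energy_def clamp_minus P_even)

text \<open>
  The corners of \<open>clamp\<close> do no harm: at \<open>\<plusminus>a\<close> the difference quotients of \<open>P \<circ> clamp\<close> are dominated by
  those of \<open>P\<close>, which tend to \<open>P' (\<plusminus>a) = 0\<close>.
\<close>

lemma P_clamp_deriv: "((\<lambda>x. P (clamp x)) has_real_derivative P' (clamp x)) (at x)"
proof -
  have right: "((\<lambda>x. P (clamp x)) has_real_derivative P' (clamp x)) (at x)" if x: "x > - a" for x
  proof (cases x a rule: linorder_cases)
    case less
    have "(P has_real_derivative P' x) (at x)" using less x by (intro P_deriv) simp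
    moreover have "open {-a<..<a}" "x \<in> {-a<..<a}" using less x by auto
    ultimately have "((\<lambda>x. P (clamp x)) has_real_derivative P' x) (at x)"
      by (rule has_field_derivative_transform_within_open) (auto simp: clamp_id abs_less_iff)
    then show ?thesis using less x by (simp add: clamp_id)
  next
    case greater
    have "((\<lambda>_. P a) has_real_derivative 0) (at x)" by simp
    moreover have "open {a<..}" "x \<in> {a<..}" using greater by auto
    ultimately have "((\<lambda>x. P (clamp x)) has_real_derivative 0) (at x)"
      by (rule has_field_derivative_transform_within_open) (use a_pos in \<open>auto simp: clamp_def\<close>)
    then show ?thesis using greater a_pos by (simp add: clamp_def P'_a)
  next
    case equal
    have "((\<lambda>y. (P y - P a) / (y - a)) \<longlongrightarrow> 0) (at a)"
      using P_deriv[of a] a_pos by (simp add: has_field_derivative_iff P'_a)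
    then have lim: "((\<lambda>y. \<bar>(P y - P a) / (y - a)\<bar>) \<longlongrightarrow> 0) (at a)"
      by (rule tendsto_rabs_zero)
    have "((\<lambda>y. (P (clamp y) - P a) / (y - a)) \<longlongrightarrow> 0) (at a)"
    proof (rule Lim_null_comparison[OF _ lim])
      have "\<forall>\<^sub>F y in at a. y \<in> {- a<..}"
        using a_pos by (intro eventually_at_in_open') auto
      then show "\<forall>\<^sub>F y in at a. norm ((P (clamp y) - P a) / (y - a)) \<le> \<bar>(P y - P a) / (y - a)\<bar>"
        by eventually_elim (use a_pos in \<open>auto simp: clamp_def min_def\<close>)
    qed
    then show ?thesis using equal a_pos by (simp add: has_field_derivative_iff P'_a clamp_def)
  qed
  show ?thesis
  proof (cases "x > - a")
    case False
    then have "- x > - a" using a_pos by simp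
    from right[OF this] show ?thesis by (simp add: DERIV_mirror clamp_minus P_even P'_odd)
  qed (rule right)
qed

lemma P_clamp_pos: "P (clamp x) > 0"
  by (rule P_pos) (rule clamp_bounds)

lemma P_strict_antimono:
  assumes "0 \<le> x" "x < y" "y \<le> a"
  shows "P y < P x"
proof (rule DERIV_neg_imp_decreasing_open[OF \<open>x < y\<close>])
  show "\<exists>d. (P has_real_derivative d) (at u) \<and> d < 0" if "x < u" "u < y" for u
    using P_deriv[of u] P'_neg[of u] that assms by auto
  show "continuous_on {x..y} P"
    using assms by (intro continuous_at_imp_continuous_on ballI DERIV_isCont[OF P_deriv]) auto
qed

lemma P_less: "\<bar>x\<bar> < \<bar>y\<bar> \<Longrightarrow> \<bar>y\<bar> \<le> a \<Longrightarrow> P y < P x"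
  using P_strict_antimono[of "\<bar>x\<bar>" "\<bar>y\<bar>"] by (auto simp: abs_if P_even split: if_splits)

lemma P_ge_a: "\<bar>x\<bar> \<le> a \<Longrightarrow> P a \<le> P x"
  using P_less[of x a] a_pos P_even[of a] by (cases "\<bar>x\<bar> = a") (auto simp: abs_if split: if_splits)

lemma P_le_0: "\<bar>x\<bar> \<le> a \<Longrightarrow> P x \<le> P 0"
  using P_less[of 0 x] by (cases "x = 0") auto

lemma P_clamp_ge: "P a \<le> P (clamp x)"
  by (rule P_ge_a) (rule clamp_bounds)

lemma saddle_level_pos: "saddle_level > 0"
  using P_pos[of a] a_pos by (simp add: saddle_level_def)

text \<open>
  The terms with \<open>h\<close> cancel, which leaves a quantity of one sign. The factor \<open>s\<close> covers reversed
  time, \<open>s = - 1\<close>.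
\<close>

lemma energy_derivative:
  assumes "(z has_vector_derivative s *\<^sub>R field (z t)) (at t)"
  shows "((\<lambda>t. energy (z t)) has_real_derivative - s * loss (z t)) (at t)"
proof -
  obtain \<theta> \<psi> where z: "z t = (\<theta>, \<psi>)" by fastforce
  define Q where "Q = P (clamp \<theta>)"
  have Q: "Q > 0" unfolding Q_def by (rule P_clamp_pos)
  have d1: "((\<lambda>t. fst (z t)) has_real_derivative s * (k (clamp \<theta>) * sin \<psi>)) (at t)"
    using bounded_linear.has_vector_derivative[OF bounded_linear_fst assms]
    by (simp add: z field_def has_real_derivative_iff_has_vector_derivative)
  have d2: "((\<lambda>t. snd (z t)) has_real_derivative s * (k (clamp \<theta>) * (sin \<psi> / 2 + h (clamp \<theta>) * cos \<psi>))) (at t)"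
    using bounded_linear.has_vector_derivative[OF bounded_linear_snd assms]
    by (simp add: z field_def has_real_derivative_iff_has_vector_derivative)
  have dP: "((\<lambda>t. P (clamp (fst (z t)))) has_real_derivative P' (clamp \<theta>) * (s * (k (clamp \<theta>) * sin \<psi>))) (at t)"
    by (rule DERIV_chain2[OF _ d1]) (use P_clamp_deriv[of \<theta>] z in simp)
  define S where "S = sqrt (2 * Q)"
  have S: "S > 0" "S * S = 2 * Q" using Q by (simp_all add: S_def)
  have P': "P' (clamp \<theta>) = h (clamp \<theta>) * (S * S)"
    using Q by (simp add: h_def S(2) flip: Q_def)
  have dS: "((\<lambda>t. sqrt (2 * P (clamp (fst (z t))))) has_real_derivative
      h (clamp \<theta>) * S * (s * (k (clamp \<theta>) * sin \<psi>))) (at t)"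
    by (rule derivative_eq_intros dP refl | (use Q in \<open>simp add: z Q_def; fail\<close>))+
       (use Q S in \<open>simp add: z P' flip: Q_def S_def\<close>, simp add: field_simps)
  have "((\<lambda>t. sqrt (2 * P (clamp (fst (z t)))) * cos (snd (z t))) has_real_derivative
      h (clamp \<theta>) * S * (s * (k (clamp \<theta>) * sin \<psi>)) * cos \<psi> +
      (- sin \<psi> * (s * (k (clamp \<theta>) * (sin \<psi> / 2 + h (clamp \<theta>) * cos \<psi>)))) * S) (at t)"
    by (rule DERIV_cong[OF DERIV_mult[OF dS DERIV_chain2[OF DERIV_cos d2]]])
       (simp add: z S_def Q_def)
  also have "h (clamp \<theta>) * S * (s * (k (clamp \<theta>) * sin \<psi>)) * cos \<psi> +
      (- sin \<psi> * (s * (k (clamp \<theta>) * (sin \<psi> / 2 + h (clamp \<theta>) * cos \<psi>)))) * S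
      = - s * loss (z t)"
    by (simp add: z loss_def S_def Q_def power2_eq_square algebra_simps)
  finally show ?thesis by (simp add: energy_def case_prod_beta)
qed

lemma loss_nonneg: "loss z \<ge> 0"
  using k_pos[OF clamp_bounds, of "fst z"] P_clamp_pos[of "fst z"] by (simp add: loss_def case_prod_beta)

lemma solution_energy_derivative:
  "solution z \<Longrightarrow> ((\<lambda>t. energy (z t)) has_real_derivative - loss (z t)) (at t)"
  using energy_derivative[of z 1 t] by (simp add: solution_def)

lemma energy_antimono: "solution z \<Longrightarrow> s \<le> t \<Longrightarrow> energy (z t) \<le> energy (z s)"
  by (rule DERIV_nonpos_imp_nonincreasing[where f = "\<lambda>t. energy (z t)"])
     (use solution_energy_derivative loss_nonneg in \<open>meson neg_le_0_iff_le\<close>)+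

lemma solution_continuous: "solution z \<Longrightarrow> continuous_on S z"
  unfolding solution_def
  by (meson continuous_at_imp_continuous_on has_vector_derivative_continuous)

lemma energy_along_continuous: "solution z \<Longrightarrow> continuous_on S (\<lambda>t. energy (z t))"
  by (rule continuous_at_imp_continuous_on)
     (blast intro: DERIV_isCont[OF solution_energy_derivative])

lemma P_continuous: "continuous_on {-a..a} P"
  by (intro continuous_at_imp_continuous_on ballI DERIV_isCont[OF P_deriv]) (auto simp: abs_le_iff)

lemma P_clamp_continuous: "continuous_on S (\<lambda>x. P (clamp x))"
  by (intro continuous_at_imp_continuous_on ballI DERIV_isCont[OF P_clamp_deriv])

lemma energy_continuous: "continuous_on S energy"
  unfolding energy_def case_prod_beta
  by (intro continuous_intros continuous_on_compose2[OF P_clamp_continuous[of UNIV]]) auto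

lemma h_continuous: "continuous_on {-a..a} h"
  using h_lip lipschitz_on_continuous_on unfolding h_def by blast

lemma k_continuous: "continuous_on {-a..a} k"
  using k_lip lipschitz_on_continuous_on by blast

lemma clamp_continuous: "continuous_on S clamp"
  unfolding clamp_def by (intro continuous_intros)

lemma loss_continuous: "continuous_on S loss"
  unfolding loss_def case_prod_beta
  by (intro continuous_intros continuous_on_compose2[OF P_clamp_continuous[of UNIV]]
      continuous_on_compose2[OF k_continuous] continuous_on_compose2[OF clamp_continuous[of UNIV]])
     (use clamp_bounds in \<open>auto simp: abs_le_iff minus_le_iff\<close>)

text \<open>
  Where \<open>sin \<psi> = 0\<close>, \<open>\<bar>energy\<bar> = sqrt (2 * P \<theta>)\<close> is at least the saddle level. Between the levels
  of \<open>\<plusminus>saddle_level\<close> the direction of the motion in \<open>\<theta>\<close> is therefore frozen.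
\<close>

lemma sin_nonzero_below_saddle:
  assumes "\<bar>energy z\<bar> < saddle_level"
  shows "sin (snd z) \<noteq> 0"
proof
  assume "sin (snd z) = 0"
  then have "\<bar>cos (snd z)\<bar> = 1" by (simp add: sin_zero_abs_cos_one)
  then have "\<bar>energy z\<bar> = sqrt (2 * P (clamp (fst z)))"
    using P_clamp_pos[of "fst z"] by (simp add: energy_def case_prod_beta abs_mult)
  also have "\<dots> \<ge> saddle_level"
    using P_clamp_ge[of "fst z"] by (simp add: saddle_level_def)
  finally show False using assms by simp
qed

lemma energy_le: "energy z \<le> sqrt (2 * P (clamp (fst z)))"
proof -
  have "sqrt (2 * P (clamp (fst z))) * cos (snd z) \<le> sqrt (2 * P (clamp (fst z))) * 1"
    using P_clamp_pos[of "fst z"] by (intro mult_left_mono) auto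
  then show ?thesis by (simp add: energy_def case_prod_beta)
qed

lemma energy_le_top: "energy z \<le> sqrt (2 * P 0)"
  using energy_le[of z] P_le_0[OF clamp_bounds, of "fst z"] by (simp add: order_trans)

lemma energy_less_top:
  assumes "z \<in> strip" "z \<noteq> 0" shows "energy z < sqrt (2 * P 0)"
proof (cases "fst z = 0")
  case False
  have "\<bar>fst z\<bar> < a" using assms by (auto simp: strip_def)
  then have "P (fst z) < P 0" using False P_less[of 0 "fst z"] by simp
  then have "sqrt (2 * P (clamp (fst z))) < sqrt (2 * P 0)"
    using \<open>\<bar>fst z\<bar> < a\<close> by (simp add: clamp_id)
  with energy_le[of z] show ?thesis by (rule le_less_trans)
next
  case True
  then have "snd z \<noteq> 0" using assms(2) by (auto simp: prod_eq_iff)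
  moreover have "\<bar>snd z\<bar> < pi / 2" using assms(1) by (auto simp: strip_def)
  ultimately have "cos \<bar>snd z\<bar> < cos 0" by (intro cos_monotone_0_pi) auto
  then have "cos (snd z) < 1" by simp
  moreover have "sqrt (2 * P 0) > 0" using P_pos[of 0] a_pos by simp
  ultimately show ?thesis using True a_pos by (simp add: energy_def case_prod_beta clamp_id)
qed

text \<open>
  The disc around \<open>Q\<close> with \<open>E\<^sub>\<plusminus>\<close> on its rim, seen in the coordinates \<open>(\<theta>, \<psi>)\<close>.
\<close>

definition cap :: "(real \<times> real) set" where
  "cap = {z \<in> strip. saddle_level < energy z}"

lemma energy_at_edge:
  assumes "\<bar>\<theta>\<bar> = a" shows "energy (\<theta>, \<psi>) \<le> saddle_level"
proof -
  have "P (clamp \<theta>) = P a" using assms a_pos P_even[of a] by (auto simp: clamp_id abs_if split: if_splits)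
  then show ?thesis using energy_le[of "(\<theta>, \<psi>)"] by (simp add: saddle_level_def)
qed

lemma closed_strip_above_saddle:
  assumes "z \<in> {-a..a} \<times> {-(pi/2)..pi/2}" "saddle_level < energy z"
  shows "z \<in> strip"
proof -
  have z: "z = (fst z, snd z)" by simp
  have "\<bar>fst z\<bar> \<noteq> a" using assms(2) energy_at_edge[of "fst z" "snd z"] by auto
  moreover have "cos (snd z) \<noteq> 0"
    using assms(2) saddle_level_pos by (auto simp: energy_def case_prod_beta)
  then have "snd z \<noteq> pi / 2" "snd z \<noteq> - (pi / 2)" by (metis cos_pi_half cos_minus)+
  ultimately show ?thesis using assms(1) by (cases z) (auto simp: strip_def)
qed

text \<open>
  On the boundary of the strip the energy is at most the saddle level.
\<close>

lemma stays_in_strip: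
  assumes "connected T" "continuous_on T z" "t0 \<in> T" "z t0 \<in> strip"
    and above: "\<And>t. t \<in> T \<Longrightarrow> saddle_level < energy (z t)" and "t \<in> T"
  shows "z t \<in> strip"
proof -
  let ?K = "{-a..a} \<times> {-(pi/2)..pi/2}"
  have "connected (z ` T)" using assms by (intro connected_continuous_image)
  moreover have "open strip" unfolding strip_def by (intro open_Times) auto
  moreover have "open (- ?K)" by (intro open_Compl closed_Times) auto
  moreover have "strip \<inter> - ?K \<inter> z ` T = {}" by (auto simp: strip_def)
  moreover have "z ` T \<subseteq> strip \<union> - ?K"
  proof
    fix p assume "p \<in> z ` T"
    then have "saddle_level < energy p" using above by auto
    then show "p \<in> strip \<union> - ?K" using closed_strip_above_saddle by (cases "p \<in> ?K") auto
  qed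
  ultimately have "strip \<inter> z ` T = {} \<or> - ?K \<inter> z ` T = {}" by (rule connectedD)
  moreover have "z t0 \<in> strip \<inter> z ` T" using assms(3,4) by simp
  moreover have "z t \<in> z ` T" using \<open>t \<in> T\<close> by simp
  ultimately have "z t \<in> ?K" by blast
  then show ?thesis using above \<open>t \<in> T\<close> by (intro closed_strip_above_saddle)
qed

text \<open>
  LaSalle's principle by two applications of \<open>barbalat\<close>. The energy converges, so its derivative tends
  to \<open>0\<close>, which forces \<open>\<psi> \<rightarrow> 0\<close>. Then \<open>\<psi>\<close> converges, so \<open>\<psi>'\<close> tends to \<open>0\<close>, which forces
  \<open>h \<theta> \<rightarrow> 0\<close>.
\<close>

lemma settles:
  assumes der: "\<And>t. t \<ge> 0 \<Longrightarrow> (y has_vector_derivative s *\<^sub>R field (y t)) (at t)"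
    and s: "\<bar>s\<bar> = 1" and y: "\<And>t. t \<ge> 0 \<Longrightarrow> y t \<in> strip"
    and E: "((\<lambda>t. energy (y t)) \<longlongrightarrow> l) at_top"
  shows "((\<lambda>t. snd (y t)) \<longlongrightarrow> 0) at_top"
    and "((\<lambda>t. sqrt (2 * P (fst (y t)))) \<longlongrightarrow> l) at_top"
    and "((\<lambda>t. h (fst (y t))) \<longlongrightarrow> 0) at_top"
proof -
  let ?K = "{-a..a} \<times> {-(pi/2)..pi/2}"
  have K: "compact ?K" by (intro compact_Times) auto
  have yK: "y t \<in> ?K" if "t \<ge> 0" for t using y[OF that] by (auto simp: strip_def)
  have clamp: "clamp (fst (y t)) = fst (y t)" if "t \<ge> 0" for t
    using y[OF that] by (intro clamp_id) (auto simp: strip_def)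
  obtain L C where C: "\<And>z. norm (field z) \<le> C" using field_bounded_lipschitz by metis
  then have C': "norm (s *\<^sub>R field z) \<le> C" for z using s by simp
  note osc = oscillation_along_path[OF K _ yK der C']
  have loss: "((\<lambda>t. - s * loss (y t)) \<longlongrightarrow> 0) at_top"
  proof (rule barbalat[OF E])
    show "\<forall>\<^sub>F t in at_top. ((\<lambda>t. energy (y t)) has_real_derivative - s * loss (y t)) (at t)"
      using eventually_ge_at_top[of 0] by eventually_elim (rule energy_derivative[OF der])
    show "\<exists>d>0. \<forall>\<^sub>F t in at_top. \<forall>u\<in>{t..t+d}. \<bar>- s * loss (y u) - - s * loss (y t)\<bar> \<le> e"
      if "e > 0" for e
      by (rule osc[of "\<lambda>z. - s * loss z"]) (use that in \<open>auto intro!: continuous_intros loss_continuous\<close>)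
  qed
  define c where "c x = k x * sqrt (2 * P x) / 2" for x
  have c_cont: "continuous_on {-a..a} c"
    unfolding c_def by (intro continuous_intros k_continuous P_continuous) simp
  obtain x where x: "x \<in> {-a..a}" "\<And>u. u \<in> {-a..a} \<Longrightarrow> c x \<le> c u"
    using continuous_attains_inf[OF _ _ c_cont] a_pos by auto
  have cx: "c x > 0" using x k_pos[of x] P_pos[of x] by (auto simp: c_def abs_le_iff)
  have "((\<lambda>t. (sin (snd (y t)))\<^sup>2) \<longlongrightarrow> 0) at_top"
  proof (rule tendsto_zero_if_mult_le[OF loss cx])
    show "\<forall>\<^sub>F t in at_top. c x * \<bar>(sin (snd (y t)))\<^sup>2\<bar> \<le> \<bar>- s * loss (y t)\<bar>"
      using eventually_ge_at_top[of 0]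
    proof eventually_elim
      case (elim t)
      have "c x \<le> c (fst (y t))" using y[OF elim] by (intro x) (auto simp: strip_def)
      then have "c x * (sin (snd (y t)))\<^sup>2 \<le> c (fst (y t)) * (sin (snd (y t)))\<^sup>2"
        by (intro mult_right_mono) auto
      also have "\<dots> = loss (y t)" using clamp[OF elim] by (simp add: loss_def c_def case_prod_beta)
      also have "\<dots> = \<bar>- s * loss (y t)\<bar>" using s loss_nonneg by (simp add: abs_mult)
      finally show ?case by simp
    qed
  qed
  then show \<psi>: "((\<lambda>t. snd (y t)) \<longlongrightarrow> 0) at_top"
  proof (rule tendsto_unique_zero[where K = "{-(pi/2)..pi/2}" and f = "\<lambda>x. (sin x)\<^sup>2", rotated -1])
    show "continuous_on {-(pi/2)..pi/2} (\<lambda>x::real. (sin x)\<^sup>2)" by (intro continuous_intros)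
    show "x = 0" if "x \<in> {-(pi/2)..pi/2}" "(sin x)\<^sup>2 = 0" for x :: real
    proof (rule sin_eq_0_pi)
      show "- pi < x" "x < pi" using that(1) pi_gt_zero unfolding atLeastAtMost_iff by linarith+
    qed (use that in simp)
    show "\<forall>\<^sub>F t in at_top. snd (y t) \<in> {-(pi/2)..pi/2}"
      using eventually_ge_at_top[of 0] by eventually_elim (use yK in \<open>auto simp: mem_Times_iff\<close>)
  qed simp
  have cos1: "((\<lambda>t. cos (snd (y t))) \<longlongrightarrow> 1) at_top" using tendsto_cos[OF \<psi>] by simp
  have sin0: "((\<lambda>t. sin (snd (y t))) \<longlongrightarrow> 0) at_top" using tendsto_sin[OF \<psi>] by simp
  have cos_pos: "cos (snd (y t)) > 0" if "t \<ge> 0" for t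
    using y[OF that] by (intro cos_gt_zero_pi) (auto simp: strip_def)
  have "((\<lambda>t. energy (y t) / cos (snd (y t))) \<longlongrightarrow> l / 1) at_top"
    by (intro tendsto_divide E cos1) simp
  then have "((\<lambda>t. energy (y t) / cos (snd (y t))) \<longlongrightarrow> l) at_top" by simp
  then show "((\<lambda>t. sqrt (2 * P (fst (y t)))) \<longlongrightarrow> l) at_top"
  proof (rule Lim_transform_eventually)
    show "\<forall>\<^sub>F t in at_top. energy (y t) / cos (snd (y t)) = sqrt (2 * P (fst (y t)))"
      using eventually_ge_at_top[of 0]
      by eventually_elim (use clamp cos_pos in \<open>force simp: energy_def case_prod_beta\<close>)
  qed
  have f: "((\<lambda>t. s * snd (field (y t))) \<longlongrightarrow> 0) at_top"
  proof (rule barbalat[OF \<psi>])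
    show "\<forall>\<^sub>F t in at_top. ((\<lambda>t. snd (y t)) has_real_derivative s * snd (field (y t))) (at t)"
      using eventually_ge_at_top[of 0]
    proof eventually_elim
      case (elim t)
      from bounded_linear.has_vector_derivative[OF bounded_linear_snd der[OF elim]]
      show ?case by (simp add: has_real_derivative_iff_has_vector_derivative)
    qed
    show "\<exists>d>0. \<forall>\<^sub>F t in at_top. \<forall>u\<in>{t..t+d}. \<bar>s * snd (field (y u)) - s * snd (field (y t))\<bar> \<le> e"
      if "e > 0" for e
      by (rule osc[of "\<lambda>z. s * snd (field z)"]) (use that in \<open>auto intro!: continuous_intros field_continuous\<close>)
  qed
  obtain x where x: "x \<in> {-a..a}" "\<And>u. u \<in> {-a..a} \<Longrightarrow> k x \<le> k u"
    using continuous_attains_inf[OF _ _ k_continuous] a_pos by auto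
  have kx: "k x > 0" using x k_pos[of x] by (auto simp: abs_le_iff)
  have "((\<lambda>t. sin (snd (y t)) / 2 + h (fst (y t)) * cos (snd (y t))) \<longlongrightarrow> 0) at_top"
  proof (rule tendsto_zero_if_mult_le[OF f kx])
    show "\<forall>\<^sub>F t in at_top. k x * \<bar>sin (snd (y t)) / 2 + h (fst (y t)) * cos (snd (y t))\<bar>
        \<le> \<bar>s * snd (field (y t))\<bar>"
      using eventually_ge_at_top[of 0]
    proof eventually_elim
      case (elim t)
      let ?g = "sin (snd (y t)) / 2 + h (fst (y t)) * cos (snd (y t))"
      have "0 < k x \<and> k x \<le> k (fst (y t))" using y[OF elim] kx by (auto intro!: x simp: strip_def)
      then have "k x * \<bar>?g\<bar> \<le> \<bar>k (fst (y t))\<bar> * \<bar>?g\<bar>"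
        by (intro mult_right_mono) auto
      also have "\<dots> = \<bar>s * snd (field (y t))\<bar>"
        using clamp[OF elim] s by (simp add: field_def case_prod_beta abs_mult)
      finally show ?case .
    qed
  qed
  then have "((\<lambda>t. (sin (snd (y t)) / 2 + h (fst (y t)) * cos (snd (y t)) - sin (snd (y t)) / 2)
      / cos (snd (y t))) \<longlongrightarrow> (0 - 0 / 2) / 1) at_top"
    by (intro tendsto_divide tendsto_diff sin0 cos1 tendsto_const) auto
  then have "((\<lambda>t. (sin (snd (y t)) / 2 + h (fst (y t)) * cos (snd (y t)) - sin (snd (y t)) / 2)
      / cos (snd (y t))) \<longlongrightarrow> 0) at_top" by simp
  then show "((\<lambda>t. h (fst (y t))) \<longlongrightarrow> 0) at_top"
  proof (rule Lim_transform_eventually)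
    show "\<forall>\<^sub>F t in at_top. (sin (snd (y t)) / 2 + h (fst (y t)) * cos (snd (y t)) - sin (snd (y t)) / 2)
      / cos (snd (y t)) = h (fst (y t))"
      using eventually_ge_at_top[of 0]
      by eventually_elim (use cos_pos in force)
  qed
qed

lemma zero_in_cap: "0 \<in> cap"
  using a_pos P_less[of 0 a] by (auto simp: cap_def strip_def zero_prod_def energy_def saddle_level_def clamp_id)

lemma open_cap: "open cap"
proof -
  have "open {z. saddle_level < energy z}"
    using open_Collect_less[OF continuous_on_const energy_continuous[of UNIV]] by simp
  moreover have "open strip" unfolding strip_def by (intro open_Times) auto
  ultimately have "open (strip \<inter> {z. saddle_level < energy z})" by (intro open_Int)
  then show ?thesis by (simp add: cap_def Int_def)
qed

text \<open>
  Backward in time the energy grows and stays above the saddle level.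
\<close>

lemma cap_backward:
  assumes z: "solution z" "z 0 \<in> cap" and t: "t \<le> 0"
  shows "z t \<in> cap"
proof -
  have e: "saddle_level < energy (z s)" if "s \<le> 0" for s
    using energy_antimono[OF z(1) that] z(2) by (auto simp: cap_def)
  have "z t \<in> strip"
    by (rule stays_in_strip[of "{..0}" z 0]) (use z t e solution_continuous in \<open>auto simp: cap_def\<close>)
  then show ?thesis using e[OF t] by (simp add: cap_def)
qed

text \<open>
  Backward in time the energy tends to a limit above the saddle level, so \<open>\<theta>\<close> ends up in a compact set
  that avoids \<open>\<plusminus>a\<close>; there \<open>0\<close> is the only zero of \<open>h\<close>.
\<close>

lemma emerges_from_top:
  assumes z: "solution z" "z 0 \<in> cap"
  shows "(z \<longlongrightarrow> 0) at_bot"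
proof -
  define y where "y t = z (- t)" for t
  have "(y has_vector_derivative (-1) *\<^sub>R field (y t)) (at t)" for t
  proof -
    have "(uminus has_vector_derivative (-1::real)) (at t)"
      by (auto intro!: derivative_eq_intros simp flip: has_real_derivative_iff_has_vector_derivative)
    moreover have "(z has_vector_derivative field (z (- t))) (at (- t))"
      using z(1) by (simp add: solution_def)
    ultimately show ?thesis using vector_diff_chain_at[of uminus "-1" t z] by (simp add: o_def y_def[abs_def])
  qed
  note der = this
  have y: "y t \<in> cap" if "t \<ge> 0" for t
    unfolding y_def by (rule cap_backward[OF z]) (use that in simp)
  then have ys: "y t \<in> strip" if "t \<ge> 0" for t using that by (auto simp: cap_def)
  obtain l where l: "((\<lambda>t. energy (y t)) \<longlongrightarrow> l) at_top" "\<And>t. 0 \<le> t \<Longrightarrow> energy (y t) \<le> l"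
    by (rule mono_bounded_converges[of 0 "\<lambda>t. energy (y t)" "sqrt (2 * P 0)"])
       (use energy_antimono[OF z(1)] energy_le_top in \<open>auto simp: y_def\<close>)
  have "saddle_level < l" using l(2)[of 0] y[of 0] by (auto simp: cap_def)
  then obtain m where m: "saddle_level < m" "m < l" using dense by blast
  note s = settles[of y "-1", OF der _ ys l(1), simplified]
  let ?f = "\<lambda>x. sqrt (2 * P x)"
  have f_cont: "continuous_on {-a..a} ?f" by (intro continuous_intros P_continuous)
  let ?K = "{-a..a} \<inter> ?f -` {m..}"
  have "closed ?K" by (rule continuous_closed_preimage[OF f_cont]) auto
  moreover have "bounded ?K" by (rule bounded_subset[of "{-a..a}"]) auto
  ultimately have K: "compact ?K" by (simp add: compact_eq_bounded_closed)
  have 1: "((\<lambda>t. fst (y t)) \<longlongrightarrow> 0) at_top"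
  proof (rule tendsto_unique_zero[where f = h and y = "\<lambda>t. fst (y t)", OF K _ _ _ s(3)])
    show "continuous_on ?K h" by (rule continuous_on_subset[OF h_continuous]) auto
    show "x = 0" if x: "x \<in> ?K" "h x = 0" for x
    proof -
      have "x \<noteq> a" "x \<noteq> - a" using x(1) m(1) P_even[of a] by (auto simp: saddle_level_def)
      then show ?thesis using h_eq_0[of x] x by auto
    qed
    show "\<forall>\<^sub>F t in at_top. fst (y t) \<in> ?K"
      using order_tendstoD(1)[OF s(2) m(2)] eventually_ge_at_top[of 0]
      by eventually_elim (use ys in \<open>force simp: strip_def\<close>)
  qed
  have "((\<lambda>t. (fst (y t), snd (y t))) \<longlongrightarrow> (0, 0)) at_top" by (rule tendsto_Pair[OF 1 s(1)])
  then have "(y \<longlongrightarrow> 0) at_top" by (simp add: zero_prod_def)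
  then show ?thesis unfolding y_def filterlim_at_bot_mirror .
qed

text \<open>
  If the energy came down to the saddle level at a first time \<open>t\<close>, it would be stationary there, so
  \<open>\<psi> = 0\<close> and hence \<open>\<theta> = \<plusminus>a\<close>. But that is a rest point, and no other solution passes through it.
\<close>

lemma stays_above_saddle:
  assumes z: "solution z" "z 0 \<in> cap" and above: "\<And>t. t \<ge> 0 \<Longrightarrow> saddle_level \<le> energy (z t)"
    and "t \<ge> 0"
  shows "z t \<in> cap"
proof -
  have strict: "saddle_level < energy (z s)" if s: "s \<ge> 0" for s
  proof (rule ccontr)
    assume "\<not> saddle_level < energy (z s)"
    then have "energy (z s) \<le> saddle_level" "saddle_level < energy (z 0)"
      using z(2) by (auto simp: cap_def)
    then obtain t where t: "0 < t" "energy (z t) = saddle_level"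
        "\<And>u. 0 \<le> u \<Longrightarrow> u < t \<Longrightarrow> saddle_level < energy (z u)"
      using first_hit[OF energy_along_continuous[OF z(1)] s] by blast
    have in_strip: "z u \<in> strip" if "0 \<le> u" "u < t" for u
      by (rule stays_in_strip[of "{0..<t}" z 0])
         (use t z that solution_continuous in \<open>auto simp: cap_def\<close>)
    have "z t \<in> {-a..a} \<times> {-(pi/2)..pi/2}"
    proof (rule Lim_in_closed_set)
      show "(z \<longlongrightarrow> z t) (at_left t)"
        using solution_continuous[OF z(1), of UNIV] by (simp add: continuous_on_eq_continuous_at isCont_def filterlim_at_split)
      show "\<forall>\<^sub>F u in at_left t. z u \<in> {-a..a} \<times> {-(pi/2)..pi/2}"
        using eventually_at_left_real[OF t(1)]
      proof eventually_elim
        case (elim u)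
        then have "z u \<in> strip" using in_strip[of u] by simp
        then show ?case by (auto simp: strip_def)
      qed
    qed (auto intro!: closed_Times)
    then have bd: "\<bar>fst (z t)\<bar> \<le> a" "\<bar>snd (z t)\<bar> \<le> pi / 2" by (auto simp: mem_Times_iff abs_le_iff)
    have "loss (z t) = 0"
    proof (rule ccontr)
      assume "loss (z t) \<noteq> 0"
      then have "- loss (z t) < 0" using loss_nonneg[of "z t"] by simp
      from DERIV_neg_dec_right[OF solution_energy_derivative[OF z(1)] this]
      obtain d where d: "d > 0" "\<And>u. 0 < u \<Longrightarrow> u < d \<Longrightarrow> energy (z (t + u)) < energy (z t)" by blast
      have "energy (z (t + d / 2)) < energy (z t)" using d(1) by (intro d(2)) auto
      then show False using above[of "t + d / 2"] t d(1) by auto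
    qed
    then have sin: "sin (snd (z t)) = 0"
      using k_pos[OF clamp_bounds, of "fst (z t)"] P_clamp_pos[of "fst (z t)"]
      by (simp add: loss_def case_prod_beta)
    have "- pi < snd (z t)" "snd (z t) < pi" using bd(2) pi_gt_zero by linarith+
    from sin_eq_0_pi[OF this sin] have "snd (z t) = 0" .
    then have "P (fst (z t)) = P a"
      using t(2) bd(1) by (simp add: energy_def case_prod_beta clamp_id saddle_level_def)
    then have "\<bar>fst (z t)\<bar> = a" using P_less[of "fst (z t)" a] bd(1) a_pos by fastforce
    then have "z t = (a, 0) \<or> z t = (- a, 0)" using \<open>snd (z t) = 0\<close> by (cases "z t") auto
    then obtain p where p: "z t = p" "field p = 0" "p = (a, 0) \<or> p = (- a, 0)" using field_rest by metis
    have "solution (\<lambda>_. p)" using p(2) by (simp add: solution_def)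
    then have "z = (\<lambda>_. p)" by (rule solution_unique[OF z(1)]) (rule p)
    then have "z 0 = p" by simp
    then show False using p(3) z(2) by (auto simp: cap_def strip_def)
  qed
  have "z t \<in> strip"
    by (rule stays_in_strip[of "{0..}" z 0]) (use z strict \<open>t \<ge> 0\<close> solution_continuous in \<open>auto simp: cap_def\<close>)
  then show ?thesis using strict \<open>t \<ge> 0\<close> by (simp add: cap_def)
qed

text \<open>
  The energy stays below its value at the top by a fixed amount. This keeps \<open>\<theta>\<close> away from \<open>0\<close>, so its
  sign is eventually constant and one zero of \<open>h\<close> is left for the limit.
\<close>

lemma ends_at_saddle:
  assumes z: "solution z" "z 0 \<in> cap" "z 0 \<noteq> 0"
    and above: "\<And>t. t \<ge> 0 \<Longrightarrow> saddle_level \<le> energy (z t)"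
  shows "(z \<longlongrightarrow> (a, 0)) at_top \<or> (z \<longlongrightarrow> (- a, 0)) at_top"
proof -
  have zb: "z t \<in> cap" if "t \<ge> 0" for t by (rule stays_above_saddle[OF z(1,2) above that])
  then have zs: "z t \<in> strip" if "t \<ge> 0" for t using that by (auto simp: cap_def)
  obtain l where l: "((\<lambda>t. - energy (z t)) \<longlongrightarrow> l) at_top" "\<And>t. 0 \<le> t \<Longrightarrow> - energy (z t) \<le> l"
    by (rule mono_bounded_converges[of 0 "\<lambda>t. - energy (z t)" "- saddle_level"])
       (use energy_antimono[OF z(1)] above in auto)
  have E: "((\<lambda>t. energy (z t)) \<longlongrightarrow> - l) at_top" using tendsto_minus[OF l(1)] by simp
  have "energy (z 0) < sqrt (2 * P 0)" using energy_less_top z by (auto simp: cap_def)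
  then have "- l < sqrt (2 * P 0)" using l(2)[of 0] by simp
  then obtain m where m: "- l < m" "m < sqrt (2 * P 0)" using dense by blast
  have der: "(z has_vector_derivative 1 *\<^sub>R field (z t)) (at t)" for t
    using z(1) by (simp add: solution_def)
  note s = settles[of z 1, OF der _ zs E, simplified]
  let ?f = "\<lambda>x. sqrt (2 * P x)"
  have f_cont: "continuous_on {-a..a} ?f" by (intro continuous_intros P_continuous)
  have ev: "\<forall>\<^sub>F t in at_top. ?f (fst (z t)) \<le> m \<and> \<bar>fst (z t)\<bar> \<le> a"
    using order_tendstoD(2)[OF s(2) m(1)] eventually_ge_at_top[of 0]
    by eventually_elim (use zs in \<open>force simp: strip_def abs_le_iff\<close>)
  then obtain T where T: "\<And>t. t \<ge> T \<Longrightarrow> ?f (fst (z t)) \<le> m \<and> \<bar>fst (z t)\<bar> \<le> a"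
    by (auto simp: eventually_at_top_linorder)
  have nz: "fst (z t) \<noteq> 0" if "t \<ge> T" for t using T[OF that] m(2) by auto
  have fst_cont: "continuous_on S (\<lambda>t. fst (z t))" for S
    by (intro continuous_intros solution_continuous[OF z(1)])
  have lim: "(z \<longlongrightarrow> (b, 0)) at_top"
    if b: "b = a \<or> b = - a" and sgn: "\<And>t. t \<ge> T \<Longrightarrow> b * fst (z t) > 0" for b
  proof -
    let ?K = "({-a..a} \<inter> ?f -` {..m}) \<inter> {x. b * x \<ge> 0}"
    have "closed ({-a..a} \<inter> ?f -` {..m})" by (rule continuous_closed_preimage[OF f_cont]) auto
    moreover have "closed {x. b * x \<ge> 0}" by (intro closed_Collect_le continuous_intros)
    ultimately have "closed ?K" by (rule closed_Int)
    moreover have "bounded ?K" by (rule bounded_subset[of "{-a..a}"]) auto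
    ultimately have K: "compact ?K" by (simp add: compact_eq_bounded_closed)
    have 1: "((\<lambda>t. fst (z t)) \<longlongrightarrow> b) at_top"
    proof (rule tendsto_unique_zero[where f = h and y = "\<lambda>t. fst (z t)", OF K _ _ _ s(3)])
      show "continuous_on ?K h" by (rule continuous_on_subset[OF h_continuous]) auto
      show "x = b" if x: "x \<in> ?K" "h x = 0" for x
      proof -
        have "x \<noteq> 0" using x(1) m(2) by auto
        moreover have "x = 0 \<or> x = a \<or> x = - a" using x by (intro h_eq_0) (auto simp: abs_le_iff)
        moreover have "b * x \<ge> 0" using x by simp
        moreover have "a * a > 0" using a_pos by simp
        ultimately show ?thesis using b by auto
      qed
      show "\<forall>\<^sub>F t in at_top. fst (z t) \<in> ?K"
        using eventually_ge_at_top[of T]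
        by eventually_elim (use T sgn in \<open>force simp: abs_le_iff\<close>)
    qed
    have "((\<lambda>t. (fst (z t), snd (z t))) \<longlongrightarrow> (b, 0)) at_top" by (rule tendsto_Pair[OF 1 s(1)])
    then show ?thesis by simp
  qed
  show ?thesis
  proof (cases "fst (z T) > 0")
    case True
    have "fst (z t) > 0" if "t \<ge> T" for t
      by (rule nonzero_keeps_sign[of "{T..}" "\<lambda>t. fst (z t)" T t]) (use fst_cont nz that True in auto)
    then show ?thesis using lim[of a] a_pos by simp
  next
    case False
    have "continuous_on {T..} (\<lambda>t. - fst (z t))" by (intro continuous_on_minus fst_cont)
    moreover have "- fst (z T) > 0" using False nz[of T] by simp
    ultimately have "- fst (z t) > 0" if "t \<ge> T" for t
      using nonzero_keeps_sign[of "{T..}" "\<lambda>t. - fst (z t)" T t] nz that by simp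
    then show ?thesis using lim[of "- a"] a_pos by (simp add: mult_neg_neg mult_pos_neg)
  qed
qed

lemma sin_keeps_sign_below_saddle:
  assumes z: "solution z" and "s \<le> t" "\<bar>energy (z s)\<bar> < saddle_level" "\<bar>energy (z t)\<bar> < saddle_level"
    and "e * sin (snd (z s)) > 0"
  shows "e * sin (snd (z t)) > 0"
proof (rule nonzero_keeps_sign[of "{s..t}" "\<lambda>u. e * sin (snd (z u))" s t])
  show "continuous_on {s..t} (\<lambda>u. e * sin (snd (z u)))"
    by (intro continuous_intros solution_continuous z)
  show "e * sin (snd (z u)) \<noteq> 0" if "u \<in> {s..t}" for u
  proof -
    have "energy (z t) \<le> energy (z u)" "energy (z u) \<le> energy (z s)"
      using that by (auto intro!: energy_antimono z)
    then have "\<bar>energy (z u)\<bar> < saddle_level" using assms by auto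
    from sin_nonzero_below_saddle[OF this] show ?thesis using assms(5) by auto
  qed
qed (use assms in auto)

text \<open>
  The states of solutions that have left the cap to the right (\<open>e = 1\<close>) or to the left (\<open>e = - 1\<close>).
\<close>

definition crosses :: "real \<Rightarrow> (real \<times> real) set" where
  "crosses e = {z. \<bar>energy z\<bar> < saddle_level \<and> e * sin (snd z) > 0}"

lemma open_crosses: "open (crosses e)"
proof -
  have "open {z. \<bar>energy z\<bar> < saddle_level}"
    by (intro open_Collect_less continuous_intros energy_continuous)
  moreover have "open {z :: real \<times> real. 0 < e * sin (snd z)}"
    by (intro open_Collect_less continuous_intros)
  ultimately show ?thesis unfolding crosses_def by (rule open_Collect_conj)
qed

text \<open>
  Let \<open>A 1\<close> and \<open>A (- 1)\<close> be the sets of parameters of a small half circle around \<open>0\<close> whose solutions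
  leave the cap to the right and to the left. They are open by continuous dependence and disjoint as
  the sign of \<open>sin \<psi>\<close> is frozen after the exit, and the symmetry \<open>z \<mapsto> - z\<close> maps one end point of the
  half circle to the other and exchanges the two sets. So they cannot cover the connected half circle.
  A solution from outside both never falls below the saddle level; it ends at a saddle, and after a
  reflection at the right one.
\<close>

lemma connection_exists:
  obtains z where "solution z" "\<And>t. z t \<in> cap" "z 0 \<noteq> 0" "(z \<longlongrightarrow> 0) at_bot" "(z \<longlongrightarrow> (a, 0)) at_top"
proof -
  obtain e where e: "e > 0" "ball 0 e \<subseteq> cap"
    using open_cap zero_in_cap by (auto simp: open_contains_ball)
  define r where "r = e / 2"
  have r: "r > 0" using e by (simp add: r_def)
  define circle where "circle s = (r * cos s, r * sin s)" for s
  have norm_circle: "norm (circle s) = r" for s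
  proof -
    have "(r * cos s)\<^sup>2 + (r * sin s)\<^sup>2 = r\<^sup>2 * ((sin s)\<^sup>2 + (cos s)\<^sup>2)"
      by (simp only: power_mult_distrib distrib_left add.commute)
    then have "(r * cos s)\<^sup>2 + (r * sin s)\<^sup>2 = r\<^sup>2" by (simp only: sin_cos_squared_add mult_1_right)
    then show ?thesis using r by (simp add: circle_def norm_Pair)
  qed
  have circle_cap: "circle s \<in> cap" for s
    using e norm_circle[of s] by (intro subsetD[OF e(2)]) (simp add: r_def)
  have circle_nz: "circle s \<noteq> 0" for s using norm_circle[of s] r by auto
  \<comment> \<open>the solution that starts at the point \<open>circle s\<close>\<close>
  define \<phi> where "\<phi> s = (SOME z. solution z \<and> z 0 = circle s)" for s
  have \<phi>: "solution (\<phi> s)" "\<phi> s 0 = circle s" for s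
  proof -
    have "\<exists>z. solution z \<and> z 0 = circle s" using solution_exists by metis
    from someI_ex[OF this] show "solution (\<phi> s)" "\<phi> s 0 = circle s" by (auto simp: \<phi>_def)
  qed
  obtain L where L: "L-lipschitz_on UNIV field" using field_bounded_lipschitz by metis
  have \<phi>_cont: "continuous_on UNIV (\<lambda>s. \<phi> s t)" if "t \<ge> 0" for t
  proof (rule continuous_at_imp_continuous_on, rule ballI)
    fix s
    have "((\<lambda>u. circle u) \<longlongrightarrow> circle s) (at s)" unfolding circle_def by (intro tendsto_intros)
    then have "((\<lambda>u. exp (L * (t - 0)) * norm (circle u - circle s)) \<longlongrightarrow> exp (L * (t - 0)) * norm (circle s - circle s)) (at s)"
      by (intro tendsto_intros)
    then have lim: "((\<lambda>u. exp (L * (t - 0)) * norm (circle u - circle s)) \<longlongrightarrow> 0) (at s)" by simp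
    have "((\<lambda>u. \<phi> u t - \<phi> s t) \<longlongrightarrow> 0) (at s)"
    proof (rule Lim_null_comparison[OF _ lim], rule always_eventually, rule allI)
      fix u
      show "norm (\<phi> u t - \<phi> s t) \<le> exp (L * (t - 0)) * norm (circle u - circle s)"
        using gronwall_forward[OF L that, of "\<phi> u" "\<phi> s"] \<phi> by (simp add: solution_def)
    qed
    then show "isCont (\<lambda>s. \<phi> s t) s" by (simp add: isCont_def LIM_zero_iff)
  qed
  define A where "A e = (\<Union>t\<in>{0..}. (\<lambda>s. \<phi> s t) -` crosses e)" for e :: real
  have A_open: "open (A e)" for e
    unfolding A_def by (intro open_UN ballI open_vimage open_crosses \<phi>_cont) auto
  have A_disjoint: "A 1 \<inter> A (- 1) = {}"
  proof (rule ccontr)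
    assume "A 1 \<inter> A (- 1) \<noteq> {}"
    then obtain s t u where "\<phi> s t \<in> crosses 1" "\<phi> s u \<in> crosses (- 1)"
      unfolding A_def by blast
    then show False
      using sin_keeps_sign_below_saddle[OF \<phi>(1), of t u s 1]
        sin_keeps_sign_below_saddle[OF \<phi>(1), of u t s "- 1"] by (cases "t \<le> u") (auto simp: crosses_def)
  qed
  have \<phi>_pi: "\<phi> pi = (\<lambda>t. - \<phi> 0 t)"
    by (rule solution_unique[OF \<phi>(1) solution_minus[OF \<phi>(1)], of _ 0]) (simp add: \<phi>(2) circle_def)
  \<comment> \<open>the two ends of the half circle leave the cap on opposite sides\<close>
  have A_sym: "0 \<in> A e \<longleftrightarrow> pi \<in> A (- e)" for e
    by (simp add: A_def \<phi>_pi crosses_def energy_minus)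
  have "\<not> {0..pi} \<subseteq> A 1 \<union> A (- 1)"
  proof
    assume sub: "{0..pi} \<subseteq> A 1 \<union> A (- 1)"
    have "A 1 \<inter> {0..pi} = {} \<or> A (- 1) \<inter> {0..pi} = {}"
      by (rule connectedD[OF _ A_open A_open _ sub]) (use A_disjoint in auto)
    moreover have "0 \<in> A 1 \<union> A (- 1)" "0 \<in> {0..pi}" "pi \<in> {0..pi}"
      using subsetD[OF sub, of 0] by auto
    ultimately show False using A_sym[of 1] A_sym[of "- 1"] by auto
  qed
  then obtain s where s: "s \<notin> A 1" "s \<notin> A (- 1)" by auto
  have above: "saddle_level \<le> energy (\<phi> s t)" if t: "t \<ge> 0" for t
  proof (rule ccontr)
    assume "\<not> saddle_level \<le> energy (\<phi> s t)"
    moreover have "saddle_level < energy (\<phi> s 0)" using circle_cap[of s] \<phi>(2) by (simp add: cap_def)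
    \<comment> \<open>just after the exit the energy still lies between \<open>- saddle_level\<close> and \<open>saddle_level\<close>\<close>
    ultimately obtain u where u: "0 \<le> u" "energy (\<phi> s u) = max (energy (\<phi> s t)) (saddle_level / 2)"
      using IVT2'[of "\<lambda>t. energy (\<phi> s t)" t "max (energy (\<phi> s t)) (saddle_level / 2)" 0]
        energy_along_continuous[OF \<phi>(1)] saddle_level_pos t by auto
    then have "\<bar>energy (\<phi> s u)\<bar> < saddle_level"
      using \<open>\<not> saddle_level \<le> energy (\<phi> s t)\<close> saddle_level_pos by auto
    moreover from sin_nonzero_below_saddle[OF this]
    have "1 * sin (snd (\<phi> s u)) > 0 \<or> - 1 * sin (snd (\<phi> s u)) > 0" by auto
    ultimately have "s \<in> A 1 \<union> A (- 1)" using u(1) by (auto simp: A_def crosses_def)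
    then show False using s by simp
  qed
  have cap: "\<phi> s t \<in> cap" for t
    using stays_above_saddle[OF \<phi>(1) _ above, of t] cap_backward[OF \<phi>(1), of s t] circle_cap \<phi>(2)
    by (cases "t \<ge> 0") auto
  have start: "(\<phi> s \<longlongrightarrow> 0) at_bot" by (rule emerges_from_top) (use \<phi> circle_cap in auto)
  have minus_cap: "- z \<in> cap" if "z \<in> cap" for z
    using that by (cases z) (auto simp: cap_def strip_def energy_minus[of "(_, _)", simplified])
  show thesis
  proof (cases "(\<phi> s \<longlongrightarrow> (a, 0)) at_top")
    case True
    show thesis by (rule that[of "\<phi> s"]) (use \<phi> cap start True circle_nz in auto)
  next
    case False
    then have "(\<phi> s \<longlongrightarrow> (- a, 0)) at_top"
      using ends_at_saddle[OF \<phi>(1) _ _ above] \<phi> circle_cap circle_nz by auto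
    from tendsto_minus[OF this] have fin: "((\<lambda>t. - \<phi> s t) \<longlongrightarrow> (a, 0)) at_top" by simp
    show thesis
      by (rule that[of "\<lambda>t. - \<phi> s t"])
         (use solution_minus[OF \<phi>(1)] \<phi>(2) minus_cap[OF cap] tendsto_minus[OF start] fin circle_nz in auto)
  qed
qed

lemma solution_fst_derivative:
  assumes "solution z"
  shows "((\<lambda>t. fst (z t)) has_real_derivative k (clamp (fst (z t))) * sin (snd (z t))) (at t)"
  using assms bounded_linear.has_vector_derivative[OF bounded_linear_fst, of z "field (z t)" "at t"]
  by (simp add: solution_def has_real_derivative_iff_has_vector_derivative field_def case_prod_beta)

lemma solution_snd_derivative:
  assumes "solution z"
  shows "((\<lambda>t. snd (z t)) has_real_derivative
    k (clamp (fst (z t))) * (sin (snd (z t)) / 2 + h (clamp (fst (z t))) * cos (snd (z t)))) (at t)"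
  using assms bounded_linear.has_vector_derivative[OF bounded_linear_snd, of z "field (z t)" "at t"]
  by (simp add: solution_def has_real_derivative_iff_has_vector_derivative field_def case_prod_beta)

text \<open>
  For \<open>0 < \<theta> < a\<close> the angle decreases wherever \<open>\<psi> = 0\<close>. So once \<open>\<psi> \<le> 0\<close>, this remains true, and
  \<open>\<theta>\<close> moves away from \<open>a\<close>.
\<close>

lemma arrives_from_inside:
  assumes z: "solution z" and strip: "\<And>t. z t \<in> strip" and lim: "(z \<longlongrightarrow> (a, 0)) at_top"
  obtains T where "\<And>t. T \<le> t \<Longrightarrow> 0 < fst (z t) \<and> 0 < snd (z t)"
proof -
  have lim1: "((\<lambda>t. fst (z t)) \<longlongrightarrow> a) at_top" using tendsto_fst[OF lim] by simp
  obtain T where T: "\<And>t. T \<le> t \<Longrightarrow> 0 < fst (z t)"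
    using order_tendstoD(1)[OF lim1 a_pos] by (auto simp: eventually_at_top_linorder)
  have bds: "\<bar>fst (z t)\<bar> < a" "\<bar>snd (z t)\<bar> < pi / 2" for t using strip[of t] by (auto simp: strip_def)
  have clamp: "clamp (fst (z t)) = fst (z t)" for t using bds[of t] by (simp add: clamp_id)
  have cos: "cos (snd (z t)) > 0" for t using bds[of t] by (intro cos_gt_zero_pi) auto
  have cont: "continuous_on S (\<lambda>t. snd (z t))" for S
    by (intro continuous_intros solution_continuous z)
  have "0 < snd (z s)" if s: "T \<le> s" for s
  proof (rule ccontr)
    assume neg: "\<not> 0 < snd (z s)"
    have stays: "snd (z t) \<le> 0" if t: "s \<le> t" for t
    proof (rule ccontr)
      assume "\<not> snd (z t) \<le> 0"
      then obtain u where u: "s \<le> u" "u < t" "snd (z u) = 0" "\<And>v. u < v \<Longrightarrow> v \<le> t \<Longrightarrow> 0 < snd (z v)"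
        using last_hit[OF cont t, of 0] neg by (metis not_le not_less)
      have "h (fst (z u)) < 0" using T[of u] u(1) s bds[of u] by (intro h_neg) auto
      moreover have "k (fst (z u)) > 0" using bds[of u] by (intro k_pos) simp
      ultimately have "k (clamp (fst (z u))) * (sin (snd (z u)) / 2 + h (clamp (fst (z u))) * cos (snd (z u))) < 0"
        using u(3) by (simp add: clamp mult_pos_neg)
      from DERIV_neg_dec_right[OF solution_snd_derivative[OF z] this]
      obtain d where d: "d > 0" "\<And>v. 0 < v \<Longrightarrow> v < d \<Longrightarrow> snd (z (u + v)) < snd (z u)" by blast
      define v where "v = min (d / 2) (t - u)"
      have "0 < v" "v < d" "u + v \<le> t" using d(1) u(2) by (auto simp: v_def)
      then show False using d(2)[of v] u(3) u(4)[of "u + v"] by simp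
    qed
    have "fst (z t) \<le> fst (z s)" if "s \<le> t" for t
    proof (rule DERIV_nonpos_imp_nonincreasing[OF that])
      fix u assume "s \<le> u" "u \<le> t"
      then have "snd (z u) \<le> 0" by (intro stays)
      moreover have "- snd (z u) \<le> pi" using bds[of u] pi_gt_zero by linarith
      ultimately have "sin (- snd (z u)) \<ge> 0" by (intro sin_ge_zero) auto
      then have "k (clamp (fst (z u))) * sin (snd (z u)) \<le> 0"
        using k_pos[OF clamp_bounds, of "fst (z u)"] by (simp add: mult_nonneg_nonpos)
      with solution_fst_derivative[OF z, of u]
      show "\<exists>y. ((\<lambda>t. fst (z t)) has_real_derivative y) (at u) \<and> y \<le> 0" by blast
    qed
    then have "a \<le> fst (z s)"
      by (intro tendsto_upperbound[OF lim1]) (auto simp: eventually_at_top_linorder)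
    then show False using bds[of s] by simp
  qed
  then show thesis using T that by blast
qed

text \<open>
  Dividing the two equations of motion, \<open>d\<psi>/d\<theta> = 1/2 + h * cot \<psi>\<close>.
\<close>

lemma orbit_as_graph:
  assumes z: "solution z" and strip: "\<And>t. z t \<in> strip" and lim: "(z \<longlongrightarrow> (a, 0)) at_top"
  obtains u0 g where "0 < u0" "u0 < a"
    and "\<And>u. u0 < u \<Longrightarrow> u < a \<Longrightarrow> fst (z (g u)) = u \<and> 0 < snd (z (g u)) \<and> snd (z (g u)) < pi / 2"
    and "\<And>u. u0 < u \<Longrightarrow> u < a \<Longrightarrow> ((\<lambda>u. snd (z (g u))) has_real_derivative
      1 / 2 + h u * (cos (snd (z (g u))) / sin (snd (z (g u))))) (at u)"
    and "((\<lambda>u. snd (z (g u))) \<longlongrightarrow> 0) (at_left a)"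
proof -
  obtain T where T: "\<And>t. T \<le> t \<Longrightarrow> 0 < fst (z t) \<and> 0 < snd (z t)"
    using arrives_from_inside[OF assms] by metis
  have bds: "\<bar>fst (z t)\<bar> < a" "\<bar>snd (z t)\<bar> < pi / 2" for t using strip[of t] by (auto simp: strip_def)
  have clamp: "clamp (fst (z t)) = fst (z t)" for t using bds[of t] by (simp add: clamp_id)
  have lim1: "((\<lambda>t. fst (z t)) \<longlongrightarrow> a) at_top" using tendsto_fst[OF lim] by simp
  have lim2: "((\<lambda>t. snd (z t)) \<longlongrightarrow> 0) at_top" using tendsto_snd[OF lim] by simp
  let ?d = "\<lambda>t. k (fst (z t)) * sin (snd (z t))"
  have der: "((\<lambda>t. fst (z t)) has_real_derivative ?d t) (at t)" for t
    using solution_fst_derivative[OF z, of t] by (simp add: clamp)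
  have k: "k (fst (z t)) > 0" for t using bds[of t] by (intro k_pos) simp
  have s: "sin (snd (z t)) > 0" if "T \<le> t" for t
    using T[OF that] bds[of t] by (intro sin_gt_zero) auto
  obtain g where g: "\<And>u. fst (z T) < u \<Longrightarrow> u < a \<Longrightarrow> T < g u \<and> fst (z (g u)) = u"
    and dg: "\<And>u. fst (z T) < u \<Longrightarrow> u < a \<Longrightarrow> (g has_real_derivative inverse (?d (g u))) (at u)"
    by (rule increasing_inverse[of T "\<lambda>t. fst (z t)" ?d a])
       (use der k s lim1 in auto)
  show thesis
  proof (rule that[of "fst (z T)" g])
    show "0 < fst (z T)" using T[of T] by simp
    show "fst (z T) < a" using bds[of T] by simp
    fix u assume u: "fst (z T) < u" "u < a"
    show "fst (z (g u)) = u \<and> 0 < snd (z (g u)) \<and> snd (z (g u)) < pi / 2"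
      using g[OF u] T[of "g u"] bds[of "g u"] by auto
    have "((\<lambda>t. snd (z t)) has_real_derivative k u * (sin (snd (z (g u))) / 2 + h u * cos (snd (z (g u))))) (at (g u))"
      using solution_snd_derivative[OF z, of "g u"] g[OF u] clamp[of "g u"] by simp
    from DERIV_chain2[OF this dg[OF u]]
    show "((\<lambda>u. snd (z (g u))) has_real_derivative
      1 / 2 + h u * (cos (snd (z (g u))) / sin (snd (z (g u))))) (at u)"
      by (rule DERIV_cong) (use g[OF u] s[of "g u"] k[of "g u"] in \<open>simp add: field_simps\<close>)
  next
    show "((\<lambda>u. snd (z (g u))) \<longlongrightarrow> 0) (at_left a)"
    proof (rule filterlim_compose[OF lim2], unfold filterlim_at_top, intro allI)
      fix Z
      define Z' where "Z' = max Z T"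
      have "\<forall>\<^sub>F u in at_left a. u \<in> {max (fst (z T)) (fst (z Z'))<..<a}"
        using bds[of T] bds[of Z'] by (intro eventually_at_left_real) auto
      then show "\<forall>\<^sub>F u in at_left a. Z \<le> g u"
      proof eventually_elim
        case (elim u)
        then have gu: "T < g u" "fst (z (g u)) = u" using g[of u] by auto
        show "Z \<le> g u"
        proof (rule ccontr)
          assume "\<not> Z \<le> g u"
          then have "g u < Z'" by (simp add: Z'_def)
          then have "fst (z (g u)) < fst (z Z')"
          proof (rule DERIV_pos_imp_increasing)
            fix x assume "g u \<le> x" "x \<le> Z'"
            then have "?d x > 0" using k[of x] s[of x] gu by simp
            with der[of x] show "\<exists>y. ((\<lambda>t. fst (z t)) has_real_derivative y) (at x) \<and> 0 < y" by blast
          qed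
          then show False using elim gu by simp
        qed
      qed
    qed
  qed
qed

text \<open>
  Two such orbits are graphs \<open>p\<close> and \<open>q\<close> over \<open>\<theta>\<close> near \<open>a\<close>, and \<open>(p - q)\<^sup>2\<close> has the derivative
  \<open>2 * h * (p - q) * (cot p - cot q) \<ge> 0\<close>, because \<open>h < 0\<close> and \<open>cot\<close> decreases. As it tends to \<open>0\<close> at
  \<open>a\<close>, it vanishes; the orbits meet and agree up to a shift of time.
\<close>

lemma connection_unique:
  assumes z: "solution z" "\<And>t. z t \<in> strip" "(z \<longlongrightarrow> (a, 0)) at_top"
    and z': "solution z'" "\<And>t. z' t \<in> strip" "(z' \<longlongrightarrow> (a, 0)) at_top"
  obtains s where "\<And>t. z t = z' (t + s)"
proof -
  obtain u1 g1 where 1: "0 < u1" "u1 < a"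
      "\<And>u. u1 < u \<Longrightarrow> u < a \<Longrightarrow> fst (z (g1 u)) = u \<and> 0 < snd (z (g1 u)) \<and> snd (z (g1 u)) < pi / 2"
      "\<And>u. u1 < u \<Longrightarrow> u < a \<Longrightarrow> ((\<lambda>u. snd (z (g1 u))) has_real_derivative
        1 / 2 + h u * (cos (snd (z (g1 u))) / sin (snd (z (g1 u))))) (at u)"
      "((\<lambda>u. snd (z (g1 u))) \<longlongrightarrow> 0) (at_left a)"
    by (rule orbit_as_graph[OF z]) blast
  obtain u2 g2 where 2: "0 < u2" "u2 < a"
      "\<And>u. u2 < u \<Longrightarrow> u < a \<Longrightarrow> fst (z' (g2 u)) = u \<and> 0 < snd (z' (g2 u)) \<and> snd (z' (g2 u)) < pi / 2"
      "\<And>u. u2 < u \<Longrightarrow> u < a \<Longrightarrow> ((\<lambda>u. snd (z' (g2 u))) has_real_derivative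
        1 / 2 + h u * (cos (snd (z' (g2 u))) / sin (snd (z' (g2 u))))) (at u)"
      "((\<lambda>u. snd (z' (g2 u))) \<longlongrightarrow> 0) (at_left a)"
    by (rule orbit_as_graph[OF z']) blast
  define p where "p u = snd (z (g1 u))" for u
  define q where "q u = snd (z' (g2 u))" for u
  define D where "D u = (p u - q u)\<^sup>2" for u
  obtain u where u: "max u1 u2 < u" "u < a" using dense[of "max u1 u2" a] 1 2 by auto
  have mono: "D u \<le> D w" if "u \<le> w" "w < a" for w
  proof (rule DERIV_nonneg_imp_nondecreasing[OF \<open>u \<le> w\<close>])
    fix x assume "u \<le> x" "x \<le> w"
    then have x: "u1 < x" "u2 < x" "x < a" using u that by auto
    define c where "c = cos (p x) / sin (p x) - cos (q x) / sin (q x)"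
    have dp: "(p has_real_derivative 1 / 2 + h x * (cos (p x) / sin (p x))) (at x)"
      using 1(4)[OF x(1,3)] unfolding p_def .
    have dq: "(q has_real_derivative 1 / 2 + h x * (cos (q x) / sin (q x))) (at x)"
      using 2(4)[OF x(2,3)] unfolding q_def .
    have "((\<lambda>x. p x - q x) has_real_derivative h x * c) (at x)"
      by (rule DERIV_cong[OF DERIV_diff[OF dp dq]]) (simp add: c_def algebra_simps)
    from DERIV_power[OF this, of 2]
    have "(D has_real_derivative 2 * (h x * ((p x - q x) * c))) (at x)"
      unfolding D_def by (simp add: algebra_simps)
    moreover have "(p x - q x) * c \<le> 0"
      unfolding c_def using 1(3)[OF x(1,3)] 2(3)[OF x(2,3)]
      by (intro cot_antimono) (auto simp: p_def q_def)
    moreover have "h x < 0" using x 1(1) by (intro h_neg) auto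
    ultimately show "\<exists>y. (D has_real_derivative y) (at x) \<and> 0 \<le> y"
      by (intro exI[of _ "2 * (h x * ((p x - q x) * c))"]) (simp add: mult_nonpos_nonpos)
  qed
  have "(D \<longlongrightarrow> (0 - 0)\<^sup>2) (at_left a)"
    unfolding D_def p_def q_def by (intro tendsto_intros 1(5) 2(5))
  then have "D u \<le> (0 - 0)\<^sup>2"
  proof (rule tendsto_lowerbound)
    show "\<forall>\<^sub>F w in at_left a. D u \<le> D w"
      using eventually_at_left_real[OF u(2)] by eventually_elim (use mono in auto)
  qed simp
  then have "p u = q u" by (simp add: D_def)
  then have eq: "z (g1 u) = z' (g2 u)" using 1(3)[of u] 2(3)[of u] u by (simp add: p_def q_def prod_eq_iff)
  have "z = (\<lambda>t. z' (t + (g2 u - g1 u)))"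
    by (rule solution_unique[OF z(1) solution_shift[OF z'(1)], of "g1 u"]) (simp add: eq)
  then show thesis using that by metis
qed

end

section \<open>The potential of the collision manifold\<close>

locale collision =
  fixes M B B1 \<mu> \<gamma> :: real
  assumes M_pos: "M > 0" and B_pos: "B > 0" and B1_pos: "B1 > 0" and \<mu>_gt: "\<mu> > 1"
    and \<gamma>_eq: "\<gamma> = 16 * B1 / B" and \<mu>\<gamma>: "\<mu> > 1 + 1 / \<gamma>"
begin

abbreviation (input) "\<theta>w \<equiv> theta_w \<mu> \<gamma>"
abbreviation (input) "Wf \<equiv> W M B B1 \<mu>"
abbreviation (input) "Uf \<equiv> U M B B1 \<mu>"

definition "A = (M / 2) powr (3/2)"
definition "D \<theta> = (cos \<theta>)\<^sup>2 + \<mu> * (sin \<theta>)\<^sup>2" for \<theta> :: real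
definition "W' \<theta> = 3 * A * sin \<theta> * cos \<theta> * (B / cos \<theta> ^ 5 - 16 * B1 * (\<mu> - 1) / D \<theta> powr (5/2))" for \<theta>
definition "speed \<theta> = sqrt (2 * cos \<theta> ^ 3)" for \<theta> :: real

lemma A_pos: "A > 0" using M_pos by (simp add: A_def)

lemma \<gamma>_pos: "\<gamma> > 0" using B_pos B1_pos by (simp add: \<gamma>_eq)

lemma B1_eq: "16 * B1 = \<gamma> * B" using B_pos by (simp add: \<gamma>_eq)

lemma D_eq: "D \<theta> = \<mu> - (\<mu> - 1) * (cos \<theta>)\<^sup>2"
  by (simp add: D_def sin_squared_eq algebra_simps)

lemma D_pos: "D \<theta> > 0"
proof -
  have "(\<mu> - 1) * (cos \<theta>)\<^sup>2 \<le> (\<mu> - 1) * 1"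
    using \<mu>_gt by (intro mult_left_mono) (auto simp: abs_square_le_1)
  then show ?thesis by (simp add: D_eq)
qed

lemma W_eq: "Wf \<theta> = A * (B / cos \<theta> ^ 3 + 16 * B1 / D \<theta> powr (3/2))"
  by (simp add: W_def A_def D_def)

lemma W_pos: "cos \<theta> > 0 \<Longrightarrow> Wf \<theta> > 0"
  unfolding W_eq using A_pos B_pos B1_pos D_pos[of \<theta>]
  by (intro mult_pos_pos add_pos_pos divide_pos_pos) auto

lemma W_even: "Wf (- \<theta>) = Wf \<theta>"
  by (simp add: W_def)

lemma W'_odd: "W' (- \<theta>) = - W' \<theta>"
  by (simp add: W'_def D_def)

lemma D_deriv: "(D has_real_derivative 2 * (\<mu> - 1) * sin \<theta> * cos \<theta>) (at \<theta>)"
  unfolding D_def by (auto intro!: derivative_eq_intros simp: algebra_simps)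

lemma D_powr_deriv:
  "((\<lambda>\<theta>. D \<theta> powr p) has_real_derivative p * D \<theta> powr (p - 1) * (2 * (\<mu> - 1) * sin \<theta> * cos \<theta>)) (at \<theta>)"
  by (rule DERIV_chain2[OF has_real_derivative_powr[OF D_pos] D_deriv])

lemma W_deriv:
  assumes "cos \<theta> > 0" shows "(Wf has_real_derivative W' \<theta>) (at \<theta>)"
proof -
  have 1: "((\<lambda>\<theta>. B / cos \<theta> ^ 3) has_real_derivative 3 * B * sin \<theta> / cos \<theta> ^ 4) (at \<theta>)"
    using assms by (auto intro!: derivative_eq_intros simp: power2_eq_square field_simps eval_nat_numeral)
  have "D \<theta> powr (- (3/2) - 1) = 1 / D \<theta> powr (5/2)"
    using powr_minus_divide[of "D \<theta>" "5/2"] by simp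
  then have eq: "- (3/2) * D \<theta> powr (- (3/2) - 1) * (2 * (\<mu> - 1) * sin \<theta> * cos \<theta>) =
      - (3 * (\<mu> - 1) * sin \<theta> * cos \<theta>) / D \<theta> powr (5/2)"
    using D_pos[of \<theta>] by (simp add: field_simps)
  have 2: "((\<lambda>\<theta>. D \<theta> powr (- (3/2))) has_real_derivative - (3 * (\<mu> - 1) * sin \<theta> * cos \<theta>) / D \<theta> powr (5/2)) (at \<theta>)"
    by (rule DERIV_cong[OF D_powr_deriv eq])
  have "((\<lambda>\<theta>. A * (B / cos \<theta> ^ 3 + 16 * B1 * D \<theta> powr (- (3/2)))) has_real_derivative
      A * (3 * B * sin \<theta> / cos \<theta> ^ 4 + 16 * B1 * (- (3 * (\<mu> - 1) * sin \<theta> * cos \<theta>) / D \<theta> powr (5/2)))) (at \<theta>)"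
    by (intro DERIV_cmult DERIV_add 1 2)
  also have "(\<lambda>\<theta>. A * (B / cos \<theta> ^ 3 + 16 * B1 * D \<theta> powr (- (3/2)))) = Wf"
    by (simp add: W_eq fun_eq_iff powr_minus_divide)
  also have "A * (3 * B * sin \<theta> / cos \<theta> ^ 4 + 16 * B1 * (- (3 * (\<mu> - 1) * sin \<theta> * cos \<theta>) / D \<theta> powr (5/2))) = W' \<theta>"
    using assms D_pos[of \<theta>] by (simp add: W'_def field_simps eval_nat_numeral)
  finally show ?thesis .
qed

lemma \<theta>w: "0 < \<theta>w" "\<theta>w < pi / 2"
  using theta_w(1)[OF \<mu>_gt \<gamma>_pos \<mu>\<gamma>] by auto

text \<open>
  Chosen such that \<open>cos\<^sup>2 \<theta>\<^sub>w = \<mu> / N\<close>.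
\<close>

definition "N = (\<mu> - 1) + ((\<mu> - 1) * \<gamma>) powr (2/5)"

lemma N_pos: "N > 0" unfolding N_def using \<mu>_gt by (intro add_pos_nonneg) auto

lemma cos_\<theta>w_sq: "(cos \<theta>w)\<^sup>2 = \<mu> / N"
proof -
  have "\<mu> / N \<ge> 0" using N_pos \<mu>_gt by simp
  then show ?thesis
    using theta_w(2)[OF \<mu>_gt \<gamma>_pos \<mu>\<gamma>] \<mu>_gt \<gamma>_pos by (simp add: N_def powr_mult)
qed

text \<open>
  With \<open>g = (\<mu> - 1) * \<gamma>\<close>, \<open>W'\<close> has the sign of \<open>D powr (5/2) - g * cos ^ 5\<close>, hence that of
  \<open>D - g powr (2/5) * cos\<^sup>2 = N * (cos\<^sup>2 \<theta>\<^sub>w - cos\<^sup>2 \<theta>)\<close>.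
\<close>

lemma W'_sgn:
  assumes "0 < \<theta>" "\<theta> < pi / 2"
  shows "sgn (W' \<theta>) = sgn (\<theta> - \<theta>w)"
proof -
  have c: "cos \<theta> > 0" and s: "sin \<theta> > 0" using assms by (auto intro!: cos_gt_zero sin_gt_zero)
  define g where "g = (\<mu> - 1) * \<gamma>"
  have g: "g > 0" using \<mu>_gt \<gamma>_pos by (simp add: g_def)
  define X where "X = D \<theta> powr (5/2)"
  have X: "X > 0" using D_pos[of \<theta>] by (simp add: X_def)
  have "(g powr (2/5) * (cos \<theta>)\<^sup>2) powr (5/2) = (g powr (2/5)) powr (5/2) * ((cos \<theta>)\<^sup>2) powr (5/2)"
    using g c by (simp add: powr_mult)
  also have "((cos \<theta>)\<^sup>2) powr (5/2) = cos \<theta> powr 5"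
    using c by (simp add: powr_powr flip: powr_numeral)
  also have "\<dots> = cos \<theta> ^ 5" using c by (simp add: powr_numeral)
  finally have Y: "(g powr (2/5) * (cos \<theta>)\<^sup>2) powr (5/2) = g * cos \<theta> ^ 5"
    using g by (simp add: powr_powr)
  have "sgn (X - g * cos \<theta> ^ 5) = sgn (D \<theta> - g powr (2/5) * (cos \<theta>)\<^sup>2)"
    unfolding X_def Y[symmetric] using D_pos[of \<theta>] g c by (intro sgn_powr_diff) auto
  also have "D \<theta> - g powr (2/5) * (cos \<theta>)\<^sup>2 = N * ((cos \<theta>w)\<^sup>2 - (cos \<theta>)\<^sup>2)"
    using N_pos by (simp add: cos_\<theta>w_sq right_diff_distrib) (simp add: D_eq N_def g_def algebra_simps)
  also have "sgn \<dots> = sgn ((cos \<theta>w)\<^sup>2 - (cos \<theta>)\<^sup>2)" using N_pos by (simp add: sgn_mult)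
  also have "\<dots> = sgn (\<theta> - \<theta>w)"
  proof -
    have cw: "cos \<theta>w > 0" using \<theta>w by (intro cos_gt_zero) auto
    show ?thesis
    proof (cases \<theta> \<theta>w rule: linorder_cases)
      case less
      then have "cos \<theta>w < cos \<theta>" using assms \<theta>w by (intro cos_monotone_0_pi) auto
      then have "(cos \<theta>w)\<^sup>2 < (cos \<theta>)\<^sup>2" using cw by (intro power_strict_mono) auto
      then show ?thesis using less by simp
    next
      case greater
      then have "cos \<theta> < cos \<theta>w" using assms \<theta>w by (intro cos_monotone_0_pi) auto
      then have "(cos \<theta>)\<^sup>2 < (cos \<theta>w)\<^sup>2" using c by (intro power_strict_mono) auto
      then show ?thesis using greater by simp
    qed auto
  qed
  finally have "sgn (X - g * cos \<theta> ^ 5) = sgn (\<theta> - \<theta>w)" .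
  moreover have "W' \<theta> = (3 * A * sin \<theta> * cos \<theta> * B / (cos \<theta> ^ 5 * X)) * (X - g * cos \<theta> ^ 5)"
    using X c by (simp add: W'_def B1_eq g_def flip: X_def) (simp add: field_simps)
  moreover have "3 * A * sin \<theta> * cos \<theta> * B / (cos \<theta> ^ 5 * X) > 0"
    using X c s A_pos B_pos by simp
  ultimately show ?thesis by (simp only: sgn_mult sgn_pos mult_1)
qed

lemma cos_pos: "\<bar>\<theta>\<bar> < pi / 2 \<Longrightarrow> cos \<theta> > 0"
  by (intro cos_gt_zero_pi) auto

lemma cos_pos_w: "\<bar>\<theta>\<bar> \<le> \<theta>w \<Longrightarrow> cos \<theta> > 0"
  using \<theta>w by (intro cos_pos) simp

lemma speed_deriv:
  assumes "cos \<theta> > 0"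
  shows "(speed has_real_derivative - (3/2) * (sin \<theta> / cos \<theta>) * speed \<theta>) (at \<theta>)"
proof -
  have s: "speed \<theta> > 0" "speed \<theta> * speed \<theta> = 2 * cos \<theta> ^ 3" using assms by (simp_all add: speed_def)
  have "(speed has_real_derivative (2 * (3 * (cos \<theta>)\<^sup>2 * - sin \<theta>)) * (inverse (speed \<theta>) / 2)) (at \<theta>)"
    unfolding speed_def using assms
    by (auto intro!: derivative_eq_intros simp: field_simps)
  moreover have "(2 * (3 * (cos \<theta>)\<^sup>2 * - sin \<theta>)) * (inverse (speed \<theta>) / 2) = - (3/2) * (sin \<theta> / cos \<theta>) * speed \<theta>"
    using s assms by (simp add: field_simps) (simp add: power2_eq_square power3_eq_cube)
  ultimately show ?thesis by simp
qed

lemma speed_lipschitz: "\<exists>L. L-lipschitz_on {-\<theta>w..\<theta>w} speed"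
proof (rule lipschitz_on_interval_C1)
  show "(speed has_real_derivative - (3/2) * (sin \<theta> / cos \<theta>) * speed \<theta>) (at \<theta>)" if "\<theta> \<in> {-\<theta>w..\<theta>w}" for \<theta>
    using that by (intro speed_deriv cos_pos_w) (auto simp: abs_le_iff)
  have "cos \<theta> \<noteq> 0" if "\<theta> \<in> {-\<theta>w..\<theta>w}" for \<theta> using cos_pos_w[of \<theta>] that by (auto simp: abs_le_iff)
  then show "continuous_on {-\<theta>w..\<theta>w} (\<lambda>\<theta>. - (3/2) * (sin \<theta> / cos \<theta>) * speed \<theta>)"
    unfolding speed_def by (intro continuous_intros) auto
qed

lemma D_continuous: "continuous_on S D"
  unfolding D_def by (intro continuous_intros)

lemma W'_continuous: "continuous_on {-\<theta>w..\<theta>w} W'"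
proof -
  have "cos \<theta> \<noteq> 0" if "\<theta> \<in> {-\<theta>w..\<theta>w}" for \<theta> using cos_pos_w[of \<theta>] that by (auto simp: abs_le_iff)
  then show ?thesis unfolding W'_def
    using D_pos by (intro continuous_intros D_continuous) (auto simp: less_imp_neq[symmetric])
qed

lemma W'_deriv:
  assumes "cos \<theta> > 0"
  shows "(W' has_real_derivative 3 * A * ((cos \<theta>)\<^sup>2 - (sin \<theta>)\<^sup>2) * (B / cos \<theta> ^ 5 - 16 * B1 * (\<mu> - 1) * D \<theta> powr (- (5/2)))
      + 3 * A * sin \<theta> * cos \<theta> * (5 * B * sin \<theta> / cos \<theta> ^ 6
        + 16 * B1 * (\<mu> - 1) * (5 * (\<mu> - 1) * sin \<theta> * cos \<theta> * D \<theta> powr (- (7/2))))) (at \<theta>)"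
proof -
  have 1: "((\<lambda>\<theta>. B / cos \<theta> ^ 5) has_real_derivative 5 * B * sin \<theta> / cos \<theta> ^ 6) (at \<theta>)"
    using assms by (auto intro!: derivative_eq_intros simp: field_simps eval_nat_numeral)
  have 2: "((\<lambda>\<theta>. D \<theta> powr (- (5/2))) has_real_derivative - (5 * (\<mu> - 1) * sin \<theta> * cos \<theta> * D \<theta> powr (- (7/2)))) (at \<theta>)"
    by (rule DERIV_cong[OF D_powr_deriv]) simp
  have 3: "((\<lambda>\<theta>. 3 * A * sin \<theta> * cos \<theta>) has_real_derivative 3 * A * ((cos \<theta>)\<^sup>2 - (sin \<theta>)\<^sup>2)) (at \<theta>)"
    by (auto intro!: derivative_eq_intros simp: power2_eq_square algebra_simps)
  have eq: "W' = (\<lambda>\<theta>. (3 * A * sin \<theta> * cos \<theta>) * (B / cos \<theta> ^ 5 - 16 * B1 * (\<mu> - 1) * D \<theta> powr (- (5/2))))"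
    by (simp add: W'_def fun_eq_iff powr_minus_divide)
  show ?thesis unfolding eq
    by (rule DERIV_cong[OF DERIV_mult[OF 3 DERIV_diff[OF 1 DERIV_cmult[OF 2]]]]) (simp add: algebra_simps)
qed

lemma slope_lipschitz: "\<exists>L. L-lipschitz_on {-\<theta>w..\<theta>w} (\<lambda>\<theta>. W' \<theta> / (2 * Wf \<theta>))"
proof -
  define W'' where "W'' \<theta> = 3 * A * ((cos \<theta>)\<^sup>2 - (sin \<theta>)\<^sup>2) * (B / cos \<theta> ^ 5 - 16 * B1 * (\<mu> - 1) * D \<theta> powr (- (5/2)))
      + 3 * A * sin \<theta> * cos \<theta> * (5 * B * sin \<theta> / cos \<theta> ^ 6
        + 16 * B1 * (\<mu> - 1) * (5 * (\<mu> - 1) * sin \<theta> * cos \<theta> * D \<theta> powr (- (7/2))))" for \<theta>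
  have c: "cos \<theta> > 0" if "\<theta> \<in> {-\<theta>w..\<theta>w}" for \<theta> using cos_pos_w[of \<theta>] that by (auto simp: abs_le_iff)
  have nz: "cos \<theta> \<noteq> 0" "Wf \<theta> \<noteq> 0" if "\<theta> \<in> {-\<theta>w..\<theta>w}" for \<theta> using c[OF that] W_pos[of \<theta>] by auto
  have "D \<theta> \<noteq> 0" for \<theta> using D_pos[of \<theta>] by simp
  then have c'': "continuous_on {-\<theta>w..\<theta>w} W''"
    unfolding W''_def using nz by (intro continuous_intros D_continuous) auto
  have cW: "continuous_on {-\<theta>w..\<theta>w} Wf"
    by (intro continuous_at_imp_continuous_on ballI DERIV_isCont[OF W_deriv] c)
  show ?thesis
  proof (rule lipschitz_on_interval_C1)
    show "((\<lambda>\<theta>. W' \<theta> / (2 * Wf \<theta>)) has_real_derivative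
        (W'' \<theta> * (2 * Wf \<theta>) - W' \<theta> * (2 * W' \<theta>)) / (2 * Wf \<theta> * (2 * Wf \<theta>))) (at \<theta>)"
      if "\<theta> \<in> {-\<theta>w..\<theta>w}" for \<theta>
      using DERIV_divide[OF W'_deriv[OF c[OF that], folded W''_def] DERIV_cmult[OF W_deriv[OF c[OF that]], of 2]]
        nz(2)[OF that] by simp
    show "continuous_on {-\<theta>w..\<theta>w} (\<lambda>\<theta>. (W'' \<theta> * (2 * Wf \<theta>) - W' \<theta> * (2 * W' \<theta>)) / (2 * Wf \<theta> * (2 * Wf \<theta>)))"
      using nz by (intro continuous_intros c'' cW W'_continuous) auto
  qed
qed

lemma W'_0: "W' (theta_w \<mu> \<gamma>) = 0"
  using W'_sgn[OF \<theta>w] by (simp add: sgn_zero_iff)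

end

section \<open>From the collision manifold to the plane\<close>

sublocale collision \<subseteq> hill: symmetric_hill "theta_w \<mu> \<gamma>" "W M B B1 \<mu>" W' speed
proof
  show "0 < \<theta>w" by (rule \<theta>w)
  show "(Wf has_real_derivative W' x) (at x)" if "\<bar>x\<bar> \<le> \<theta>w" for x
    using that by (intro W_deriv cos_pos_w)
  show "0 < Wf x" if "\<bar>x\<bar> \<le> \<theta>w" for x using that by (intro W_pos cos_pos_w)
  show "Wf (- x) = Wf x" for x by (rule W_even)
  show "W' (- x) = - W' x" for x by (rule W'_odd)
  show "W' x < 0" if "0 < x" "x < \<theta>w" for x
    using W'_sgn[of x] that \<theta>w(2) by (auto simp: sgn_if split: if_splits)
  show "W' \<theta>w = 0" by (rule W'_0)
  show "0 < speed x" if "\<bar>x\<bar> \<le> \<theta>w" for x using cos_pos_w[OF that] by (simp add: speed_def)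
  show "speed (- x) = speed x" for x by (simp add: speed_def)
  show "\<exists>L. L-lipschitz_on {- \<theta>w..\<theta>w} speed" by (rule speed_lipschitz)
  show "\<exists>L. L-lipschitz_on {- \<theta>w..\<theta>w} (\<lambda>x. W' x / (2 * Wf x))" by (rule slope_lipschitz)
qed

context collision begin

lemma W'_pos: "\<theta>w < x \<Longrightarrow> x < pi / 2 \<Longrightarrow> W' x > 0"
  using W'_sgn[of x] \<theta>w(1) by (auto simp: sgn_if split: if_splits)

lemma U_eq: "cos \<theta> > 0 \<Longrightarrow> Uf \<theta> = Wf \<theta> * cos \<theta> ^ 3"
  by (rule U_eq_W_cos) simp

lemma deriv_U:
  assumes "cos \<theta> > 0"
  shows "deriv Uf \<theta> = W' \<theta> * cos \<theta> ^ 3 - 3 * Wf \<theta> * (cos \<theta>)\<^sup>2 * sin \<theta>"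
proof (rule DERIV_imp_deriv)
  have "((\<lambda>\<theta>. Wf \<theta> * cos \<theta> ^ 3) has_real_derivative
      W' \<theta> * cos \<theta> ^ 3 - 3 * Wf \<theta> * (cos \<theta>)\<^sup>2 * sin \<theta>) (at \<theta>)"
    by (auto intro!: derivative_eq_intros W_deriv[OF assms])
  moreover have "open {\<theta> :: real. 0 < cos \<theta>}" by (intro open_Collect_less continuous_intros)
  ultimately show "(Uf has_real_derivative W' \<theta> * cos \<theta> ^ 3 - 3 * Wf \<theta> * (cos \<theta>)\<^sup>2 * sin \<theta>) (at \<theta>)"
    by (rule has_field_derivative_transform_within_open) (use assms U_eq in auto)
qed

lemma manifold_eq:
  assumes "(v, \<theta>, w) \<in> collision_manifold M B B1 \<mu>" "cos \<theta> > 0"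
  shows "w\<^sup>2 * Wf \<theta> = cos \<theta> ^ 3 * (2 * Wf \<theta> - v\<^sup>2)"
proof -
  have W: "Wf \<theta> > 0" using assms(2) by (rule W_pos)
  have "cos \<theta> ^ 6 / Uf \<theta> = cos \<theta> ^ 3 / Wf \<theta>"
    using U_eq[OF assms(2)] W assms(2) by (simp add: field_simps flip: power_add)
  moreover have "w\<^sup>2 + cos \<theta> ^ 6 / Uf \<theta> * v\<^sup>2 = 2 * cos \<theta> ^ 3"
    using assms(1) by (simp add: collision_manifold_def)
  ultimately have "w\<^sup>2 + cos \<theta> ^ 3 / Wf \<theta> * v\<^sup>2 = 2 * cos \<theta> ^ 3" by (simp only:)
  then show ?thesis using W by (simp add: field_simps)
qed

lemma in_manifoldI:
  assumes "cos \<theta> > 0" "\<bar>\<theta>\<bar> \<le> pi / 2" "w\<^sup>2 * Wf \<theta> = cos \<theta> ^ 3 * (2 * Wf \<theta> - v\<^sup>2)"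
  shows "(v, \<theta>, w) \<in> collision_manifold M B B1 \<mu>"
proof -
  have W: "Wf \<theta> > 0" using assms(1) by (rule W_pos)
  have "cos \<theta> ^ 6 / Uf \<theta> = cos \<theta> ^ 3 / Wf \<theta>"
    using U_eq[OF assms(1)] W assms(1) by (simp add: field_simps flip: power_add)
  moreover have "w\<^sup>2 + cos \<theta> ^ 3 / Wf \<theta> * v\<^sup>2 = 2 * cos \<theta> ^ 3"
    using assms(3) W by (simp add: field_simps)
  ultimately have "w\<^sup>2 + cos \<theta> ^ 6 / Uf \<theta> * v\<^sup>2 = 2 * cos \<theta> ^ 3" by (simp only:)
  then show ?thesis using assms(2) by (auto simp: collision_manifold_def abs_le_iff)
qed

lemma v_le:
  assumes "(v, \<theta>, w) \<in> collision_manifold M B B1 \<mu>" "cos \<theta> > 0"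
  shows "v\<^sup>2 \<le> 2 * Wf \<theta>"
proof -
  have "0 \<le> w\<^sup>2 * Wf \<theta>" using W_pos[OF assms(2)] by simp
  then have "0 \<le> cos \<theta> ^ 3 * (2 * Wf \<theta> - v\<^sup>2)" using manifold_eq[OF assms] by simp
  then show ?thesis using assms(2) by (simp add: zero_le_mult_iff)
qed

text \<open>
  The energy relation eliminates \<open>v\<^sup>2\<close>. The first component then shows that \<open>v\<close> does not increase, and
  the last one that \<open>w' = W' / W * cos\<^sup>3\<close> where \<open>w = 0\<close>.
\<close>

lemma field_on_manifold:
  assumes m: "(v, \<theta>, w) \<in> collision_manifold M B B1 \<mu>" and c: "cos \<theta> > 0"
  shows "collision_field M B B1 \<mu> (v, \<theta>, w) =
    (- sqrt (Uf \<theta>) * w\<^sup>2 / (2 * cos \<theta> ^ 3), w,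
     cos \<theta> ^ 3 * v * w / (2 * sqrt (Uf \<theta>)) + W' \<theta> / Wf \<theta> * (cos \<theta> ^ 3 - w\<^sup>2 / 2)
       - 3/2 * (sin \<theta> / cos \<theta>) * w\<^sup>2)"
proof -
  have W: "Wf \<theta> > 0" using c by (rule W_pos)
  have U: "Uf \<theta> > 0" using W c by (simp add: U_eq)
  define S where "S = sqrt (Uf \<theta>)"
  have S: "S > 0" "S * S = Uf \<theta>" using U by (simp_all add: S_def)
  have v2: "cos \<theta> ^ 3 * v\<^sup>2 = Wf \<theta> * (2 * cos \<theta> ^ 3 - w\<^sup>2)"
    using manifold_eq[OF m c] by (simp add: algebra_simps)
  have "cos \<theta> ^ 3 / (2 * S) * v\<^sup>2 - S = (cos \<theta> ^ 3 * v\<^sup>2 - 2 * (S * S)) / (2 * S)"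
    using S by (simp add: field_simps)
  also have "\<dots> = - Wf \<theta> * w\<^sup>2 / (2 * S)"
    unfolding v2 S(2) U_eq[OF c] by (simp add: algebra_simps)
  also have "\<dots> = - (S * S) * w\<^sup>2 / (2 * S * cos \<theta> ^ 3)"
    unfolding S(2) U_eq[OF c] using c S by (simp add: field_simps)
  also have "\<dots> = - S * w\<^sup>2 / (2 * cos \<theta> ^ 3)" using S(1) by simp
  finally have 1: "cos \<theta> ^ 3 / (2 * S) * v\<^sup>2 - S = - S * w\<^sup>2 / (2 * cos \<theta> ^ 3)" .
  have q: "deriv Uf \<theta> / Uf \<theta> = W' \<theta> / Wf \<theta> - 3 * (sin \<theta> / cos \<theta>)"
    unfolding deriv_U[OF c] U_eq[OF c] using W c by (simp add: field_simps eval_nat_numeral)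
  have e1: "3 * sin \<theta> * cos \<theta> ^ 5 / Uf \<theta> * v\<^sup>2 = 3 * (sin \<theta> / cos \<theta>) * (2 * cos \<theta> ^ 3 - w\<^sup>2)"
  proof -
    have "3 * sin \<theta> * cos \<theta> ^ 5 / Uf \<theta> * v\<^sup>2 = 3 * (sin \<theta> / cos \<theta>) * (cos \<theta> ^ 3 * v\<^sup>2) / Wf \<theta>"
      unfolding U_eq[OF c] using W c by (simp add: field_simps eval_nat_numeral)
    then show ?thesis unfolding v2 using W by simp
  qed
  have e2: "3 * sin \<theta> * (cos \<theta>)\<^sup>2 = 3 * (sin \<theta> / cos \<theta>) * cos \<theta> ^ 3"
    using c by (simp add: field_simps eval_nat_numeral)
  have ring: "b + (q - 3 * \<tau>) * (c - u / 2) - 3 * \<tau> * c + 3 * \<tau> * (2 * c - u) = b + q * (c - u / 2) - 3/2 * \<tau> * u"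
    for b q \<tau> c u :: real by (simp add: algebra_simps)
  have 2: "cos \<theta> ^ 3 / (2 * S) * v * w + deriv Uf \<theta> / Uf \<theta> * (cos \<theta> ^ 3 - w\<^sup>2 / 2)
        - 3 * sin \<theta> * (cos \<theta>)\<^sup>2 + 3 * sin \<theta> * cos \<theta> ^ 5 / Uf \<theta> * v\<^sup>2
      = cos \<theta> ^ 3 * v * w / (2 * S) + W' \<theta> / Wf \<theta> * (cos \<theta> ^ 3 - w\<^sup>2 / 2)
       - 3/2 * (sin \<theta> / cos \<theta>) * w\<^sup>2"
    unfolding q e1 e2 ring by simp
  show ?thesis unfolding collision_field_def Let_def prod.case S_def[symmetric] 1 2 ..
qed

text \<open>
  The interior \<open>cos \<theta> > 0\<close> of \<open>\<Delta>\<close> is a cylinder over \<open>\<theta>\<close> with the angle \<open>\<psi>\<close>. By using \<open>arcsin\<close>, the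
  inverse \<open>to_planar\<close> picks the half \<open>\<bar>\<psi>\<bar> \<le> \<pi>/2\<close> of it, where \<open>v \<ge> 0\<close>; this half contains the cap.
\<close>

definition from_planar :: "real \<times> real \<Rightarrow> real \<times> real \<times> real" where
  "from_planar = (\<lambda>(\<theta>, \<psi>). (sqrt (2 * Wf \<theta>) * cos \<psi>, \<theta>, speed \<theta> * sin \<psi>))"

definition to_planar :: "real \<times> real \<times> real \<Rightarrow> real \<times> real" where
  "to_planar = (\<lambda>(v, \<theta>, w). (\<theta>, arcsin (w / speed \<theta>)))"

lemma speed_sq: "cos \<theta> > 0 \<Longrightarrow> speed \<theta> > 0 \<and> speed \<theta> * speed \<theta> = 2 * cos \<theta> ^ 3"
  by (simp add: speed_def)

lemma from_planar_manifold:
  assumes "\<bar>\<theta>\<bar> < pi / 2"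
  shows "from_planar (\<theta>, \<psi>) \<in> collision_manifold M B B1 \<mu>"
proof -
  have c: "cos \<theta> > 0" using assms by (rule cos_pos)
  have W: "Wf \<theta> > 0" using c by (rule W_pos)
  have "(speed \<theta> * sin \<psi>)\<^sup>2 * Wf \<theta> = (speed \<theta> * speed \<theta>) * (sin \<psi>)\<^sup>2 * Wf \<theta>"
    by (simp add: power2_eq_square)
  also have "\<dots> = cos \<theta> ^ 3 * (2 * Wf \<theta> - 2 * Wf \<theta> * (cos \<psi>)\<^sup>2)"
    using speed_sq[OF c] by (simp add: sin_squared_eq algebra_simps)
  also have "2 * Wf \<theta> * (cos \<psi>)\<^sup>2 = (sqrt (2 * Wf \<theta>) * cos \<psi>)\<^sup>2"
    using W by (simp add: power_mult_distrib)
  finally show ?thesis unfolding from_planar_def prod.case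
    using c assms by (intro in_manifoldI) auto
qed

lemma to_planar_point:
  assumes m: "(v, \<theta>, w) \<in> collision_manifold M B B1 \<mu>" and c: "cos \<theta> > 0" and v: "v > 0"
  shows "\<bar>w / speed \<theta>\<bar> < 1" "speed \<theta> * sin (arcsin (w / speed \<theta>)) = w"
    "sqrt (2 * Wf \<theta>) * cos (arcsin (w / speed \<theta>)) = v" "\<bar>arcsin (w / speed \<theta>)\<bar> < pi / 2"
proof -
  have W: "Wf \<theta> > 0" using c by (rule W_pos)
  note s = speed_sq[OF c]
  define p where "p = w / speed \<theta>"
  have "p * speed \<theta> = w" using s by (simp add: p_def)
  moreover have "(p * speed \<theta>)\<^sup>2 = p\<^sup>2 * (2 * cos \<theta> ^ 3)"
    using s by (simp add: power_mult_distrib power2_eq_square[of "speed \<theta>"])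
  ultimately have "p\<^sup>2 * (2 * cos \<theta> ^ 3) = w\<^sup>2" by simp
  then have "p\<^sup>2 * (2 * Wf \<theta>) * cos \<theta> ^ 3 = (2 * Wf \<theta> - v\<^sup>2) * cos \<theta> ^ 3"
    using manifold_eq[OF m c] by (metis (no_types, lifting) mult.assoc mult.commute)
  then have p2: "p\<^sup>2 * (2 * Wf \<theta>) = 2 * Wf \<theta> - v\<^sup>2" using c by simp
  then have "p\<^sup>2 * (2 * Wf \<theta>) < 1 * (2 * Wf \<theta>)" using v by simp
  then have "p\<^sup>2 < 1" using W by simp
  then have p1: "\<bar>p\<bar> < 1" by (simp add: abs_square_less_1)
  show "\<bar>w / speed \<theta>\<bar> < 1" using p1 by (simp add: p_def)
  have sin: "sin (arcsin p) = p" using p1 by (intro sin_arcsin) auto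
  then show "speed \<theta> * sin (arcsin (w / speed \<theta>)) = w" using s by (simp add: p_def)
  have "cos (arcsin p) = sqrt (1 - p\<^sup>2)" using p1 by (intro cos_arcsin) auto
  then have "sqrt (2 * Wf \<theta>) * cos (arcsin p) = sqrt (2 * Wf \<theta> * (1 - p\<^sup>2))"
    by (simp add: real_sqrt_mult)
  also have "2 * Wf \<theta> * (1 - p\<^sup>2) = v\<^sup>2" using p2 by (simp add: algebra_simps)
  finally show "sqrt (2 * Wf \<theta>) * cos (arcsin (w / speed \<theta>)) = v" using v by (simp add: p_def)
  have "- (pi / 2) < arcsin p \<and> arcsin p < pi / 2"
    using arcsin_less_mono[of "-1" p] arcsin_less_mono[of p 1] p1 by auto
  then show "\<bar>arcsin (w / speed \<theta>)\<bar> < pi / 2" by (auto simp: p_def)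
qed

lemma from_to_planar:
  assumes "X \<in> collision_manifold M B B1 \<mu>" "cos (fst (snd X)) > 0" "fst X > 0"
  shows "from_planar (to_planar X) = X"
  using to_planar_point[of "fst X" "fst (snd X)" "snd (snd X)"] assms
  by (simp add: from_planar_def to_planar_def case_prod_beta)

lemma sqrt_relations:
  assumes "cos \<theta> > 0"
  shows "sqrt (2 * Wf \<theta>) * speed \<theta> = 2 * sqrt (Uf \<theta>)"
    "sqrt (2 * Wf \<theta>) * cos \<theta> ^ 3 = speed \<theta> * sqrt (Uf \<theta>)"
proof -
  have W: "Wf \<theta> > 0" using assms by (rule W_pos)
  show "sqrt (2 * Wf \<theta>) * speed \<theta> = 2 * sqrt (Uf \<theta>)"
    unfolding speed_def U_eq[OF assms] by (simp add: real_sqrt_mult)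
  have "cos \<theta> ^ 3 = sqrt (cos \<theta> ^ 3) * sqrt (cos \<theta> ^ 3)" using assms by simp
  then show "sqrt (2 * Wf \<theta>) * cos \<theta> ^ 3 = speed \<theta> * sqrt (Uf \<theta>)"
    unfolding speed_def U_eq[OF assms] real_sqrt_mult by (metis mult.assoc mult.left_commute)
qed

lemma field_from_planar:
  assumes t: "\<bar>\<theta>\<bar> < pi / 2"
  shows "collision_field M B B1 \<mu> (from_planar (\<theta>, \<psi>)) =
    (- (speed \<theta> * sqrt (2 * Wf \<theta>) / 2 * (sin \<psi>)\<^sup>2), speed \<theta> * sin \<psi>,
     - (3/2) * (sin \<theta> / cos \<theta>) * speed \<theta> * (speed \<theta> * sin \<psi>) * sin \<psi> +
      speed \<theta> * cos \<psi> * (speed \<theta> * (sin \<psi> / 2 + W' \<theta> / (2 * Wf \<theta>) * cos \<psi>)))"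
proof -
  have c: "cos \<theta> > 0" using t by (rule cos_pos)
  have W: "Wf \<theta> > 0" using c by (rule W_pos)
  have U: "Uf \<theta> > 0" using W c by (simp add: U_eq)
  define S where "S = sqrt (Uf \<theta>)"
  define R where "R = sqrt (2 * Wf \<theta>)"
  have S: "S > 0" using U by (simp add: S_def)
  note s = speed_sq[OF c]
  have rel: "R * speed \<theta> = 2 * S" "R * cos \<theta> ^ 3 = speed \<theta> * S"
    using sqrt_relations[OF c] by (simp_all add: R_def S_def)
  have c3: "cos \<theta> ^ 3 = speed \<theta> * speed \<theta> / 2" using s by simp
  have 1: "- S * (speed \<theta> * sin \<psi>)\<^sup>2 / (2 * cos \<theta> ^ 3) = - (speed \<theta> * R / 2 * (sin \<psi>)\<^sup>2)"
  proof -
    have "- S * (speed \<theta> * sin \<psi>)\<^sup>2 / (2 * cos \<theta> ^ 3) = - (S * (sin \<psi>)\<^sup>2)"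
      unfolding c3 using conjunct1[OF s] by (simp add: power_mult_distrib power2_eq_square)
    moreover have "S = speed \<theta> * R / 2" using rel(1) by (simp add: mult.commute)
    then have "S * (sin \<psi>)\<^sup>2 = speed \<theta> * R / 2 * (sin \<psi>)\<^sup>2" by simp
    ultimately show ?thesis by simp
  qed
  have 2: "cos \<theta> ^ 3 * (R * cos \<psi>) * (speed \<theta> * sin \<psi>) / (2 * S) = speed \<theta> * speed \<theta> * cos \<psi> * sin \<psi> / 2"
  proof -
    have "cos \<theta> ^ 3 * (R * cos \<psi>) * (speed \<theta> * sin \<psi>) = (R * cos \<theta> ^ 3) * speed \<theta> * cos \<psi> * sin \<psi>"
      by (simp add: mult.assoc mult.commute mult.left_commute)
    also have "\<dots> = (speed \<theta> * speed \<theta> * cos \<psi> * sin \<psi>) * S"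
      unfolding rel(2) by (simp add: mult.assoc mult.commute mult.left_commute)
    finally have n: "cos \<theta> ^ 3 * (R * cos \<psi>) * (speed \<theta> * sin \<psi>) =
      (speed \<theta> * speed \<theta> * cos \<psi> * sin \<psi>) * S" .
    show ?thesis unfolding n using S by simp
  qed
  have 3: "W' \<theta> / Wf \<theta> * (cos \<theta> ^ 3 - (speed \<theta> * sin \<psi>)\<^sup>2 / 2)
      = W' \<theta> / (2 * Wf \<theta>) * (speed \<theta> * speed \<theta>) * (cos \<psi>)\<^sup>2"
    unfolding c3 power_mult_distrib cos_squared_eq by (simp add: power2_eq_square algebra_simps diff_divide_distrib)
  have "from_planar (\<theta>, \<psi>) = (R * cos \<psi>, \<theta>, speed \<theta> * sin \<psi>)" by (simp add: from_planar_def R_def)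
  then have "collision_field M B B1 \<mu> (from_planar (\<theta>, \<psi>)) =
    (- S * (speed \<theta> * sin \<psi>)\<^sup>2 / (2 * cos \<theta> ^ 3), speed \<theta> * sin \<psi>,
     cos \<theta> ^ 3 * (R * cos \<psi>) * (speed \<theta> * sin \<psi>) / (2 * S)
     + W' \<theta> / Wf \<theta> * (cos \<theta> ^ 3 - (speed \<theta> * sin \<psi>)\<^sup>2 / 2)
       - 3/2 * (sin \<theta> / cos \<theta>) * (speed \<theta> * sin \<psi>)\<^sup>2)"
    using field_on_manifold[of "R * cos \<psi>" \<theta> "speed \<theta> * sin \<psi>"] from_planar_manifold[OF t, of \<psi>] c
    by (simp add: S_def)
  also have "\<dots> = (- (speed \<theta> * R / 2 * (sin \<psi>)\<^sup>2), speed \<theta> * sin \<psi>,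
     - (3/2) * (sin \<theta> / cos \<theta>) * speed \<theta> * (speed \<theta> * sin \<psi>) * sin \<psi> +
      speed \<theta> * cos \<psi> * (speed \<theta> * (sin \<psi> / 2 + W' \<theta> / (2 * Wf \<theta>) * cos \<psi>)))"
    unfolding 1 2 3 by (simp add: power2_eq_square algebra_simps)
  finally show ?thesis by (simp add: R_def)
qed

lemma trajectory_from_planar:
  assumes z: "hill.solution z" and strip: "\<And>t. z t \<in> hill.strip"
  shows "trajectory M B B1 \<mu> (\<lambda>t. from_planar (z t))"
  unfolding trajectory_def
proof (intro allI conjI)
  fix t
  obtain \<theta> \<psi> where zt: "z t = (\<theta>, \<psi>)" by fastforce
  have \<theta>: "\<bar>\<theta>\<bar> < \<theta>w" "\<bar>\<theta>\<bar> < pi / 2" using strip[of t] \<theta>w zt by (auto simp: hill.strip_def)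
  have c: "cos \<theta> > 0" using \<theta>(2) by (rule cos_pos)
  show "from_planar (z t) \<in> collision_manifold M B B1 \<mu>"
    unfolding zt using \<theta>(2) by (rule from_planar_manifold)
  have clamp: "hill.clamp (fst (z u)) = fst (z u)" for u
    using strip[of u] by (intro hill.clamp_id) (auto simp: hill.strip_def)
  have d\<theta>: "((\<lambda>t. fst (z t)) has_real_derivative speed \<theta> * sin \<psi>) (at t)"
    using hill.solution_fst_derivative[OF z, of t] clamp[of t] by (simp add: zt)
  have d\<psi>: "((\<lambda>t. snd (z t)) has_real_derivative speed \<theta> * (sin \<psi> / 2 + W' \<theta> / (2 * Wf \<theta>) * cos \<psi>)) (at t)"
    using hill.solution_snd_derivative[OF z, of t] clamp[of t] by (simp add: zt hill.h_def)
  have dv: "((\<lambda>t. sqrt (2 * Wf (fst (z t))) * cos (snd (z t))) has_real_derivative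
      - (speed \<theta> * sqrt (2 * Wf \<theta>) / 2 * (sin \<psi>)\<^sup>2)) (at t)"
    using hill.solution_energy_derivative[OF z, of t] clamp clamp[of t, unfolded zt fst_conv]
    by (simp add: hill.energy_def hill.loss_def case_prod_beta zt)
  have "((\<lambda>t. speed (fst (z t))) has_real_derivative
      - (3/2) * (sin \<theta> / cos \<theta>) * speed \<theta> * (speed \<theta> * sin \<psi>)) (at t)"
    by (rule DERIV_chain2[OF _ d\<theta>]) (use speed_deriv[OF c] zt in simp)
  from DERIV_mult[OF this DERIV_chain2[OF DERIV_sin d\<psi>]]
  have dw: "((\<lambda>t. speed (fst (z t)) * sin (snd (z t))) has_real_derivative
     - (3/2) * (sin \<theta> / cos \<theta>) * speed \<theta> * (speed \<theta> * sin \<psi>) * sin \<psi> +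
      speed \<theta> * cos \<psi> * (speed \<theta> * (sin \<psi> / 2 + W' \<theta> / (2 * Wf \<theta>) * cos \<psi>))) (at t)"
    by (rule DERIV_cong) (simp add: zt)
  show "((\<lambda>t. from_planar (z t)) has_vector_derivative collision_field M B B1 \<mu> (from_planar (z t))) (at t)"
    unfolding zt field_from_planar[OF \<theta>(2)]
    using d\<theta> dv dw unfolding from_planar_def case_prod_beta has_real_derivative_iff_has_vector_derivative
    by (intro has_vector_derivative_Pair) auto
qed

text \<open>
  The coordinates of a trajectory as real functions, in which the facts about its motion are stated.
\<close>

context
  fixes x v \<theta> w
  assumes x: "trajectory M B B1 \<mu> x"
    and v_def: "v = (\<lambda>t. fst (x t))" and \<theta>_def: "\<theta> = (\<lambda>t. fst (snd (x t)))"
    and w_def: "w = (\<lambda>t. snd (snd (x t)))"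
begin

lemma x_eq: "x t = (v t, \<theta> t, w t)"
  by (simp add: v_def \<theta>_def w_def)

lemma on_manifold: "(v t, \<theta> t, w t) \<in> collision_manifold M B B1 \<mu>"
  using x by (simp add: trajectory_def flip: x_eq)

lemma \<theta>_bounds: "\<bar>\<theta> t\<bar> \<le> pi / 2"
  using on_manifold[of t] by (auto simp: collision_manifold_def abs_le_iff)

lemma \<theta>_bounds_strict: "cos (\<theta> t) > 0 \<Longrightarrow> \<bar>\<theta> t\<bar> < pi / 2"
proof -
  assume "cos (\<theta> t) > 0"
  then have "cos \<bar>\<theta> t\<bar> \<noteq> 0" by (simp add: abs_if)
  then have "\<bar>\<theta> t\<bar> \<noteq> pi / 2" using cos_pi_half by metis
  then show "\<bar>\<theta> t\<bar> < pi / 2" using \<theta>_bounds[of t] by simp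
qed

lemma x_derivs:
  shows "(v has_real_derivative fst (collision_field M B B1 \<mu> (x t))) (at t)"
    and "(\<theta> has_real_derivative w t) (at t)"
    and "(w has_real_derivative snd (snd (collision_field M B B1 \<mu> (x t)))) (at t)"
proof -
  have d: "(x has_vector_derivative collision_field M B B1 \<mu> (x t)) (at t)"
    using x by (simp add: trajectory_def)
  note d1 = bounded_linear.has_vector_derivative[OF bounded_linear_fst d]
  note d2 = bounded_linear.has_vector_derivative[OF bounded_linear_snd d]
  note d3 = bounded_linear.has_vector_derivative[OF bounded_linear_fst d2]
  note d4 = bounded_linear.has_vector_derivative[OF bounded_linear_snd d2]
  show "(v has_real_derivative fst (collision_field M B B1 \<mu> (x t))) (at t)"
    using d1 by (simp add: v_def has_real_derivative_iff_has_vector_derivative)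
  have "fst (snd (collision_field M B B1 \<mu> (x t))) = w t"
    by (simp add: x_eq collision_field_def Let_def)
  then show "(\<theta> has_real_derivative w t) (at t)"
    using d3 by (simp add: \<theta>_def has_real_derivative_iff_has_vector_derivative)
  show "(w has_real_derivative snd (snd (collision_field M B B1 \<mu> (x t)))) (at t)"
    using d4 by (simp add: w_def has_real_derivative_iff_has_vector_derivative)
qed

lemma v_deriv: "cos (\<theta> t) > 0 \<Longrightarrow>
    (v has_real_derivative - sqrt (Uf (\<theta> t)) * (w t)\<^sup>2 / (2 * cos (\<theta> t) ^ 3)) (at t)"
  using x_derivs(1)[of t] field_on_manifold[OF on_manifold, of t] by (simp add: x_eq)

lemma w_deriv: "cos (\<theta> t) > 0 \<Longrightarrow>
    (w has_real_derivative cos (\<theta> t) ^ 3 * v t * w t / (2 * sqrt (Uf (\<theta> t)))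
      + W' (\<theta> t) / Wf (\<theta> t) * (cos (\<theta> t) ^ 3 - (w t)\<^sup>2 / 2)
      - 3/2 * (sin (\<theta> t) / cos (\<theta> t)) * (w t)\<^sup>2) (at t)"
  using x_derivs(3)[of t] field_on_manifold[OF on_manifold, of t] by (simp add: x_eq)

lemma to_planar_derivative:
  assumes t: "\<bar>\<theta> t\<bar> \<le> \<theta>w" and v: "v t > 0"
  shows "((\<lambda>t. to_planar (x t)) has_vector_derivative hill.field (to_planar (x t))) (at t)"
proof -
  have c: "cos (\<theta> t) > 0" using t by (rule cos_pos_w)
  have t2: "\<bar>\<theta> t\<bar> < pi / 2" using t \<theta>w by simp
  note p = to_planar_point[OF on_manifold c v]
  define \<psi> where "\<psi> = arcsin (w t / speed (\<theta> t))"
  have X: "from_planar (\<theta> t, \<psi>) = x t"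
    using p by (simp add: from_planar_def \<psi>_def x_eq)
  have w: "w t = speed (\<theta> t) * sin \<psi>" using p by (simp add: \<psi>_def)
  have cos: "cos \<psi> > 0" using p(4) by (intro cos_gt_zero_pi) (auto simp: \<psi>_def)
  have s: "speed (\<theta> t) > 0" using speed_sq[OF c] by simp
  define \<psi>' where "\<psi>' = speed (\<theta> t) * (sin \<psi> / 2 + W' (\<theta> t) / (2 * Wf (\<theta> t)) * cos \<psi>)"
  have dw: "(w has_real_derivative - (3/2) * (sin (\<theta> t) / cos (\<theta> t)) * speed (\<theta> t) * w t * sin \<psi>
      + speed (\<theta> t) * cos \<psi> * \<psi>') (at t)"
    using x_derivs(3)[of t] field_from_planar[OF t2, of \<psi>] unfolding X \<psi>'_def w[symmetric] by simp
  have ds: "((\<lambda>t. speed (\<theta> t)) has_real_derivative - (3/2) * (sin (\<theta> t) / cos (\<theta> t)) * speed (\<theta> t) * w t) (at t)"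
    by (rule DERIV_chain2[OF speed_deriv[OF c] x_derivs(2)])
  have "((\<lambda>t. w t / speed (\<theta> t)) has_real_derivative cos \<psi> * \<psi>') (at t)"
    by (rule DERIV_cong[OF DERIV_divide[OF dw ds]])
       (use s in \<open>simp_all add: w field_simps\<close>)
  moreover have "sqrt (1 - (w t / speed (\<theta> t))\<^sup>2) = cos \<psi>"
    unfolding \<psi>_def by (rule cos_arcsin[symmetric]) (use p(1) in linarith)+
  then have "(arcsin has_real_derivative inverse (cos \<psi>)) (at (w t / speed (\<theta> t)))"
    using DERIV_arcsin[of "w t / speed (\<theta> t)"] p(1)[unfolded abs_less_iff] by simp
  ultimately have "((\<lambda>t. arcsin (w t / speed (\<theta> t))) has_real_derivative inverse (cos \<psi>) * (cos \<psi> * \<psi>')) (at t)"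
    by (rule DERIV_chain2[rotated])
  then have d\<psi>: "((\<lambda>t. arcsin (w t / speed (\<theta> t))) has_real_derivative \<psi>') (at t)"
    by (rule DERIV_cong) (use cos in simp)
  have "hill.field (\<theta> t, \<psi>) = (w t, \<psi>')"
    using t by (simp add: hill.field_def hill.clamp_id hill.h_def \<psi>'_def w)
  then show ?thesis
    using x_derivs(2)[of t] d\<psi> unfolding to_planar_def x_eq prod.case \<psi>_def[symmetric]
      has_real_derivative_iff_has_vector_derivative
    by (simp add: has_vector_derivative_Pair)
qed

end

section \<open>Orbits that leave the cap\<close>

lemma W_continuous: "cos \<theta> > 0 \<Longrightarrow> isCont Wf \<theta>"
  by (rule DERIV_isCont[OF W_deriv])

lemma saddle_level_sq: "hill.saddle_level\<^sup>2 = 2 * Wf \<theta>w"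
  using W_pos[OF cos_pos_w, of \<theta>w] \<theta>w by (simp add: hill.saddle_level_def)

context
  fixes x v \<theta> w
  assumes x: "trajectory M B B1 \<mu> x"
    and v_def: "v = (\<lambda>t. fst (x t))" and \<theta>_def: "\<theta> = (\<lambda>t. fst (snd (x t)))"
    and w_def: "w = (\<lambda>t. snd (snd (x t)))"
begin

lemmas vdefs = x v_def \<theta>_def w_def

lemma w_sq_le: "(w t)\<^sup>2 \<le> 2 * cos (\<theta> t) ^ 3"
proof -
  have b: "\<theta> t \<in> {-(pi/2)..pi/2}" using \<theta>_bounds[OF vdefs, of t] by (auto simp: abs_le_iff)
  have "(w t)\<^sup>2 + cos (\<theta> t) ^ 6 / Uf (\<theta> t) * (v t)\<^sup>2 = 2 * cos (\<theta> t) ^ 3"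
    using on_manifold[OF vdefs, of t] by (simp add: collision_manifold_def)
  moreover have "cos (\<theta> t) ^ 6 / Uf (\<theta> t) * (v t)\<^sup>2 \<ge> 0"
    using U_pos[OF M_pos B_pos B1_pos b, of \<mu>] by simp
  ultimately show ?thesis by linarith
qed

lemma continuous_coordinates:
  "continuous_on S v" "continuous_on S \<theta>" "continuous_on S w"
  by (intro continuous_at_imp_continuous_on ballI DERIV_isCont[OF x_derivs(1)[OF vdefs]]
      DERIV_isCont[OF x_derivs(2)[OF vdefs]] DERIV_isCont[OF x_derivs(3)[OF vdefs]])+

lemma v_antimono:
  assumes c: "\<And>t. cos (\<theta> t) > 0" and "s \<le> t"
  shows "v t \<le> v s"
proof (rule DERIV_nonpos_imp_nonincreasing[OF \<open>s \<le> t\<close>])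
  fix u
  have "Uf (\<theta> u) > 0" using W_pos[OF c[of u]] c[of u] by (simp add: U_eq)
  then have "- sqrt (Uf (\<theta> u)) * (w u)\<^sup>2 / (2 * cos (\<theta> u) ^ 3) \<le> 0" using c[of u] by simp
  with v_deriv[OF vdefs c[of u]] show "\<exists>y. (v has_real_derivative y) (at u) \<and> y \<le> 0" by blast
qed

text \<open>
  Since \<open>w\<^sup>2 \<le> 2 * cos\<^sup>3 \<theta> \<le> (2 * cos \<theta>)\<^sup>2\<close>, the value \<open>cos \<theta>\<close> decays at most like \<open>exp (- 2 * t)\<close> and
  cannot reach \<open>0\<close>.
\<close>

lemma interior_forward:
  assumes c: "cos (\<theta> s) > 0" and "s \<le> t"
  shows "cos (\<theta> t) > 0"
proof -
  have "cos (\<theta> s) * exp (2 * s) \<le> cos (\<theta> t) * exp (2 * t)"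
  proof (rule DERIV_nonneg_imp_nondecreasing[OF \<open>s \<le> t\<close>])
    fix u
    have cu: "cos (\<theta> u) \<ge> 0" using \<theta>_bounds[OF vdefs, of u] by (intro cos_ge_zero) (auto simp: abs_le_iff)
    have "(w u)\<^sup>2 \<le> 2 * cos (\<theta> u) ^ 3" by (rule w_sq_le)
    also have "\<dots> \<le> (2 * cos (\<theta> u))\<^sup>2"
    proof -
      have "cos (\<theta> u) * (cos (\<theta> u))\<^sup>2 \<le> 2 * (cos (\<theta> u))\<^sup>2"
        by (intro mult_right_mono) (auto intro: order_trans[OF cos_le_one])
      then show ?thesis by (simp add: power2_eq_square power3_eq_cube)
    qed
    finally have "\<bar>w u\<bar>\<^sup>2 \<le> (2 * cos (\<theta> u))\<^sup>2" by simp
    then have w: "\<bar>w u\<bar> \<le> 2 * cos (\<theta> u)" by (rule power2_le_imp_le) (use cu in simp)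
    have "\<bar>sin (\<theta> u) * w u\<bar> \<le> 1 * \<bar>w u\<bar>" unfolding abs_mult by (intro mult_right_mono) auto
    then have "sin (\<theta> u) * w u \<le> 2 * cos (\<theta> u)" using w by linarith
    then have "(2 * cos (\<theta> u) - sin (\<theta> u) * w u) * exp (2 * u) \<ge> 0" by simp
    moreover have "((\<lambda>u. cos (\<theta> u) * exp (2 * u)) has_real_derivative
        (2 * cos (\<theta> u) - sin (\<theta> u) * w u) * exp (2 * u)) (at u)"
      by (auto intro!: derivative_eq_intros x_derivs(2)[OF vdefs] simp: algebra_simps)
    ultimately show "\<exists>y. ((\<lambda>u. cos (\<theta> u) * exp (2 * u)) has_real_derivative y) (at u) \<and> 0 \<le> y" by blast
  qed
  moreover have "cos (\<theta> s) * exp (2 * s) > 0" using c by simp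
  ultimately have "cos (\<theta> t) * exp (2 * t) > 0" by linarith
  then show ?thesis by (simp add: zero_less_mult_iff)
qed

text \<open>
  For \<open>w > 0\<close> this says \<open>- dv/d\<theta> \<le> sqrt (2 * W 0) / 2\<close>; it comes from \<open>w \<le> sqrt (2 * cos\<^sup>3 \<theta>)\<close> and
  \<open>W \<theta> \<le> W 0\<close>.
\<close>

lemma v_descent_bound:
  assumes t: "\<bar>\<theta> t\<bar> \<le> \<theta>w" and w: "w t \<ge> 0"
  shows "sqrt (Uf (\<theta> t)) * (w t)\<^sup>2 / (2 * cos (\<theta> t) ^ 3) \<le> sqrt (2 * Wf 0) / 2 * w t"
proof -
  have c: "cos (\<theta> t) > 0" using t by (rule cos_pos_w)
  note s = speed_sq[OF c]
  have "w t \<le> speed (\<theta> t)"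
    unfolding speed_def by (rule real_le_rsqrt) (rule w_sq_le)
  then have "sqrt (Uf (\<theta> t)) * w t \<le> sqrt (Uf (\<theta> t)) * speed (\<theta> t)"
    using W_pos[OF c] c by (intro mult_left_mono) (simp_all add: U_eq)
  also have "\<dots> = sqrt (2 * Wf (\<theta> t)) * cos (\<theta> t) ^ 3"
    using sqrt_relations(2)[OF c] by (simp add: mult.commute)
  also have "\<dots> \<le> sqrt (2 * Wf 0) * cos (\<theta> t) ^ 3"
    using hill.P_le_0[OF t] c by (intro mult_right_mono) auto
  finally have "sqrt (Uf (\<theta> t)) * w t * w t \<le> sqrt (2 * Wf 0) * cos (\<theta> t) ^ 3 * w t"
    using w by (rule mult_right_mono)
  then show ?thesis using c by (simp add: field_simps power2_eq_square)
qed

text \<open>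
  While \<open>\<theta> \<le> \<theta>\<^sub>w\<close>, \<open>steep\<close> and the bound on the descent keep \<open>v\<close> above minus the saddle level, and
  there \<open>w = 0\<close> would mean \<open>v\<^sup>2 = 2 * W \<theta>\<close>, which is too large. If \<open>w\<close> vanished for the first time at some
  \<open>\<theta> > \<theta>\<^sub>w\<close>, then \<open>w' > 0\<close> at that time, a contradiction. So \<open>\<theta>\<close> increases to a limit. A limit below
  \<open>\<pi>/2\<close> would be a rest point with \<open>\<bar>v\<bar>\<close> equal to \<open>sqrt (2 * W)\<close>; the two arguments just given, applied in
  the limit, exclude it.
\<close>

lemma right_exit:
  assumes c: "\<And>t. cos (\<theta> t) > 0"
    and v1: "v t1 = hill.saddle_level" and w1: "w t1 > 0" and \<theta>1: "\<bar>\<theta> t1\<bar> < \<theta>w"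
    and steep: "\<theta>w * sqrt (2 * Wf 0) \<le> 2 * hill.saddle_level"
  shows "ends_in_B_plus x"
proof -
  define s where "s = hill.saddle_level"
  have s: "s > 0" "s\<^sup>2 = 2 * Wf \<theta>w" using hill.saddle_level_pos saddle_level_sq by (simp_all add: s_def)
  define G where "G = sqrt (2 * Wf 0) / 2"
  have G: "G > 0" "G * (2 * \<theta>w) \<le> 2 * s"
    using hill.P_pos[of 0] \<theta>w steep by (auto simp: G_def s_def algebra_simps)
  note dv = v_deriv[OF vdefs c] and d\<theta> = x_derivs(2)[OF vdefs] and dw = w_deriv[OF vdefs c]
  have W: "Wf (\<theta> t) > 0" and U: "Uf (\<theta> t) > 0" for t using W_pos[OF c[of t]] c[of t] by (simp_all add: U_eq)
  have man: "(w t)\<^sup>2 * Wf (\<theta> t) = cos (\<theta> t) ^ 3 * (2 * Wf (\<theta> t) - (v t)\<^sup>2)" for t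
    by (rule manifold_eq[OF on_manifold[OF vdefs] c])
  \<comment> \<open>\<open>v\<close> decreases strictly at \<open>t1\<close>, where \<open>w \<noteq> 0\<close>\<close>
  have v_less: "v t < s" if "t1 < t" for t
  proof -
    have "- sqrt (Uf (\<theta> t1)) * (w t1)\<^sup>2 / (2 * cos (\<theta> t1) ^ 3) < 0"
      using U[of t1] c[of t1] w1 by simp
    from DERIV_neg_dec_right[OF dv this] obtain d
      where d: "d > 0" "\<And>h. 0 < h \<Longrightarrow> h < d \<Longrightarrow> v (t1 + h) < v t1" by blast
    define h where "h = min (d / 2) (t - t1)"
    have h: "0 < h" "h < d" "t1 + h \<le> t" using d(1) that by (auto simp: h_def)
    have "v t \<le> v (t1 + h)" by (rule v_antimono[OF c h(3)])
    then show ?thesis using d(2)[OF h(1,2)] v1 by (simp add: s_def)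
  qed
  have \<theta>_mono: "\<theta> p \<le> \<theta> q" if "p \<le> q" "\<And>u. p \<le> u \<Longrightarrow> u \<le> q \<Longrightarrow> w u \<ge> 0" for p q
    by (rule DERIV_nonneg_imp_nondecreasing[OF that(1)]) (use d\<theta> that(2) in blast)
  have descent: "v t \<ge> s - G * (\<theta> t - \<theta> t1)"
    if t: "t1 \<le> t" "\<theta> t \<le> \<theta>w" and pos: "\<And>u. t1 \<le> u \<Longrightarrow> u \<le> t \<Longrightarrow> w u \<ge> 0" for t
  proof -
    have "v t1 + G * \<theta> t1 \<le> v t + G * \<theta> t"
    proof (rule DERIV_nonneg_imp_nondecreasing[OF t(1)])
      fix u assume u: "t1 \<le> u" "u \<le> t"
      have "\<theta> t1 \<le> \<theta> u" "\<theta> u \<le> \<theta> t" using u pos by (auto intro!: \<theta>_mono)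
      then have "\<bar>\<theta> u\<bar> \<le> \<theta>w" using t(2) \<theta>1 by linarith
      then have "- sqrt (Uf (\<theta> u)) * (w u)\<^sup>2 / (2 * cos (\<theta> u) ^ 3) + G * w u \<ge> 0"
        using v_descent_bound[OF _ pos[OF u]] by (simp add: G_def)
      moreover have "((\<lambda>t. v t + G * \<theta> t) has_real_derivative
          - sqrt (Uf (\<theta> u)) * (w u)\<^sup>2 / (2 * cos (\<theta> u) ^ 3) + G * w u) (at u)"
        by (intro DERIV_add dv DERIV_cmult d\<theta>)
      ultimately show "\<exists>y. ((\<lambda>t. v t + G * \<theta> t) has_real_derivative y) (at u) \<and> 0 \<le> y" by blast
    qed
    then show ?thesis using v1 by (simp add: s_def algebra_simps)
  qed
  \<comment> \<open>\<open>\<theta>\<close> travels by less than \<open>2 * \<theta>w\<close> before it reaches \<open>\<theta>w\<close>\<close>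
  have above: "- s < s - G * (y - \<theta> t1)" if "y \<le> \<theta>w" for y
  proof -
    have "y - \<theta> t1 < 2 * \<theta>w" using that \<theta>1 by linarith
    then have "G * (y - \<theta> t1) < G * (2 * \<theta>w)" using G(1) by simp
    then show ?thesis using G(2) by linarith
  qed
  have low: "\<not> 2 * Wf y \<le> u\<^sup>2" if "\<bar>y\<bar> \<le> \<theta>w" "- s < u" "u < s" for y u
  proof -
    have "\<bar>u\<bar> < \<bar>s\<bar>" using that s(1) by auto
    then have "u\<^sup>2 < s\<^sup>2" by (simp add: power2_strict_mono)
    then show ?thesis using hill.P_ge_a[OF that(1)] s(2) by simp
  qed
  have w_pos: "w t > 0" if t: "t1 \<le> t" for t
  proof (rule ccontr)
    assume "\<not> w t > 0"
    then obtain t2 where t2: "t1 < t2" "w t2 = 0" "\<And>u. t1 \<le> u \<Longrightarrow> u < t2 \<Longrightarrow> 0 < w u"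
      using first_hit[OF continuous_coordinates(3) t, of 0] w1 by (metis not_less)
    have nonneg: "w u \<ge> 0" if "t1 \<le> u" "u \<le> t2" for u
      using t2(2) t2(3)[of u] that by (cases "u = t2") auto
    have v2: "(v t2)\<^sup>2 = 2 * Wf (\<theta> t2)" using man[of t2] t2(2) c[of t2] by simp
    have \<theta>2: "\<theta> t1 \<le> \<theta> t2" using t2(1) nonneg by (intro \<theta>_mono) auto
    show False
    proof (cases "\<theta> t2 \<le> \<theta>w")
      case True
      have "- s < v t2" using descent[of t2] above[OF True] True t2(1) nonneg by fastforce
      moreover have "\<bar>\<theta> t2\<bar> \<le> \<theta>w" using \<theta>2 \<theta>1 True by linarith
      ultimately show False using low[of "\<theta> t2" "v t2"] v_less[OF t2(1)] v2 by simp
    next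
      case False
      then have "W' (\<theta> t2) > 0" using \<theta>_bounds_strict[OF vdefs c[of t2]] by (intro W'_pos) auto
      then have "W' (\<theta> t2) / Wf (\<theta> t2) * cos (\<theta> t2) ^ 3 > 0" using W[of t2] c[of t2] by simp
      moreover have "(w has_real_derivative W' (\<theta> t2) / Wf (\<theta> t2) * cos (\<theta> t2) ^ 3) (at t2)"
        using dw[of t2] t2(2) by simp
      ultimately obtain d where d: "d > 0" "\<And>h. 0 < h \<Longrightarrow> h < d \<Longrightarrow> w (t2 - h) < w t2"
        using DERIV_pos_inc_left by blast
      define h where "h = min (d / 2) (t2 - t1)"
      have "0 < h" "h < d" "t1 \<le> t2 - h" using d(1) t2(1) by (auto simp: h_def)
      then show False using d(2)[of h] t2(2) t2(3)[of "t2 - h"] by simp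
    qed
  qed
  then have w_nonneg: "w t \<ge> 0" if "t1 \<le> t" for t using that by (simp add: less_imp_le)
  have \<theta>_le: "\<theta> t \<le> pi / 2" for t using \<theta>_bounds[OF vdefs, of t] by linarith
  obtain l where l: "(\<theta> \<longlongrightarrow> l) at_top" "\<And>t. t1 \<le> t \<Longrightarrow> \<theta> t \<le> l" "l \<le> pi / 2"
    by (rule mono_bounded_converges[of t1 \<theta> "pi / 2"])
       (use \<theta>_mono w_nonneg \<theta>_le in auto)
  have l_eq: "l = pi / 2"
  proof (rule ccontr)
    assume "l \<noteq> pi / 2"
    then have l2: "l < pi / 2" using l(3) by simp
    have "\<theta> t1 \<le> l" using l(2) by simp
    then have l3: "- \<theta>w < l" "\<bar>l\<bar> < pi / 2" using \<theta>1 l2 \<theta>w by linarith+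
    have cl: "cos l > 0" using l3(2) by (rule cos_pos)
    have W_lim: "((\<lambda>t. Wf (\<theta> t)) \<longlongrightarrow> Wf l) at_top"
      by (rule isCont_tendsto_compose[OF W_continuous[OF cl] l(1)])
    have cos_lim: "((\<lambda>t. cos (\<theta> t) ^ 3) \<longlongrightarrow> cos l ^ 3) at_top" by (intro tendsto_intros l(1))
    have range: "cos y > 0" if "y \<in> {\<theta> t1..l}" for y
      using that l3 \<theta>1 \<theta>w by (intro cos_pos) (auto simp: abs_less_iff)
    have "continuous_on {\<theta> t1..l} Wf"
      by (intro continuous_at_imp_continuous_on ballI W_continuous range)
    then have "\<exists>y0\<in>{\<theta> t1..l}. \<forall>y\<in>{\<theta> t1..l}. Wf y \<le> Wf y0"
      using \<open>\<theta> t1 \<le> l\<close> by (intro continuous_attains_sup) auto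
    then obtain C where C: "\<And>y. y \<in> {\<theta> t1..l} \<Longrightarrow> Wf y \<le> C" by blast
    have v_low: "- v t \<le> sqrt (2 * C)" if "t1 \<le> t" for t
    proof (rule real_le_rsqrt)
      have "(v t)\<^sup>2 \<le> 2 * Wf (\<theta> t)" by (rule v_le[OF on_manifold[OF vdefs] c])
      moreover have "\<theta> t1 \<le> \<theta> t" using that w_nonneg by (intro \<theta>_mono) auto
      ultimately show "(- v t)\<^sup>2 \<le> 2 * C" using C[of "\<theta> t"] l(2)[OF that] by auto
    qed
    obtain m where m: "((\<lambda>t. - v t) \<longlongrightarrow> m) at_top" "\<And>t. t1 \<le> t \<Longrightarrow> - v t \<le> m"
      by (rule mono_bounded_converges[of t1 "\<lambda>t. - v t" "sqrt (2 * C)"])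
         (use v_low v_antimono[OF c] in auto)
    have v_lim: "(v \<longlongrightarrow> - m) at_top" using tendsto_minus[OF m(1)] by simp
    have "((\<lambda>t. sqrt (cos (\<theta> t) ^ 3 * (2 * Wf (\<theta> t) - (v t)\<^sup>2) / Wf (\<theta> t))) \<longlongrightarrow>
        sqrt (cos l ^ 3 * (2 * Wf l - (- m)\<^sup>2) / Wf l)) at_top"
      using W_pos[OF cl] by (intro tendsto_intros cos_lim W_lim v_lim) auto
    then have w_lim: "(w \<longlongrightarrow> sqrt (cos l ^ 3 * (2 * Wf l - (- m)\<^sup>2) / Wf l)) at_top"
    proof (rule Lim_transform_eventually)
      show "\<forall>\<^sub>F t in at_top. sqrt (cos (\<theta> t) ^ 3 * (2 * Wf (\<theta> t) - (v t)\<^sup>2) / Wf (\<theta> t)) = w t"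
        using eventually_ge_at_top[of t1]
      proof eventually_elim
        case (elim t)
        show ?case unfolding man[symmetric] using W[of t] w_nonneg[OF elim] by simp
      qed
    qed
    then have zero: "sqrt (cos l ^ 3 * (2 * Wf l - (- m)\<^sup>2) / Wf l) = 0"
      by (rule derivative_limit_zero[OF l(1) always_eventually, rotated]) (use d\<theta> in auto)
    then have m2: "m\<^sup>2 = 2 * Wf l" using cl W_pos[OF cl] by simp
    have w0: "(w \<longlongrightarrow> 0) at_top" using w_lim unfolding zero .
    show False
    proof (cases "l \<le> \<theta>w")
      case True
      have "- m \<ge> s - G * (l - \<theta> t1)"
      proof (rule tendsto_le[OF _ v_lim])
        show "((\<lambda>t. s - G * (\<theta> t - \<theta> t1)) \<longlongrightarrow> s - G * (l - \<theta> t1)) at_top" by (intro tendsto_intros l(1))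
        show "\<forall>\<^sub>F t in at_top. s - G * (\<theta> t - \<theta> t1) \<le> v t"
          using eventually_ge_at_top[of t1]
        proof eventually_elim
          case (elim t)
          show ?case using l(2)[OF elim] True w_nonneg by (intro descent elim) auto
        qed
      qed simp
      then have "- s < - m" using above[OF True] by linarith
      moreover have "- m < s" using m(2)[of "t1 + 1"] v_less[of "t1 + 1"] by simp
      moreover have "\<bar>l\<bar> \<le> \<theta>w" using True l3 by linarith
      ultimately show False using low[of l "- m"] m2 by simp
    next
      case False
      then have "W' l > 0" using l2 by (intro W'_pos) auto
      have W'_lim: "((\<lambda>t. W' (\<theta> t)) \<longlongrightarrow> W' l) at_top"
        by (rule isCont_tendsto_compose[OF DERIV_isCont[OF W'_deriv[OF cl]] l(1)])
      have U_lim: "((\<lambda>t. Uf (\<theta> t)) \<longlongrightarrow> Uf l) at_top"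
        unfolding U_eq[OF c] U_eq[OF cl] by (intro tendsto_intros W_lim l(1))
      have "Uf l > 0" using W_pos[OF cl] cl by (simp add: U_eq)
      then have "((\<lambda>t. cos (\<theta> t) ^ 3 * v t * w t / (2 * sqrt (Uf (\<theta> t)))
        + W' (\<theta> t) / Wf (\<theta> t) * (cos (\<theta> t) ^ 3 - (w t)\<^sup>2 / 2)
        - 3/2 * (sin (\<theta> t) / cos (\<theta> t)) * (w t)\<^sup>2) \<longlongrightarrow>
          cos l ^ 3 * (- m) * 0 / (2 * sqrt (Uf l))
        + W' l / Wf l * (cos l ^ 3 - 0\<^sup>2 / 2)
        - 3/2 * (sin l / cos l) * 0\<^sup>2) at_top"
        using W_pos[OF cl] cl
        by (intro tendsto_intros cos_lim W_lim v_lim w0 W'_lim U_lim l(1)) auto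
      from derivative_limit_zero[OF w0 always_eventually this] dw
      have "W' l / Wf l * cos l ^ 3 = 0" by simp
      then show False using \<open>W' l > 0\<close> cl W_pos[OF cl] by simp
    qed
  qed
  have \<theta>_lim: "(\<theta> \<longlongrightarrow> pi / 2) at_top" using l(1) unfolding l_eq .
  have "(w \<longlongrightarrow> 0) at_top"
  proof (rule tendsto_sandwich)
    show "((\<lambda>_. 0) \<longlongrightarrow> (0::real)) at_top" by simp
    have "((\<lambda>t. sqrt (2 * cos (\<theta> t) ^ 3)) \<longlongrightarrow> sqrt (2 * cos (pi / 2) ^ 3)) at_top"
      by (intro tendsto_intros \<theta>_lim)
    then show "((\<lambda>t. sqrt (2 * cos (\<theta> t) ^ 3)) \<longlongrightarrow> 0) at_top" by simp
    show "\<forall>\<^sub>F t in at_top. 0 \<le> w t"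
      using eventually_ge_at_top[of t1] by eventually_elim (rule w_nonneg)
    show "\<forall>\<^sub>F t in at_top. w t \<le> sqrt (2 * cos (\<theta> t) ^ 3)"
      by (intro always_eventually allI real_le_rsqrt w_sq_le)
  qed
  then show ?thesis using \<theta>_lim unfolding ends_in_B_plus_def \<theta>_def w_def by simp
qed

text \<open>
  At \<open>\<bar>\<theta>\<bar> = \<theta>\<^sub>w\<close> the bounds \<open>s \<le> v\<close> and \<open>v\<^sup>2 \<le> 2 * W \<theta>\<^sub>w = s\<^sup>2\<close>, for the saddle level \<open>s\<close>, force \<open>v = s\<close>
  and \<open>w = 0\<close>: the orbit would sit in the rest point \<open>E\<^sub>\<plusminus>\<close>, by uniqueness for all earlier times too.
\<close>

lemma not_at_edge:
  assumes lim: "(\<theta> \<longlongrightarrow> 0) at_bot" and v: "\<And>t. t \<le> T \<Longrightarrow> hill.saddle_level \<le> v t" and "t \<le> T"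
  shows "\<bar>\<theta> t\<bar> < \<theta>w"
proof (rule ccontr)
  assume not: "\<not> \<bar>\<theta> t\<bar> < \<theta>w"
  have "\<forall>\<^sub>F t in at_bot. dist (\<theta> t) 0 < \<theta>w" using lim \<theta>w by (intro tendstoD)
  then obtain T0 where T0: "\<And>t. t \<le> T0 \<Longrightarrow> \<bar>\<theta> t\<bar> < \<theta>w"
    by (auto simp: eventually_at_bot_linorder)
  have T0t: "T0 \<le> t" using T0[of t] not by (cases "t \<le> T0") auto
  have cont: "continuous_on {T0..t} (\<lambda>t. - \<bar>\<theta> t\<bar>)" by (intro continuous_intros continuous_coordinates)
  have ends: "- \<bar>\<theta> t\<bar> \<le> - \<theta>w" "- \<theta>w < - \<bar>\<theta> T0\<bar>" using not T0[of T0] by auto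
  obtain t2 where t2: "t2 \<le> t" "- \<bar>\<theta> t2\<bar> = - \<theta>w" "\<And>u. T0 \<le> u \<Longrightarrow> u < t2 \<Longrightarrow> - \<theta>w < - \<bar>\<theta> u\<bar>"
    by (rule first_hit[OF cont T0t ends]) blast
  have le: "\<bar>\<theta> u\<bar> \<le> \<theta>w" if "u \<le> t2" for u
    using T0[of u] t2(2) t2(3)[of u] that by (cases "u \<le> T0"; cases "u = t2") auto
  have vpos: "v u > 0" if "u \<le> t2" for u
    using v[of u] that t2(1) \<open>t \<le> T\<close> hill.saddle_level_pos by simp
  have c: "cos (\<theta> t2) > 0" using le[of t2] by (intro cos_pos_w) simp
  have Weq: "Wf (\<theta> t2) = Wf \<theta>w" using t2(2) W_even[of "\<theta> t2"] by (auto simp: abs_if split: if_splits)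
  have "(v t2)\<^sup>2 \<le> hill.saddle_level\<^sup>2"
    using v_le[OF on_manifold[OF vdefs] c] Weq saddle_level_sq by simp
  moreover have "hill.saddle_level\<^sup>2 \<le> (v t2)\<^sup>2"
    using v[of t2] t2(1) \<open>t \<le> T\<close> hill.saddle_level_pos by (intro power_mono) auto
  ultimately have "(w t2)\<^sup>2 * Wf (\<theta> t2) = 0"
    using manifold_eq[OF on_manifold[OF vdefs] c] Weq saddle_level_sq by simp
  then have "w t2 = 0" using W_pos[OF c] by simp
  then have p: "to_planar (x t2) = (\<theta> t2, 0)"
    by (simp add: to_planar_def x_eq[OF vdefs])
  have "\<theta> t2 = \<theta>w \<or> \<theta> t2 = - \<theta>w" using t2(2) by (auto simp: abs_if split: if_splits)
  then have rest: "hill.field (\<theta> t2, 0) = 0" using hill.field_rest by auto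
  obtain L C where L: "L-lipschitz_on UNIV hill.field" using hill.field_bounded_lipschitz by metis
  define u where "u = min T0 t2"
  have "norm (to_planar (x u) - (\<theta> t2, 0)) \<le> exp (L * (t2 - u)) * norm (to_planar (x t2) - (\<theta> t2, 0))"
    by (rule gronwall_backward[OF L, of _ _ "\<lambda>t. to_planar (x t)" "\<lambda>_. (\<theta> t2, 0)"])
       (use le vpos rest in \<open>auto simp: u_def intro!: to_planar_derivative[OF vdefs]\<close>)
  then have "to_planar (x u) = (\<theta> t2, 0)" using p by simp
  then have "\<theta> u = \<theta> t2" by (simp add: to_planar_def x_eq[OF vdefs])
  then show False using T0[of u] t2(2) by (simp add: u_def)
qed

end

definition mirror :: "real \<times> real \<times> real \<Rightarrow> real \<times> real \<times> real" where
  "mirror = (\<lambda>(v, \<theta>, w). (v, - \<theta>, - w))"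

lemma mirror_trajectory:
  assumes x: "trajectory M B B1 \<mu> x" and c: "\<And>t. cos (fst (snd (x t))) > 0"
  shows "trajectory M B B1 \<mu> (\<lambda>t. mirror (x t))"
  unfolding trajectory_def
proof (intro allI conjI)
  fix t
  obtain v \<theta> w where xt: "x t = (v, \<theta>, w)" by (cases "x t") auto
  have m: "(v, \<theta>, w) \<in> collision_manifold M B B1 \<mu>" using x xt by (metis trajectory_def)
  have U_even: "Uf (- \<theta>) = Uf \<theta>" by (simp add: U_def)
  have m': "(v, - \<theta>, - w) \<in> collision_manifold M B B1 \<mu>"
    using m by (auto simp: collision_manifold_def U_even)
  then show "mirror (x t) \<in> collision_manifold M B B1 \<mu>" by (simp add: mirror_def xt)
  have c\<theta>: "cos \<theta> > 0" using c[of t] xt by simp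
  have "collision_field M B B1 \<mu> (mirror (x t)) = mirror (collision_field M B B1 \<mu> (x t))"
    using field_on_manifold[OF m c\<theta>] field_on_manifold[OF m'] c\<theta>
    by (simp add: mirror_def xt U_even W_even W'_odd)
  moreover have "bounded_linear mirror"
    unfolding mirror_def case_prod_beta
    by (intro bounded_linear_Pair bounded_linear_minus bounded_linear_compose[OF bounded_linear_fst]
        bounded_linear_compose[OF bounded_linear_snd] bounded_linear_fst bounded_linear_snd)
  then have "((\<lambda>t. mirror (x t)) has_vector_derivative mirror (collision_field M B B1 \<mu> (x t))) (at t)"
    by (rule bounded_linear.has_vector_derivative) (use x in \<open>simp add: trajectory_def\<close>)
  ultimately show "((\<lambda>t. mirror (x t)) has_vector_derivative collision_field M B B1 \<mu> (mirror (x t))) (at t)"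
    by simp
qed

lemma left_exit:
  assumes x: "trajectory M B B1 \<mu> x" and c: "\<And>t. cos (fst (snd (x t))) > 0"
    and "fst (x t1) = hill.saddle_level" "snd (snd (x t1)) < 0" "\<bar>fst (snd (x t1))\<bar> < \<theta>w"
    and "\<theta>w * sqrt (2 * Wf 0) \<le> 2 * hill.saddle_level"
  shows "ends_in_B_minus x"
proof -
  have "ends_in_B_plus (\<lambda>t. mirror (x t))"
    by (rule right_exit[OF mirror_trajectory[OF x c] refl refl refl, of t1])
       (use assms in \<open>auto simp: mirror_def case_prod_beta\<close>)
  then have "((\<lambda>t. - fst (snd (x t))) \<longlongrightarrow> pi / 2) at_top" "((\<lambda>t. - snd (snd (x t))) \<longlongrightarrow> 0) at_top"
    by (simp_all add: ends_in_B_plus_def mirror_def case_prod_beta)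
  from this[THEN tendsto_minus] show ?thesis by (simp add: ends_in_B_minus_def)
qed

section \<open>The orbits that emerge from Q\<close>

lemma W_0: "Wf 0 = A * B * (1 + \<gamma>)"
  unfolding W_eq D_def B1_eq by (simp add: algebra_simps)

text \<open>
  The argument \<open>X\<close> of the cosine equals \<open>2 * sqrt (W \<theta>\<^sub>w / W 0)\<close>, and the right hand side is
  \<open>cos\<^sup>2 \<theta>\<^sub>w\<close>. If \<open>0 < X < \<theta>\<^sub>w\<close>, then \<open>cos X > cos \<theta>\<^sub>w > 0\<close>.
\<close>

lemma steep_if_cos_le:
  defines "\<delta> \<equiv> \<gamma> powr (2/5) / (\<mu> - 1) powr (3/5)"
  assumes cos_le: "(cos ((4 / (1 + \<gamma>)) powr (1/2) * (1 - 1 / \<mu>) powr (3/4) * (1 + \<delta>) powr (5/4)))\<^sup>2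
    \<le> 1 / ((1 - 1 / \<mu>) * (1 + \<delta>))"
  shows "\<theta>w * sqrt (2 * Wf 0) \<le> 2 * hill.saddle_level"
proof -
  define X where "X = (4 / (1 + \<gamma>)) powr (1/2) * (1 - 1 / \<mu>) powr (3/4) * (1 + \<delta>) powr (5/4)"
  \<comment> \<open>\<open>1 / q\<close> turns out to be \<open>cos\<^sup>2 \<theta>w\<close>\<close>
  define q where "q = (1 - 1 / \<mu>) * (1 + \<delta>)"
  have \<mu>: "\<mu> > 1" "\<mu> - 1 > 0" "1 - 1 / \<mu> > 0" using \<mu>_gt by simp_all
  have \<delta>: "\<delta> > 0" unfolding \<delta>_def using \<gamma>_pos \<mu>(2) by (intro divide_pos_pos) auto
  have q: "q > 0" using \<mu>(3) \<delta> by (simp add: q_def)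
  have "(\<mu> - 1) powr (2/5) * (\<mu> - 1) powr (3/5) = \<mu> - 1"
    using \<mu>(2) by (simp flip: powr_add)
  moreover have "u * (c / f) = c * e" if "e * f = u" "f > 0" for c e f u :: real
    using that by (simp flip: that(1))
  moreover have "(\<mu> - 1) powr (3/5) > 0" using \<mu>(2) by simp
  ultimately have "(\<mu> - 1) * \<delta> = \<gamma> powr (2/5) * (\<mu> - 1) powr (2/5)"
    unfolding \<delta>_def by blast
  moreover have "((\<mu> - 1) * \<gamma>) powr (2/5) = (\<mu> - 1) powr (2/5) * \<gamma> powr (2/5)"
    using \<gamma>_pos \<mu>(2) by (simp only: powr_mult)
  ultimately have "N = (\<mu> - 1) * (1 + \<delta>)"
    unfolding N_def by (simp only: distrib_left mult_1_right mult_1_left mult.commute)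
  then have cw2: "(cos \<theta>w)\<^sup>2 = 1 / q"
    using \<mu>(1) \<delta> by (simp add: cos_\<theta>w_sq q_def field_simps)
  have cw: "cos \<theta>w > 0" using cos_pos_w[of \<theta>w] \<theta>w by simp
  have "(1 / cos \<theta>w)\<^sup>2 = q" using cw2 by (simp add: power_divide)
  then have "1 / cos \<theta>w = sqrt q" using cw by (intro real_sqrt_unique[symmetric]) auto
  then have "1 / cos \<theta>w = q powr (1/2)" using q by (simp add: powr_half_sqrt)
  then have "(1 / cos \<theta>w) ^ 3 = (q powr (1/2)) powr 3"
    using q by simp
  then have c3: "1 / cos \<theta>w ^ 3 = q powr (3/2)"
    using q by (simp add: powr_powr power_divide)
  have "\<mu> * (1 - 1 / \<mu>) = \<mu> - 1" using \<mu> by (simp add: right_diff_distrib)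
  then have "\<mu> * q = (\<mu> - 1) * (1 + \<delta>)" by (simp add: q_def flip: mult.assoc)
  then have q_eq: "(\<mu> - 1) / q = \<mu> / (1 + \<delta>)" using q \<delta> by (simp add: frac_eq_eq)
  then have "D \<theta>w = \<mu> - \<mu> / (1 + \<delta>)" by (simp add: D_eq cw2)
  also have "\<dots> = \<mu> * \<delta> / (1 + \<delta>)" using \<delta> by (simp add: field_simps)
  also have "\<dots> = (\<mu> - 1) / q * \<delta>" unfolding q_eq by simp
  finally have "D \<theta>w = (\<mu> - 1) * \<delta> / q" by simp
  then have "D \<theta>w powr (3/2) = ((\<mu> - 1) * \<delta>) powr (3/2) / q powr (3/2)"
    using \<mu>(2) \<delta> q by (simp add: powr_divide)
  also have "((\<mu> - 1) * \<delta>) powr (3/2) = \<gamma> / \<delta>"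
  proof -
    have "\<delta> powr (5/2) = \<gamma> / (\<mu> - 1) powr (3/2)"
      using \<gamma>_pos \<mu>(2) by (simp add: \<delta>_def powr_divide powr_powr)
    moreover have "\<delta> powr (5/2) = \<delta> powr (3/2) * \<delta>"
      using \<delta> powr_add[of \<delta> "3/2" 1] by simp
    ultimately have "(\<mu> - 1) powr (3/2) * \<delta> powr (3/2) * \<delta> = \<gamma>"
      using \<mu>(2) by (simp add: field_simps)
    then have "((\<mu> - 1) * \<delta>) powr (3/2) * \<delta> = \<gamma>" using \<mu>(2) \<delta> by (simp only: powr_mult)
    then show ?thesis using \<delta> by (intro eq_divide_imp) auto
  qed
  finally have D: "\<gamma> / D \<theta>w powr (3/2) = \<delta> * q powr (3/2)"
    using \<delta> q D_pos[of \<theta>w] by (simp add: field_simps)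
  have "Wf \<theta>w = A * B * (1 / cos \<theta>w ^ 3 + \<gamma> / D \<theta>w powr (3/2))"
    unfolding W_eq B1_eq by (simp add: algebra_simps)
  then have Ww: "Wf \<theta>w = A * B * ((1 + \<delta>) * q powr (3/2))"
    unfolding c3 D by (simp add: algebra_simps)
  have X0: "X > 0" unfolding X_def using \<gamma>_pos \<mu> \<delta> by (intro mult_pos_pos) auto
  have sq: "(y powr p)\<^sup>2 = y powr (2 * p)" if "y > 0" for y p :: real
    using that by (simp add: power2_eq_square flip: powr_add)
  have "X\<^sup>2 = 4 / (1 + \<gamma>) * (1 - 1 / \<mu>) powr (3/2) * (1 + \<delta>) powr (5/2)"
    using \<gamma>_pos \<mu> \<delta> by (simp add: X_def power_mult_distrib sq)
  also have "(1 + \<delta>) powr (5/2) = (1 + \<delta>) powr (3/2) * (1 + \<delta>)"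
    using \<delta> powr_add[of "1 + \<delta>" "3/2" 1] by simp
  finally have "X\<^sup>2 = 4 / (1 + \<gamma>) * ((1 + \<delta>) * q powr (3/2))"
    using \<mu>(3) \<delta> by (simp add: q_def powr_mult)
  then have X2: "X\<^sup>2 * (1 + \<gamma>) = 4 * ((1 + \<delta>) * q powr (3/2))"
    using \<gamma>_pos by (simp add: field_simps)
  have "X\<^sup>2 * (A * B * (1 + \<gamma>)) = A * B * (X\<^sup>2 * (1 + \<gamma>))" by (simp only: mult_ac)
  also have "\<dots> = 4 * (A * B * ((1 + \<delta>) * q powr (3/2)))" unfolding X2 by (simp only: mult_ac)
  finally have XW: "X\<^sup>2 * Wf 0 = 4 * Wf \<theta>w" unfolding W_0 Ww .
  have "(X * sqrt (2 * Wf 0))\<^sup>2 = 2 * (X\<^sup>2 * Wf 0)"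
    using W_pos[of 0] by (simp add: power_mult_distrib)
  also have "\<dots> = (2 * hill.saddle_level)\<^sup>2"
    unfolding XW power_mult_distrib saddle_level_sq by simp
  finally have "(X * sqrt (2 * Wf 0))\<^sup>2 = (2 * hill.saddle_level)\<^sup>2" .
  then have X: "X * sqrt (2 * Wf 0) = 2 * hill.saddle_level"
    by (rule power2_eq_imp_eq) (use X0 hill.saddle_level_pos W_pos[of 0] in auto)
  have "\<theta>w \<le> X"
  proof (rule ccontr)
    assume "\<not> \<theta>w \<le> X"
    then have "cos \<theta>w < cos X" using X0 \<theta>w by (intro cos_monotone_0_pi) auto
    then have "(cos \<theta>w)\<^sup>2 < (cos X)\<^sup>2" using cw by (intro power_strict_mono) auto
    then show False using cos_le cw2 by (simp add: X_def q_def)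
  qed
  then have "\<theta>w * sqrt (2 * Wf 0) \<le> X * sqrt (2 * Wf 0)"
    using W_pos[of 0] by (intro mult_right_mono) auto
  then show ?thesis using X by simp
qed

lemma from_planar_tendsto:
  fixes y :: "real \<Rightarrow> real \<times> real"
  assumes "(y \<longlongrightarrow> (p, q)) F" "cos p > 0"
  shows "((\<lambda>t. from_planar (y t)) \<longlongrightarrow> from_planar (p, q)) F"
proof -
  have 1: "((\<lambda>t. fst (y t)) \<longlongrightarrow> p) F" and 2: "((\<lambda>t. snd (y t)) \<longlongrightarrow> q) F"
    using tendsto_fst[OF assms(1)] tendsto_snd[OF assms(1)] by simp_all
  have "((\<lambda>t. Wf (fst (y t))) \<longlongrightarrow> Wf p) F"
    by (rule isCont_tendsto_compose[OF W_continuous[OF assms(2)] 1])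
  then show ?thesis unfolding from_planar_def case_prod_beta fst_conv snd_conv speed_def
    by (intro tendsto_Pair tendsto_mult tendsto_real_sqrt tendsto_power tendsto_cos tendsto_sin
        tendsto_const 1 2)
qed

lemma from_planar_rest:
  "from_planar 0 = Q M B B1 \<mu>" "from_planar (\<theta>w, 0) = E_plus M B B1 \<mu> \<gamma>"
  "from_planar (- \<theta>w, 0) = E_minus M B B1 \<mu> \<gamma>"
  by (simp_all add: from_planar_def zero_prod_def Q_def E_plus_def E_minus_def W_even)

lemma to_from_planar:
  assumes "z \<in> hill.strip" shows "to_planar (from_planar z) = z"
proof -
  obtain \<theta> \<psi> where z: "z = (\<theta>, \<psi>)" by fastforce
  have b: "\<bar>\<theta>\<bar> \<le> \<theta>w" "\<bar>\<psi>\<bar> \<le> pi / 2" using assms by (auto simp: z hill.strip_def)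
  have "speed \<theta> > 0" using speed_sq[OF cos_pos_w[OF b(1)]] by simp
  then show ?thesis using b(2) by (simp add: z to_planar_def from_planar_def arcsin_sin abs_le_iff)
qed

text \<open>
  Either \<open>v\<close> stays above the saddle level forever, and the orbit is one of the planar system that ends
  at a saddle; or it comes down to that level, and there \<open>\<bar>\<theta>\<bar> < \<theta>\<^sub>w\<close> gives \<open>2 * W \<theta> > v\<^sup>2\<close>, that is
  \<open>w \<noteq> 0\<close>, so one of the two exit lemmas applies.
\<close>

lemma emergent_orbits:
  assumes steep: "\<theta>w * sqrt (2 * Wf 0) \<le> 2 * hill.saddle_level"
    and x: "trajectory M B B1 \<mu> x" and em: "emerges_from x (Q M B B1 \<mu>)"
  shows "ends_in_B_plus x \<or> ends_in_B_minus x \<or>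
    (\<exists>z. hill.solution z \<and> (\<forall>t. z t \<in> hill.strip) \<and> x = (\<lambda>t. from_planar (z t)) \<and>
      ((z \<longlongrightarrow> (\<theta>w, 0)) at_top \<or> (z \<longlongrightarrow> (- \<theta>w, 0)) at_top))"
proof -
  define v where "v t = fst (x t)" for t
  define \<theta> where "\<theta> t = fst (snd (x t))" for t
  define w where "w t = snd (snd (x t))" for t
  have defs: "v = (\<lambda>t. fst (x t))" "\<theta> = (\<lambda>t. fst (snd (x t)))" "w = (\<lambda>t. snd (snd (x t)))"
    by (simp_all add: v_def \<theta>_def w_def fun_eq_iff)
  note vd = x defs
  define s where "s = hill.saddle_level"
  have s: "s > 0" using hill.saddle_level_pos by (simp add: s_def)
  have lim: "(x \<longlongrightarrow> (sqrt (2 * Wf 0), 0, 0)) at_bot" using em by (simp add: emerges_from_def Q_def)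
  have v_lim: "(v \<longlongrightarrow> sqrt (2 * Wf 0)) at_bot" using tendsto_fst[OF lim] by (simp add: defs)
  have \<theta>_lim: "(\<theta> \<longlongrightarrow> 0) at_bot" using tendsto_fst[OF tendsto_snd[OF lim]] by (simp add: defs)
  have top: "s < sqrt (2 * Wf 0)"
    using hill.P_less[of 0 \<theta>w] \<theta>w by (simp add: s_def hill.saddle_level_def)
  have "\<forall>\<^sub>F t in at_bot. dist (\<theta> t) 0 < \<theta>w" using \<theta>_lim \<theta>w by (intro tendstoD)
  then obtain T0 where T0: "\<And>t. t \<le> T0 \<Longrightarrow> \<bar>\<theta> t\<bar> < \<theta>w" by (auto simp: eventually_at_bot_linorder)
  have c: "cos (\<theta> t) > 0" for t
  proof (cases "t \<le> T0")
    case True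
    then show ?thesis using T0 by (intro cos_pos_w) (simp add: less_imp_le)
  next
    case False
    have "cos (\<theta> T0) > 0" using T0[of T0] by (intro cos_pos_w) simp
    then show ?thesis by (rule interior_forward[OF vd]) (use False in simp)
  qed
  have c': "cos (fst (snd (x t))) > 0" for t using c[of t] by (simp add: \<theta>_def)
  obtain T1 where T1: "\<And>t. t \<le> T1 \<Longrightarrow> s < v t"
    using order_tendstoD(1)[OF v_lim top] by (auto simp: eventually_at_bot_linorder)
  show ?thesis
  proof (cases "\<forall>t. s \<le> v t")
    case True
    have \<theta>: "\<bar>\<theta> t\<bar> < \<theta>w" for t
      by (rule not_at_edge[OF vd \<theta>_lim, of t]) (use True in \<open>auto simp: s_def\<close>)
    have v: "v t > 0" for t using True s by (auto intro: less_le_trans)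
    define z where "z t = to_planar (x t)" for t
    have z: "hill.solution z"
      unfolding hill.solution_def z_def using \<theta> v
      by (auto intro!: to_planar_derivative[OF vd] simp: less_imp_le)
    have strip: "z t \<in> hill.strip" for t
      using to_planar_point(4)[OF on_manifold[OF vd] c v, of t] \<theta>[of t]
      by (auto simp: z_def to_planar_def x_eq[OF vd] hill.strip_def)
    have x_z: "x t = from_planar (z t)" for t
    proof -
      have "x t \<in> collision_manifold M B B1 \<mu>" using x by (simp add: trajectory_def)
      moreover have "fst (x t) > 0" using v[of t] by (simp add: v_def)
      ultimately show ?thesis unfolding z_def using from_to_planar c' by simp
    qed
    have energy: "hill.energy (z t) = v t" for t
    proof -
      have "hill.clamp (fst (z t)) = fst (z t)" using strip[of t] by (intro hill.clamp_id) (auto simp: hill.strip_def)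
      then have "hill.energy (z t) = fst (from_planar (z t))"
        by (simp add: hill.energy_def from_planar_def case_prod_beta)
      then show ?thesis by (simp add: v_def flip: x_z)
    qed
    \<comment> \<open>at time \<open>T1\<close> the orbit is strictly above the saddle level, as \<open>ends_at_saddle\<close> requires\<close>
    have shifted: "hill.solution (\<lambda>t. z (t + T1))" by (rule hill.solution_shift[OF z])
    have nz: "z T1 \<noteq> 0"
    proof
      assume "z T1 = 0"
      moreover have "hill.field 0 = 0" using hill.field_rest(3) by (simp add: zero_prod_def)
      then have "hill.solution (\<lambda>_. 0)" by (simp add: hill.solution_def)
      ultimately have "z = (\<lambda>_. 0)" by (intro hill.solution_unique[OF z]) auto
      then have "x constant_on UNIV"
        unfolding constant_on_def by (intro exI[of _ "from_planar 0"]) (simp add: x_z)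
      then show False using em by (simp add: emerges_from_def)
    qed
    have "((\<lambda>t. z (t + T1)) \<longlongrightarrow> (\<theta>w, 0)) at_top \<or> ((\<lambda>t. z (t + T1)) \<longlongrightarrow> (- \<theta>w, 0)) at_top"
      by (rule hill.ends_at_saddle[OF shifted])
         (use strip T1[of T1] True nz in \<open>auto simp: hill.cap_def energy s_def\<close>)
    moreover have "(z \<longlongrightarrow> p) at_top" if "((\<lambda>t. z (t + T1)) \<longlongrightarrow> p) at_top" for p
    proof -
      have "filterlim (\<lambda>t. t - T1) at_top (at_top :: real filter)"
        using filterlim_tendsto_add_at_top[OF tendsto_const[of "- T1"] filterlim_ident] by simp
      from filterlim_compose[OF that this] show ?thesis by simp
    qed
    ultimately have "(z \<longlongrightarrow> (\<theta>w, 0)) at_top \<or> (z \<longlongrightarrow> (- \<theta>w, 0)) at_top" by blast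
    then show ?thesis using z strip x_z by (intro disjI2 exI[of _ z]) auto
  next
    case False
    then obtain t0 where t0: "v t0 < s" by (auto simp: not_le)
    have T1t0: "T1 \<le> t0" using T1[of t0] t0 by (cases "t0 \<le> T1") auto
    then obtain t1 where t1: "v t1 = s" "\<And>u. T1 \<le> u \<Longrightarrow> u < t1 \<Longrightarrow> s < v u"
      using first_hit[OF continuous_coordinates(1)[OF vd] T1t0 less_imp_le[OF t0] T1[OF order_refl]] by blast
    have above: "hill.saddle_level \<le> v t" if "t \<le> t1" for t
      using T1[of t] t1(1) t1(2)[of t] that by (cases "t \<le> T1"; cases "t = t1") (auto simp: s_def)
    have \<theta>1: "\<bar>\<theta> t1\<bar> < \<theta>w" by (rule not_at_edge[OF vd \<theta>_lim above]) auto
    have "Wf \<theta>w < Wf (\<theta> t1)" using hill.P_less[of "\<theta> t1" \<theta>w] \<theta>1 \<theta>w by simp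
    then have "(v t1)\<^sup>2 < 2 * Wf (\<theta> t1)" using saddle_level_sq t1(1) by (simp add: s_def)
    then have "(w t1)\<^sup>2 * Wf (\<theta> t1) > 0"
      unfolding manifold_eq[OF on_manifold[OF vd] c] using c[of t1] by simp
    then have "w t1 \<noteq> 0" by auto
    then consider "w t1 > 0" | "w t1 < 0" by linarith
    then show ?thesis
    proof cases
      case 1
      have "ends_in_B_plus x"
        by (rule right_exit[OF vd c]) (use t1(1) 1 \<theta>1 steep in \<open>auto simp: s_def\<close>)
      then show ?thesis ..
    next
      case 2
      have "ends_in_B_minus x"
        by (rule left_exit[OF x c', of t1]) (use t1(1) 2 \<theta>1 steep in \<open>auto simp: s_def v_def \<theta>_def w_def\<close>)
      then show ?thesis by simp
    qed
  qed
qed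

theorem two_exceptional_orbits:
  assumes steep: "\<theta>w * sqrt (2 * Wf 0) \<le> 2 * hill.saddle_level"
  shows "\<exists>x\<^sub>p x\<^sub>m.
      trajectory M B B1 \<mu> x\<^sub>p \<and> emerges_from x\<^sub>p (Q M B B1 \<mu>) \<and> ends_in x\<^sub>p (E_plus M B B1 \<mu> \<gamma>) \<and>
      trajectory M B B1 \<mu> x\<^sub>m \<and> emerges_from x\<^sub>m (Q M B B1 \<mu>) \<and> ends_in x\<^sub>m (E_minus M B B1 \<mu> \<gamma>) \<and>
      range x\<^sub>p \<noteq> range x\<^sub>m \<and>
      (\<forall>x. trajectory M B B1 \<mu> x \<and> emerges_from x (Q M B B1 \<mu>) \<and>
           range x \<noteq> range x\<^sub>p \<and> range x \<noteq> range x\<^sub>m \<longrightarrow>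
           ends_in_B_plus x \<or> ends_in_B_minus x)"
proof -
  obtain z where z: "hill.solution z" "\<And>t. z t \<in> hill.cap"
      "(z \<longlongrightarrow> 0) at_bot" "(z \<longlongrightarrow> (\<theta>w, 0)) at_top"
    by (rule hill.connection_exists) blast
  define z' where "z' t = - z t" for t
  have strip: "z t \<in> hill.strip" for t using z(2) by (simp add: hill.cap_def)
  then have strip': "z' t \<in> hill.strip" for t
    unfolding z'_def by (cases "z t") (use strip[of t] in \<open>auto simp: hill.strip_def\<close>)
  have z': "hill.solution z'" unfolding z'_def by (rule hill.solution_minus[OF z(1)])
  have z'_bot: "(z' \<longlongrightarrow> 0) at_bot" using tendsto_minus[OF z(3)] by (simp add: z'_def[abs_def])
  have z'_top: "(z' \<longlongrightarrow> (- \<theta>w, 0)) at_top" using tendsto_minus[OF z(4)] by (simp add: z'_def[abs_def])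
  define xp where "xp t = from_planar (z t)" for t
  define xm where "xm t = from_planar (z' t)" for t
  have cw: "cos \<theta>w > 0" "cos (- \<theta>w) > 0" using cos_pos_w[of \<theta>w] \<theta>w by auto
  have bot: "((\<lambda>t. from_planar (y t)) \<longlongrightarrow> Q M B B1 \<mu>) at_bot" if "(y \<longlongrightarrow> 0) at_bot" for y :: "real \<Rightarrow> real \<times> real"
    using from_planar_tendsto[of y 0 0 at_bot] that from_planar_rest(1) by (simp add: zero_prod_def)
  have emerges: "emerges_from x (Q M B B1 \<mu>)"
    if "(x \<longlongrightarrow> Q M B B1 \<mu>) at_bot" "(x \<longlongrightarrow> E) at_top" "E \<noteq> Q M B B1 \<mu>" for x E
  proof -
    have "\<not> x constant_on UNIV"
    proof
      assume "x constant_on UNIV"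
      then obtain k where "x = (\<lambda>_. k)" by (auto simp: constant_on_def fun_eq_iff)
      then have k: "((\<lambda>_ :: real. k) \<longlongrightarrow> Q M B B1 \<mu>) at_bot" "((\<lambda>_ :: real. k) \<longlongrightarrow> E) at_top"
        using that(1,2) by auto
      have "k = Q M B B1 \<mu>" by (rule tendsto_unique[OF _ tendsto_const k(1)]) simp
      moreover have "k = E" by (rule tendsto_unique[OF _ tendsto_const k(2)]) simp
      ultimately show False using that(3) by simp
    qed
    then show ?thesis using that(1) by (simp add: emerges_from_def)
  qed
  have end_p: "ends_in xp (E_plus M B B1 \<mu> \<gamma>)"
    using from_planar_tendsto[OF z(4) cw(1)] by (simp add: ends_in_def xp_def[abs_def] from_planar_rest)
  have end_m: "ends_in xm (E_minus M B B1 \<mu> \<gamma>)"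
    using from_planar_tendsto[OF z'_top cw(2)] by (simp add: ends_in_def xm_def[abs_def] from_planar_rest)
  have tr_p: "trajectory M B B1 \<mu> xp"
    using trajectory_from_planar[OF z(1) strip] by (simp add: xp_def[abs_def])
  have tr_m: "trajectory M B B1 \<mu> xm"
    using trajectory_from_planar[OF z' strip'] by (simp add: xm_def[abs_def])
  have em_p: "emerges_from xp (Q M B B1 \<mu>)"
    by (rule emerges) (use bot[OF z(3)] end_p \<theta>w in \<open>auto simp: xp_def[abs_def] ends_in_def E_plus_def Q_def\<close>)
  have em_m: "emerges_from xm (Q M B B1 \<mu>)"
    by (rule emerges) (use bot[OF z'_bot] end_m \<theta>w in \<open>auto simp: xm_def[abs_def] ends_in_def E_minus_def Q_def\<close>)
  have ne: "range xp \<noteq> range xm"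
  proof
    assume "range xp = range xm"
    then obtain s where "xp 0 = xm s" by (metis rangeE rangeI)
    then have "z 0 = z' s" using to_from_planar strip strip' by (metis xp_def xm_def)
    then have "z = (\<lambda>t. z' (t + s))" by (intro hill.solution_unique[OF z(1) hill.solution_shift[OF z'], of 0]) simp
    moreover have "((\<lambda>t. z' (t + s)) \<longlongrightarrow> (- \<theta>w, 0)) at_top"
      by (rule filterlim_compose[OF z'_top]) (rule filterlim_tendsto_add_at_top[OF tendsto_const filterlim_ident, of s, simplified add.commute])
    ultimately have "(\<theta>w, 0) = (- \<theta>w, 0 :: real)" using z(4) tendsto_unique[of at_top z] by (metis trivial_limit_at_top_linorder)
    then show False using \<theta>w by simp
  qed
  have rest: "ends_in_B_plus x \<or> ends_in_B_minus x"
    if x: "trajectory M B B1 \<mu> x" "emerges_from x (Q M B B1 \<mu>)"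
      and other: "range x \<noteq> range xp" "range x \<noteq> range xm" for x
  proof (rule ccontr)
    assume "\<not> (ends_in_B_plus x \<or> ends_in_B_minus x)"
    then obtain y where y: "hill.solution y" "\<And>t. y t \<in> hill.strip" "x = (\<lambda>t. from_planar (y t))"
        "(y \<longlongrightarrow> (\<theta>w, 0)) at_top \<or> (y \<longlongrightarrow> (- \<theta>w, 0)) at_top"
      using emergent_orbits[OF steep x] by blast
    have range_shift: "range (\<lambda>t. f (t + s)) = range f" for f :: "real \<Rightarrow> real \<times> real \<times> real" and s
      by (auto simp: image_iff) (metis diff_add_cancel)
    from y(4) show False
    proof
      assume "(y \<longlongrightarrow> (\<theta>w, 0)) at_top"
      then obtain s where "\<And>t. y t = z (t + s)"
        using hill.connection_unique[OF y(1,2) _ z(1) strip z(4)] by blast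
      then have "x = (\<lambda>t. xp (t + s))" by (simp add: y(3) xp_def fun_eq_iff)
      then show False using other(1) range_shift[of xp s] by simp
    next
      assume "(y \<longlongrightarrow> (- \<theta>w, 0)) at_top"
      then have "((\<lambda>t. - y t) \<longlongrightarrow> (\<theta>w, 0)) at_top" using tendsto_minus by fastforce
      moreover have "- y t \<in> hill.strip" for t using y(2)[of t] by (cases "y t") (auto simp: hill.strip_def)
      ultimately obtain s where s: "\<And>t. - y t = z (t + s)"
        using hill.connection_unique[OF hill.solution_minus[OF y(1)] _ _ z(1) strip z(4)] by blast
      then have "y t = z' (t + s)" for t by (metis s z'_def minus_minus)
      then have "x = (\<lambda>t. xm (t + s))" by (simp add: y(3) xm_def fun_eq_iff)
      then show False using other(2) range_shift[of xm s] by simp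
    qed
  qed
  show ?thesis
    by (rule exI[of _ xp], rule exI[of _ xm])
       (intro conjI allI impI tr_p em_p end_p tr_m em_m end_m ne; elim conjE; rule rest)
qed

end

theorem corollary4:
  fixes M m A A1 B B1 \<mu> \<gamma> :: real
  assumes "M > 0" "m > 0" "A > 0" "A1 > 0" "B > 0" "B1 > 0"
    and "\<mu> = (2 * M + m) / m"
    and "\<gamma> = 16 * B1 / B"
    and "\<mu> > 1 + A / (4 * A1)"
    and "\<mu> > 1 + B / (16 * B1)"
    and "(\<mu> - 1) powr (4/15) * (4 * A1 / A) powr (2/3) \<noteq> (16 * B1 / B) powr (2/5)"
    and "(cos ((4 / (1 + \<gamma>)) powr (1/2) * (1 - 1 / \<mu>) powr (3/4)
               * (1 + \<gamma> powr (2/5) / (\<mu> - 1) powr (3/5)) powr (5/4)))\<^sup>2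
         \<le> 1 / ((1 - 1 / \<mu>) * (1 + \<gamma> powr (2/5) / (\<mu> - 1) powr (3/5)))"
  shows "\<exists>x\<^sub>p x\<^sub>m.
      trajectory M B B1 \<mu> x\<^sub>p \<and> emerges_from x\<^sub>p (Q M B B1 \<mu>) \<and> ends_in x\<^sub>p (E_plus M B B1 \<mu> \<gamma>) \<and>
      trajectory M B B1 \<mu> x\<^sub>m \<and> emerges_from x\<^sub>m (Q M B B1 \<mu>) \<and> ends_in x\<^sub>m (E_minus M B B1 \<mu> \<gamma>) \<and>
      range x\<^sub>p \<noteq> range x\<^sub>m \<and>
      (\<forall>x. trajectory M B B1 \<mu> x \<and> emerges_from x (Q M B B1 \<mu>) \<and>
           range x \<noteq> range x\<^sub>p \<and> range x \<noteq> range x\<^sub>m \<longrightarrow>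
           ends_in_B_plus x \<or> ends_in_B_minus x)"
proof -
  have "B / (16 * B1) > 0" using assms(5,6) by simp
  then have "\<mu> > 1" using assms(10) by linarith
  then interpret collision M B B1 \<mu> \<gamma>
    using assms(1,5,6,8,10) by unfold_locales auto
  show ?thesis by (rule two_exceptional_orbits[OF steep_if_cos_le[OF assms(12)]])
qed

end
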